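(* Let $\nu\in[0,1)$ and $0<b<\infty$, and let $A_{\nu,b}$ be the Bessel operator in $L^2(0,b)$ acting as $\tau_\nu=-\frac{d^2}{dx^2}+\frac{\nu^2-1/4}{x^2}$ on the domain $\{f\in H^2[0,b]: f(0)=f'(0)=f(b)=0\}$. Let $\{\mathbb C,\Gamma_0^{\nu,b},\Gamma_1^{\nu,b}\}$ be the boundary triplet for $A_{\nu,b}^*$ given by $\Gamma_0^{\nu,b}f=[f,x^{1/2+\nu}]_0$ and $\Gamma_1^{\nu,b}f=-(2\nu)^{-1}[f,x^{1/2-\nu}]_0$ if $\nu\in(0,1)$, $\Gamma_1^{0,b}f=[f,x^{1/2}\log(x)]_0$ if $\nu=0$. Then: (i) The domain of the Friedrichs extension $(A_{\nu,b})_F$ of $A_{\nu,b}$ is $$\operatorname{dom}((A_{\nu,b})_F)=\ker(\Gamma_0^{\nu,b})=\{f\in\operatorname{dom}(A_{\nu,b}^* ): [f,x^{1/2+\nu}]_0=0\}.$$ (ii) The domain of the Krein extension $(A_{\nu,b})_K$ of $A_{\nu,b}$ is $$\operatorname{dom}((A_{\nu,b})_K)=\begin{cases}\{f\in\operatorname{dom}(A_{\nu,b}^* ): (2\nu)^{-1}[f,\,b^{-2\nu}x^{1/2+\nu}-x^{1/2-\nu}]_0=0\}, & \nu\in(0,1),\\ \{f\in\operatorname{dom}(A_{0,b}^* ): [f,\,x^{1/2}\log(x/b)]_0=0\}, & \nu=0.\end{cases}$$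
   Context: $[f,g]_x=f(x)\overline{g'(x)}-f'(x)\overline{g(x)}$ and $[f,g]_0=\lim_{x\to0^+}[f,g]_x$. For a densely defined nonnegative symmetric operator $A$, the Friedrichs extension $A_F$ and the Krein extension $A_K$ are the maximal and minimal nonnegative self-adjoint extensions: $(A_F+x)^{-1}\le(\widetilde A+x)^{-1}\le(A_K+x)^{-1}$ for all $x>0$ and all nonnegative self-adjoint extensions $\widetilde A$ of $A$. Boundary triplet: $\{\mathcal H,\Gamma_0,\Gamma_1\}$ is a boundary triplet for $A^*$ if $\mathcal H$ is a Hilbert space, $\Gamma_0,\Gamma_1:\operatorname{dom}(A^* )\to\mathcal H$ are linear, $(A^*f,g)-(f,A^*g)=(\Gamma_1f,\Gamma_0g)_{\mathcal H}-(\Gamma_0f,\Gamma_1g)_{\mathcal H}$ for all $f,g\in\operatorname{dom}(A^* )$, and $f\mapsto(\Gamma_0f,\Gamma_1f)$ is surjective onto $\mathcal H\oplus\mathcal H$. *)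

theory Defs
  imports "HOL-Analysis.Analysis"
begin

section \<open>Square integrable functions\<close>

text \<open>Elements of the Hilbert space \<open>L\<^sup>2(M)\<close> are represented by functions; equality in \<open>L\<^sup>2(M)\<close> is
  equality almost everywhere.\<close>

definition L2 :: "'a measure \<Rightarrow> ('a \<Rightarrow> complex) set" where
  "L2 M = {f \<in> borel_measurable M. integrable M (\<lambda>x. (cmod (f x))\<^sup>2)}"

definition ae_equal :: "'a measure \<Rightarrow> ('a \<Rightarrow> complex) \<Rightarrow> ('a \<Rightarrow> complex) \<Rightarrow> bool" where
  "ae_equal M f g \<longleftrightarrow> (AE x in M. f x = g x)"

definition l2_inner :: "'a measure \<Rightarrow> ('a \<Rightarrow> complex) \<Rightarrow> ('a \<Rightarrow> complex) \<Rightarrow> complex" where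
  "l2_inner M f g = (LINT x|M. f x * cnj (g x))"

definition l2_norm :: "'a measure \<Rightarrow> ('a \<Rightarrow> complex) \<Rightarrow> real" where
  "l2_norm M f = sqrt (LINT x|M. (cmod (f x))\<^sup>2)"


section \<open>Unbounded operators in \<open>L\<^sup>2(M)\<close>\<close>

text \<open>An operator is given by its graph, a set of pairs of functions that is saturated with respect
  to equality almost everywhere. Its domain is \<^const>\<open>Domain\<close> of the graph, and \<open>\<subseteq>\<close> between graphs
  is extension of operators.\<close>

type_synonym 'a op_graph = "(('a \<Rightarrow> complex) \<times> ('a \<Rightarrow> complex)) set"

definition linear_operator :: "'a measure \<Rightarrow> 'a op_graph \<Rightarrow> bool" where
  "linear_operator M T \<longleftrightarrow>
     T \<subseteq> L2 M \<times> L2 M \<and>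
     (\<lambda>x. 0, \<lambda>x. 0) \<in> T \<and>
     (\<forall>(f, g)\<in>T. \<forall>(f', g')\<in>T. (\<lambda>x. f x + f' x, \<lambda>x. g x + g' x) \<in> T) \<and>
     (\<forall>(f, g)\<in>T. \<forall>c. (\<lambda>x. c * f x, \<lambda>x. c * g x) \<in> T) \<and>
     (\<forall>(f, g)\<in>T. \<forall>f' g'. ae_equal M f f' \<longrightarrow> ae_equal M g g' \<longrightarrow> (f', g') \<in> T) \<and>
     (\<forall>(f, g)\<in>T. \<forall>(f', g')\<in>T. ae_equal M f f' \<longrightarrow> ae_equal M g g')"

definition densely_defined :: "'a measure \<Rightarrow> 'a op_graph \<Rightarrow> bool" where
  "densely_defined M T \<longleftrightarrow>
     (\<forall>f\<in>L2 M. \<forall>e>0. \<exists>u\<in>Domain T. l2_norm M (\<lambda>x. f x - u x) < e)"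

definition op_adjoint :: "'a measure \<Rightarrow> 'a op_graph \<Rightarrow> 'a op_graph" where
  "op_adjoint M T =
     {(f, g). f \<in> L2 M \<and> g \<in> L2 M \<and> (\<forall>(u, v)\<in>T. l2_inner M v f = l2_inner M u g)}"

definition nonneg_operator :: "'a measure \<Rightarrow> 'a op_graph \<Rightarrow> bool" where
  "nonneg_operator M T \<longleftrightarrow> (\<forall>(f, g)\<in>T. l2_inner M g f \<in> \<real>\<^sub>\<ge>\<^sub>0)"

definition nonneg_symmetric :: "'a measure \<Rightarrow> 'a op_graph \<Rightarrow> bool" where
  "nonneg_symmetric M T \<longleftrightarrow>
     linear_operator M T \<and> densely_defined M T \<and> T \<subseteq> op_adjoint M T \<and> nonneg_operator M T"

definition nonneg_selfadjoint_extension :: "'a measure \<Rightarrow> 'a op_graph \<Rightarrow> 'a op_graph \<Rightarrow> bool" where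
  "nonneg_selfadjoint_extension M T S \<longleftrightarrow>
     T \<subseteq> S \<and> linear_operator M S \<and> densely_defined M S \<and> S = op_adjoint M S \<and> nonneg_operator M S"

text \<open>The graph of \<open>(S + c)\<^sup>-\<^sup>1\<close>.\<close>

definition shifted_inverse :: "real \<Rightarrow> 'a op_graph \<Rightarrow> 'a op_graph" where
  "shifted_inverse c S = {(\<lambda>x. g x + of_real c * f x, f) | f g. (f, g) \<in> S}"

text \<open>The order of bounded self-adjoint operators. It is used only for \<open>(S + c)\<^sup>-\<^sup>1\<close> with \<open>S\<close>
  nonnegative self-adjoint and \<open>c > 0\<close>; these are defined on all of \<open>L\<^sup>2(M)\<close>, and their
  quadratic forms are real.\<close>

definition op_le :: "'a measure \<Rightarrow> 'a op_graph \<Rightarrow> 'a op_graph \<Rightarrow> bool" where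
  "op_le M R R' \<longleftrightarrow>
     (\<forall>h f f'. (h, f) \<in> R \<longrightarrow> (h, f') \<in> R' \<longrightarrow> Re (l2_inner M f h) \<le> Re (l2_inner M f' h))"

definition is_Friedrichs_extension :: "'a measure \<Rightarrow> 'a op_graph \<Rightarrow> 'a op_graph \<Rightarrow> bool" where
  "is_Friedrichs_extension M T S \<longleftrightarrow>
     nonneg_symmetric M T \<and> nonneg_selfadjoint_extension M T S \<and>
     (\<forall>S'. nonneg_selfadjoint_extension M T S' \<longrightarrow>
        (\<forall>c>0. op_le M (shifted_inverse c S) (shifted_inverse c S')))"

definition is_Krein_extension :: "'a measure \<Rightarrow> 'a op_graph \<Rightarrow> 'a op_graph \<Rightarrow> bool" where
  "is_Krein_extension M T S \<longleftrightarrow>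
     nonneg_symmetric M T \<and> nonneg_selfadjoint_extension M T S \<and>
     (\<forall>S'. nonneg_selfadjoint_extension M T S' \<longrightarrow>
        (\<forall>c>0. op_le M (shifted_inverse c S') (shifted_inverse c S)))"

definition Friedrichs_extension :: "'a measure \<Rightarrow> 'a op_graph \<Rightarrow> 'a op_graph" where
  "Friedrichs_extension M T = (THE S. is_Friedrichs_extension M T S)"

definition Krein_extension :: "'a measure \<Rightarrow> 'a op_graph \<Rightarrow> 'a op_graph" where
  "Krein_extension M T = (THE S. is_Krein_extension M T S)"

text \<open>Boundary triplets \<open>{\<H>, \<Gamma>\<^sub>0, \<Gamma>\<^sub>1}\<close> for \<open>T\<^sup>*\<close>, in the case \<open>\<H> = \<complex>\<close> with inner product
  \<open>(a, b) = a * cnj b\<close>. The first condition says that the boundary maps are well defined on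
  classes of functions.\<close>

definition complex_boundary_triplet ::
  "'a measure \<Rightarrow> 'a op_graph \<Rightarrow> (('a \<Rightarrow> complex) \<Rightarrow> complex) \<Rightarrow> (('a \<Rightarrow> complex) \<Rightarrow> complex) \<Rightarrow> bool" where
  "complex_boundary_triplet M T \<Gamma>0 \<Gamma>1 \<longleftrightarrow>
     (\<forall>\<Gamma>\<in>{\<Gamma>0, \<Gamma>1}. \<forall>f\<in>Domain (op_adjoint M T). \<forall>g\<in>Domain (op_adjoint M T).
        (ae_equal M f g \<longrightarrow> \<Gamma> f = \<Gamma> g) \<and>
        \<Gamma> (\<lambda>x. f x + g x) = \<Gamma> f + \<Gamma> g \<and>
        (\<forall>c. \<Gamma> (\<lambda>x. c * f x) = c * \<Gamma> f)) \<and>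
     (\<forall>(f, f')\<in>op_adjoint M T. \<forall>(g, g')\<in>op_adjoint M T.
        l2_inner M f' g - l2_inner M f g' = \<Gamma>1 f * cnj (\<Gamma>0 g) - \<Gamma>0 f * cnj (\<Gamma>1 g)) \<and>
     (\<lambda>f. (\<Gamma>0 f, \<Gamma>1 f)) ` Domain (op_adjoint M T) = UNIV"


section \<open>The Bessel operator on \<open>(0, b)\<close>\<close>

abbreviation lebesgue_Ioo0 :: "real \<Rightarrow> real measure" where
  "lebesgue_Ioo0 b \<equiv> lebesgue_on {0<..<b}"

text \<open>\<open>f \<in> H\<^sup>2[0,b]\<close> with (continuous) derivative \<open>f1\<close> and second weak derivative \<open>f2\<close>: both \<open>f\<close> and
  \<open>f1\<close> are absolutely continuous on \<open>[0,b]\<close>, expressed as indefinite integrals.\<close>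

definition H2_function ::
  "real \<Rightarrow> (real \<Rightarrow> complex) \<Rightarrow> (real \<Rightarrow> complex) \<Rightarrow> (real \<Rightarrow> complex) \<Rightarrow> bool" where
  "H2_function b f f1 f2 \<longleftrightarrow>
     f2 \<in> L2 (lebesgue_Ioo0 b) \<and>
     (\<forall>x\<in>{0..b}. f1 x = f1 0 + (LINT t|lebesgue_on {0..x}. f2 t)) \<and>
     (\<forall>x\<in>{0..b}. f x = f 0 + (LINT t|lebesgue_on {0..x}. f1 t))"

text \<open>No integrability condition on \<open>v\<close> is needed: \<open>f x / x\<^sup>2\<close> is square integrable by Hardy's
  inequality, since \<open>f 0 = f1 0 = 0\<close>.\<close>

definition bessel_operator :: "real \<Rightarrow> real \<Rightarrow> real op_graph" where
  "bessel_operator \<nu> b =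
     {(u, v). \<exists>f f1 f2. H2_function b f f1 f2 \<and> f 0 = 0 \<and> f1 0 = 0 \<and> f b = 0 \<and>
        ae_equal (lebesgue_Ioo0 b) u f \<and>
        ae_equal (lebesgue_Ioo0 b) v
          (\<lambda>x. - f2 x + of_real ((\<nu>\<^sup>2 - 1/4) / x\<^sup>2) * f x)}"

text \<open>Pointwise values and derivatives of an element of the domain of the adjoint refer to its
  continuously differentiable representative, which is unique on \<open>(0,b)\<close>.\<close>

definition C1_rep :: "real \<Rightarrow> (real \<Rightarrow> complex) \<Rightarrow> (real \<Rightarrow> complex)" where
  "C1_rep b f = (SOME h. h C1_differentiable_on {0<..<b} \<and> ae_equal (lebesgue_Ioo0 b) f h)"

definition lagrange_bracket :: "(real \<Rightarrow> complex) \<Rightarrow> (real \<Rightarrow> complex) \<Rightarrow> real \<Rightarrow> complex" where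
  "lagrange_bracket f g x =
     f x * cnj (vector_derivative g (at x)) - vector_derivative f (at x) * cnj (g x)"

definition bracket0 :: "real \<Rightarrow> (real \<Rightarrow> complex) \<Rightarrow> (real \<Rightarrow> complex) \<Rightarrow> complex" where
  "bracket0 b f g = Lim (at_right 0) (lagrange_bracket (C1_rep b f) g)"

definition Gamma0 :: "real \<Rightarrow> real \<Rightarrow> (real \<Rightarrow> complex) \<Rightarrow> complex" where
  "Gamma0 \<nu> b f = bracket0 b f (\<lambda>x. of_real (x powr (1/2 + \<nu>)))"

definition Gamma1 :: "real \<Rightarrow> real \<Rightarrow> (real \<Rightarrow> complex) \<Rightarrow> complex" where
  "Gamma1 \<nu> b f =
     (if \<nu> = 0 then bracket0 b f (\<lambda>x. of_real (x powr (1/2) * ln x))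
      else - inverse (of_real (2 * \<nu>)) * bracket0 b f (\<lambda>x. of_real (x powr (1/2 - \<nu>))))"

end

theory Submission
  imports Defs
begin

text \<open>
  Put \<open>u x = x powr (1/2 + \<nu>)\<close> and let \<open>k = u \<rho>\<close>, where \<open>\<rho> x\<close> is the integral of \<open>1 / u\<^sup>2\<close> from \<open>x\<close> to
  \<open>b\<close>. Both functions are annihilated by \<open>\<tau>\<^sub>\<nu>\<close>, the second one vanishes at \<open>b\<close>, and their Wronskian
  is one. This normalisation treats \<open>\<nu> = 0\<close> and \<open>\<nu> > 0\<close> alike; the two cases differ only in the formula
  for \<open>\<rho>\<close>.

  Variation of constants attaches to a number \<open>a\<close> and a square integrable \<open>g\<close> the solution
  \<open>sol a g = k Y + u Z\<close> of \<open>\<tau>\<^sub>\<nu> f = g\<close>, \<open>f b = 0\<close>, where \<open>Y x\<close> is \<open>a\<close> plus the integral of \<open>u g\<close> over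
  \<open>(0, x)\<close> and \<open>Z x\<close> is the integral of \<open>k g\<close> over \<open>(x, b)\<close>. The brackets of \<open>sol a g\<close> with \<open>u\<close> and
  \<open>k\<close> are \<open>Y\<close> and \<open>- Z\<close>. Hence \<open>\<Gamma>\<^sub>0 (sol a g) = a\<close>, and \<open>\<Gamma>\<^sub>1 - m\<^sub>0 \<Gamma>\<^sub>0\<close> takes the value
  \<open>Z 0 = \<langle>g, k\<rangle>\<close> for a real constant \<open>m\<^sub>0\<close>. Integration by parts (\<open>sol_green\<close>) gives the Green identity.

  Elements of the domain of \<open>A\<close> are \<open>O(x powr (3/2))\<close> by the Cauchy-Schwarz inequality, and their
  images are square integrable by Hardy's inequality. So each of them is \<open>sol 0 v\<close> for some \<open>v\<close>
  orthogonal to \<open>k\<close> (\<open>H2_function_eq_sol\<close>). Conversely every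
  \<open>v\<close> that is orthogonal to \<open>k\<close> and vanishes near \<open>0\<close> is in the range of \<open>A\<close>. This identifies
  the adjoint: its domain consists of all \<open>sol a g\<close> (\<open>adjoint_iff\<close>).

  The rest is a statement about boundary triplets (\<open>extremal_extensions\<close>). The nonnegative self-adjoint
  extensions are \<open>\<Gamma>\<^sub>0 f = 0\<close> and \<open>\<Gamma>\<^sub>1 f = t \<Gamma>\<^sub>0 f\<close> with \<open>t \<ge> m\<^sub>0\<close>, and their resolvents increase from the
  first one, over decreasing \<open>t\<close>, to \<open>t = m\<^sub>0\<close>. Three facts about \<open>\<tau>\<^sub>\<nu>\<close> enter. First,
  \<open>\<langle>g, f\<rangle> = \<langle>g, k\<rangle> cnj a + \<langle>g, sol 0 g\<rangle>\<close> for \<open>f = sol a g\<close>, and \<open>\<langle>g, sol 0 g\<rangle> \<ge> 0\<close>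
  (\<open>energy_nonneg\<close>); this is the nonnegativity of the extension with \<open>\<Gamma>\<^sub>0 f = 0\<close>, and it bounds the form
  below for all \<open>t \<ge> m\<^sub>0\<close>. Secondly, \<open>\<langle>g, k\<rangle>\<close> is not controlled by \<open>\<langle>g, sol 0 g\<rangle>\<close>
  (\<open>energy_negative_direction\<close>), so no \<open>t < m\<^sub>0\<close> gives a nonnegative operator. Thirdly, the adjoint has a
  negative eigenvalue (\<open>defect_vector\<close>), whose eigenvector distinguishes the resolvents of different
  extensions and yields uniqueness.
\<close>

section \<open>The pre-Hilbert space of square integrable functions\<close>

lemma L2_measurable: "f \<in> L2 M \<Longrightarrow> f \<in> borel_measurable M"
  by (simp add: L2_def)

lemma L2_integrable_mult:
  assumes "f \<in> L2 M" "g \<in> L2 M"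
  shows "integrable M (\<lambda>x. f x * g x)"
proof (rule Bochner_Integration.integrable_bound)
  show "integrable M (\<lambda>x. (cmod (f x))\<^sup>2 + (cmod (g x))\<^sup>2)"
    using assms by (simp add: L2_def)
  show "(\<lambda>x. f x * g x) \<in> borel_measurable M"
    using assms by (auto simp: L2_def)
  have "norm (f x * g x) \<le> norm ((cmod (f x))\<^sup>2 + (cmod (g x))\<^sup>2)" for x
  proof -
    have "2 * (cmod (f x) * cmod (g x)) \<le> (cmod (f x))\<^sup>2 + (cmod (g x))\<^sup>2"
      using sum_squares_bound[of "cmod (f x)" "cmod (g x)"] by simp
    moreover have "0 \<le> cmod (f x) * cmod (g x)"
      by simp
    ultimately show ?thesis
      unfolding norm_mult real_norm_def by linarith
  qed
  then show "AE x in M. norm (f x * g x) \<le> norm ((cmod (f x))\<^sup>2 + (cmod (g x))\<^sup>2)"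
    by simp
qed

lemma L2_cnj: "f \<in> L2 M \<Longrightarrow> (\<lambda>x. cnj (f x)) \<in> L2 M"
proof -
  assume "f \<in> L2 M"
  moreover have "(\<lambda>x. cnj (f x)) = (\<lambda>x. cnj x) \<circ> f" by auto
  moreover have "cnj \<in> borel_measurable borel"
    by (intro borel_measurable_continuous_onI continuous_intros)
  ultimately show ?thesis
    by (auto simp: L2_def intro: measurable_comp)
qed

lemma L2_integrable_inner:
  assumes "f \<in> L2 M" "g \<in> L2 M"
  shows "integrable M (\<lambda>x. f x * cnj (g x))"
  using L2_integrable_mult[OF assms(1) L2_cnj[OF assms(2)]] .

lemma L2_zero [simp]: "(\<lambda>x. 0) \<in> L2 M"
  by (simp add: L2_def)

lemma L2_cmult: "f \<in> L2 M \<Longrightarrow> (\<lambda>x. c * f x) \<in> L2 M"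
  by (auto simp: L2_def norm_mult power_mult_distrib)

lemma L2_add:
  assumes "f \<in> L2 M" "g \<in> L2 M"
  shows "(\<lambda>x. f x + g x) \<in> L2 M"
proof -
  have "integrable M (\<lambda>x. (cmod (f x + g x))\<^sup>2)"
  proof (rule Bochner_Integration.integrable_bound)
    show "integrable M (\<lambda>x. 2 * (cmod (f x))\<^sup>2 + 2 * (cmod (g x))\<^sup>2)"
      using assms by (simp add: L2_def)
    show "(\<lambda>x. (cmod (f x + g x))\<^sup>2) \<in> borel_measurable M"
      using assms by (auto simp: L2_def)
    have "norm ((cmod (f x + g x))\<^sup>2) \<le> norm (2 * (cmod (f x))\<^sup>2 + 2 * (cmod (g x))\<^sup>2)" for x
    proof -
      have "(cmod (f x + g x))\<^sup>2 \<le> (cmod (f x) + cmod (g x))\<^sup>2"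
        by (intro power_mono norm_triangle_ineq) auto
      also have "\<dots> \<le> 2 * (cmod (f x))\<^sup>2 + 2 * (cmod (g x))\<^sup>2"
        using sum_squares_bound[of "cmod (f x)" "cmod (g x)"] by (simp add: power2_sum)
      finally show ?thesis by simp
    qed
    then show "AE x in M. norm ((cmod (f x + g x))\<^sup>2) \<le> norm (2 * (cmod (f x))\<^sup>2 + 2 * (cmod (g x))\<^sup>2)"
      by simp
  qed
  moreover have "(\<lambda>x. f x + g x) \<in> borel_measurable M"
    using assms by (auto simp: L2_def)
  ultimately show ?thesis by (simp add: L2_def)
qed

lemma L2_diff:
  assumes "f \<in> L2 M" "g \<in> L2 M"
  shows "(\<lambda>x. f x - g x) \<in> L2 M"
  using L2_add[OF assms(1) L2_cmult[OF assms(2), of "-1"]] by simp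

lemma L2_dominated:
  assumes "w \<in> L2 M" "v \<in> borel_measurable M" "\<And>x. x \<in> space M \<Longrightarrow> cmod (v x) \<le> cmod (w x)"
  shows "v \<in> L2 M"
proof -
  have "integrable M (\<lambda>x. (cmod (v x))\<^sup>2)"
  proof (rule Bochner_Integration.integrable_bound)
    show "integrable M (\<lambda>x. (cmod (w x))\<^sup>2)" using assms(1) by (simp add: L2_def)
    show "AE x in M. norm ((cmod (v x))\<^sup>2) \<le> norm ((cmod (w x))\<^sup>2)"
      by (rule AE_I2) (use assms(3) in \<open>auto intro!: power_mono\<close>)
  qed (use assms(2) in simp)
  then show ?thesis using assms(2) by (simp add: L2_def)
qed

lemma l2_inner_add_left:
  "\<lbrakk>f \<in> L2 M; f' \<in> L2 M; g \<in> L2 M\<rbrakk> \<Longrightarrow>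
    l2_inner M (\<lambda>x. f x + f' x) g = l2_inner M f g + l2_inner M f' g"
  unfolding l2_inner_def
  by (simp add: ring_distribs L2_integrable_inner)

lemma l2_inner_add_right:
  "\<lbrakk>f \<in> L2 M; f' \<in> L2 M; g \<in> L2 M\<rbrakk> \<Longrightarrow>
    l2_inner M g (\<lambda>x. f x + f' x) = l2_inner M g f + l2_inner M g f'"
  unfolding l2_inner_def
  by (simp add: ring_distribs L2_integrable_inner)

lemma l2_inner_cmult_left: "l2_inner M (\<lambda>x. c * f x) g = c * l2_inner M f g"
  unfolding l2_inner_def by (simp add: mult.assoc)

lemma l2_inner_cmult_right: "l2_inner M f (\<lambda>x. c * g x) = cnj c * l2_inner M f g"
  unfolding l2_inner_def by (simp add: mult.left_commute)

lemma l2_inner_diff_left: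
  assumes "f \<in> L2 M" "f' \<in> L2 M" "g \<in> L2 M"
  shows "l2_inner M (\<lambda>x. f x - f' x) g = l2_inner M f g - l2_inner M f' g"
  using l2_inner_add_left[OF assms(1) L2_cmult[OF assms(2), of "-1"] assms(3)]
    l2_inner_cmult_left[of M "-1" f' g] by simp

lemma l2_inner_diff_right:
  assumes "f \<in> L2 M" "f' \<in> L2 M" "g \<in> L2 M"
  shows "l2_inner M g (\<lambda>x. f x - f' x) = l2_inner M g f - l2_inner M g f'"
  using l2_inner_add_right[OF assms(1) L2_cmult[OF assms(2), of "-1"] assms(3)]
    l2_inner_cmult_right[of M g "-1" f'] by simp

lemma l2_inner_zero [simp]: "l2_inner M (\<lambda>x. 0) f = 0" "l2_inner M f (\<lambda>x. 0) = 0"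
  by (simp_all add: l2_inner_def)

lemma l2_inner_commute: "l2_inner M g f = cnj (l2_inner M f g)"
  unfolding l2_inner_def by (subst Bochner_Integration.integral_cnj[symmetric]) (simp add: mult.commute)

lemma l2_norm_nonneg [simp]: "0 \<le> l2_norm M f"
  by (simp add: l2_norm_def)

lemma l2_inner_self: "l2_inner M f f = of_real ((l2_norm M f)\<^sup>2)"
proof -
  have "l2_inner M f f = (LINT x|M. complex_of_real ((cmod (f x))\<^sup>2))"
    unfolding l2_inner_def by (simp only: complex_norm_square)
  then show ?thesis
    by (simp add: l2_norm_def del: of_real_power)
qed

lemma ae_equal_refl [simp]: "ae_equal M f f"
  by (simp add: ae_equal_def)

lemma ae_equal_sym: "ae_equal M f g \<Longrightarrow> ae_equal M g f"
  unfolding ae_equal_def by (auto elim: eventually_mono)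

lemma ae_equal_trans: "ae_equal M f g \<Longrightarrow> ae_equal M g h \<Longrightarrow> ae_equal M f h"
  unfolding ae_equal_def by (elim AE_mp) (rule AE_I2, simp)

lemma ae_equal_add:
  "ae_equal M f g \<Longrightarrow> ae_equal M f' g' \<Longrightarrow> ae_equal M (\<lambda>x. f x + f' x) (\<lambda>x. g x + g' x)"
  unfolding ae_equal_def by (auto elim: eventually_elim2)

lemma ae_equal_cmult: "ae_equal M f g \<Longrightarrow> ae_equal M (\<lambda>x. c * f x) (\<lambda>x. c * g x)"
  unfolding ae_equal_def by (auto elim: eventually_mono)

lemma l2_inner_cong_ae:
  assumes "f \<in> L2 M" "f' \<in> L2 M" "g \<in> L2 M" "g' \<in> L2 M" "ae_equal M f f'" "ae_equal M g g'"
  shows "l2_inner M f g = l2_inner M f' g'"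
  unfolding l2_inner_def
proof (rule integral_cong_AE)
  show "(\<lambda>x. f x * cnj (g x)) \<in> borel_measurable M" "(\<lambda>x. f' x * cnj (g' x)) \<in> borel_measurable M"
    using assms by (auto intro!: borel_measurable_integrable L2_integrable_inner)
  show "AE x in M. f x * cnj (g x) = f' x * cnj (g' x)"
    using assms(5,6) unfolding ae_equal_def by (auto elim: eventually_elim2)
qed

lemma l2_norm_eq_0:
  assumes "f \<in> L2 M" "l2_norm M f = 0"
  shows "ae_equal M f (\<lambda>x. 0)"
proof -
  have "(LINT x|M. (cmod (f x))\<^sup>2) = 0"
    using assms(2) by (simp add: l2_norm_def)
  then have "AE x in M. (cmod (f x))\<^sup>2 = 0"
    using assms(1) by (subst (asm) integral_nonneg_eq_0_iff_AE) (auto simp: L2_def)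
  then show ?thesis by (simp add: ae_equal_def)
qed

text \<open>Expand \<open>0 \<le> \<parallel>\<parallel>g\<parallel>\<^sup>2 f - \<langle>f, g\<rangle> g\<parallel>\<^sup>2\<close>.\<close>

lemma l2_Cauchy_Schwarz:
  assumes f: "f \<in> L2 M" and g: "g \<in> L2 M"
  shows "cmod (l2_inner M f g) \<le> l2_norm M f * l2_norm M g"
proof (cases "l2_norm M g = 0")
  case True
  then have "l2_inner M f g = l2_inner M f (\<lambda>x. 0)"
    using f g by (intro l2_inner_cong_ae) (auto intro: l2_norm_eq_0)
  then show ?thesis by simp
next
  case False
  define n where "n = (l2_norm M g)\<^sup>2"
  define c where "c = l2_inner M f g"
  define h where "h = (\<lambda>x. of_real n * f x - c * g x)"
  have n: "n > 0" using False by (simp add: n_def)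
  have "l2_inner M h h = of_real n * (of_real n * l2_inner M f f - cnj c * l2_inner M f g)
      - c * (of_real n * l2_inner M g f - cnj c * l2_inner M g g)"
    unfolding h_def using f g
    by (simp add: l2_inner_diff_left l2_inner_diff_right l2_inner_cmult_left l2_inner_cmult_right
        L2_cmult L2_diff)
  also have "\<dots> = of_real n * (of_real n * of_real ((l2_norm M f)\<^sup>2) - cnj c * c)
      - c * (of_real n * cnj c - cnj c * of_real n)"
    unfolding l2_inner_self n_def[symmetric] l2_inner_commute[of M g f] c_def[symmetric] ..
  also have "\<dots> = of_real n * of_real n * of_real ((l2_norm M f)\<^sup>2) - of_real n * (c * cnj c)"
    by (simp add: algebra_simps)
  also have "\<dots> = of_real (n\<^sup>2 * (l2_norm M f)\<^sup>2 - n * (cmod c)\<^sup>2)"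
    unfolding complex_norm_square[symmetric] by (simp add: power2_eq_square)
  finally have "of_real ((l2_norm M h)\<^sup>2) = complex_of_real (n\<^sup>2 * (l2_norm M f)\<^sup>2 - n * (cmod c)\<^sup>2)"
    by (simp only: l2_inner_self)
  then have "n\<^sup>2 * (l2_norm M f)\<^sup>2 - n * (cmod c)\<^sup>2 \<ge> 0"
    by (metis of_real_eq_iff zero_le_power2)
  then have "n * (cmod c)\<^sup>2 \<le> n * (n * (l2_norm M f)\<^sup>2)"
    by (simp add: power2_eq_square algebra_simps)
  then have "(cmod c)\<^sup>2 \<le> n * (l2_norm M f)\<^sup>2"
    using n by simp
  then have "(cmod c)\<^sup>2 \<le> (l2_norm M f * l2_norm M g)\<^sup>2"
    by (simp add: n_def power_mult_distrib mult.commute)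
  then show ?thesis
    unfolding c_def by (rule power2_le_imp_le) simp
qed

lemma l2_norm_triangle:
  assumes f: "f \<in> L2 M" and g: "g \<in> L2 M"
  shows "l2_norm M (\<lambda>x. f x + g x) \<le> l2_norm M f + l2_norm M g"
proof (rule power2_le_imp_le)
  have "of_real ((l2_norm M (\<lambda>x. f x + g x))\<^sup>2)
      = l2_inner M f f + l2_inner M f g + (l2_inner M g f + l2_inner M g g)"
    unfolding l2_inner_self[symmetric]
    using f g by (simp add: l2_inner_add_left l2_inner_add_right L2_add)
  then have "(l2_norm M (\<lambda>x. f x + g x))\<^sup>2
      = Re (l2_inner M f f + l2_inner M f g + (l2_inner M g f + l2_inner M g g))"
    by (metis Re_complex_of_real)
  also have "\<dots> = (l2_norm M f)\<^sup>2 + 2 * Re (l2_inner M f g) + (l2_norm M g)\<^sup>2"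
    using l2_inner_commute[of M g f] by (simp add: l2_inner_self)
  also have "Re (l2_inner M f g) \<le> l2_norm M f * l2_norm M g"
    using l2_Cauchy_Schwarz[OF f g] complex_Re_le_cmod order_trans by blast
  finally show "(l2_norm M (\<lambda>x. f x + g x))\<^sup>2 \<le> (l2_norm M f + l2_norm M g)\<^sup>2"
    by (simp add: power2_sum)
qed simp

text \<open>Approximating \<open>g\<close> by a vector \<open>u\<close> of the dense set gives \<open>\<parallel>g\<parallel>\<^sup>2 = \<langle>g - u, g\<rangle>\<close>.\<close>

lemma dense_orthogonal_imp_zero:
  assumes "densely_defined M T" "g \<in> L2 M" "Domain T \<subseteq> L2 M"
    and orth: "\<And>u. u \<in> Domain T \<Longrightarrow> l2_inner M u g = 0"
  shows "ae_equal M g (\<lambda>x. 0)"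
proof (rule l2_norm_eq_0[OF assms(2)], rule ccontr)
  assume "l2_norm M g \<noteq> 0"
  then have pos: "l2_norm M g > 0"
    using l2_norm_nonneg[of M g] by linarith
  then obtain u where u: "u \<in> Domain T" and ue: "l2_norm M (\<lambda>x. g x - u x) < l2_norm M g"
    using assms(1)[unfolded densely_defined_def] assms(2) by meson
  have uL: "u \<in> L2 M" using u assms(3) by auto
  have "of_real ((l2_norm M g)\<^sup>2) = l2_inner M (\<lambda>x. g x - u x) g"
    unfolding l2_inner_self[symmetric]
    using orth[OF u] uL assms(2) by (simp add: l2_inner_diff_left)
  then have "cmod (of_real ((l2_norm M g)\<^sup>2)) \<le> l2_norm M (\<lambda>x. g x - u x) * l2_norm M g"
    using l2_Cauchy_Schwarz[OF L2_diff[OF assms(2) uL] assms(2)] by simp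
  then have "l2_norm M g * l2_norm M g \<le> l2_norm M (\<lambda>x. g x - u x) * l2_norm M g"
    by (simp add: power2_eq_square norm_mult)
  then have "l2_norm M g \<le> l2_norm M (\<lambda>x. g x - u x)" using pos by simp
  then show False using ue by linarith
qed

section \<open>Friedrichs and Krein extensions from a boundary triplet\<close>

lemma op_adjoint_add:
  assumes "T \<subseteq> L2 M \<times> L2 M" "(f, g) \<in> op_adjoint M T" "(f', g') \<in> op_adjoint M T"
  shows "(\<lambda>x. f x + f' x, \<lambda>x. g x + g' x) \<in> op_adjoint M T"
  using assms unfolding op_adjoint_def
  by (fastforce simp: L2_add l2_inner_add_right)

lemma op_adjoint_cmult:
  assumes "(f, g) \<in> op_adjoint M T"
  shows "(\<lambda>x. c * f x, \<lambda>x. c * g x) \<in> op_adjoint M T"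
  using assms unfolding op_adjoint_def
  by (auto simp: L2_cmult l2_inner_cmult_right)

lemma op_adjoint_diff:
  assumes "T \<subseteq> L2 M \<times> L2 M" "(f, g) \<in> op_adjoint M T" "(f', g') \<in> op_adjoint M T"
  shows "(\<lambda>x. f x - f' x, \<lambda>x. g x - g' x) \<in> op_adjoint M T"
  using op_adjoint_add[OF assms(1,2) op_adjoint_cmult[OF assms(3), of "-1"]] by simp

lemma op_adjoint_antimono: "T \<subseteq> S \<Longrightarrow> op_adjoint M S \<subseteq> op_adjoint M T"
  unfolding op_adjoint_def by auto

lemma op_adjoint_ae:
  assumes L2_ae: "\<And>f f'. f \<in> L2 M \<Longrightarrow> ae_equal M f f' \<Longrightarrow> f' \<in> L2 M"
    and T: "T \<subseteq> L2 M \<times> L2 M" and fg: "(f, g) \<in> op_adjoint M T" "ae_equal M f f'" "ae_equal M g g'"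
  shows "(f', g') \<in> op_adjoint M T"
proof -
  have L: "f \<in> L2 M" "g \<in> L2 M" "f' \<in> L2 M" "g' \<in> L2 M"
    using fg L2_ae by (auto simp: op_adjoint_def)
  have "l2_inner M v f' = l2_inner M u g'" if uv: "(u, v) \<in> T" for u v
  proof -
    have "u \<in> L2 M" "v \<in> L2 M" using uv T by auto
    then have "l2_inner M v f = l2_inner M v f'" "l2_inner M u g = l2_inner M u g'"
      using L fg by (auto intro!: l2_inner_cong_ae)
    then show ?thesis using fg(1) uv by (auto simp: op_adjoint_def)
  qed
  then show ?thesis using L by (auto simp: op_adjoint_def)
qed

text \<open>Adjoints are relations on functions; density makes them single-valued on classes.\<close>

lemma op_adjoint_single_valued:
  assumes "densely_defined M T" and T: "T \<subseteq> L2 M \<times> L2 M"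
    and fg: "(f, g) \<in> op_adjoint M T" "(f', g') \<in> op_adjoint M T" "ae_equal M f f'"
  shows "ae_equal M g g'"
proof -
  have L: "f \<in> L2 M" "g \<in> L2 M" "f' \<in> L2 M" "g' \<in> L2 M"
    using fg by (auto simp: op_adjoint_def)
  have "ae_equal M (\<lambda>x. g x - g' x) (\<lambda>x. 0)"
  proof (rule dense_orthogonal_imp_zero[OF assms(1)])
    show "(\<lambda>x. g x - g' x) \<in> L2 M" using L by (simp add: L2_diff)
    show "Domain T \<subseteq> L2 M" using T by auto
    fix u assume "u \<in> Domain T"
    then obtain v where uv: "(u, v) \<in> T" by auto
    then have "u \<in> L2 M" "v \<in> L2 M" using T by auto
    moreover have "l2_inner M v f = l2_inner M v f'"
      using L \<open>v \<in> L2 M\<close> fg(3) by (intro l2_inner_cong_ae) auto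
    moreover have "l2_inner M v f = l2_inner M u g" "l2_inner M v f' = l2_inner M u g'"
      using fg(1,2) uv by (auto simp: op_adjoint_def)
    ultimately show "l2_inner M u (\<lambda>x. g x - g' x) = 0"
      using L by (simp add: l2_inner_diff_right)
  qed
  then show ?thesis by (simp add: ae_equal_def)
qed

text \<open>A boundary triplet whose maps \<open>\<Gamma>\<^sub>0\<close> and \<open>\<Gamma>\<^sub>1\<close> have the domains of the two extremal extensions as
  kernels. The form bound makes the extensions \<open>\<Gamma>\<^sub>1 f = t \<Gamma>\<^sub>0 f\<close> nonnegative for \<open>t \<ge> 0\<close>, the limit case
  \<open>\<Gamma>\<^sub>0 f = 0\<close> included; \<open>negative_direction\<close> excludes \<open>t < 0\<close>. The eigenvector in \<open>defect\<close> separates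
  the resolvents of different extensions at one point \<open>- c\<close>.\<close>

locale extremal_boundary_triplet =
  fixes M :: "'a measure" and A :: "'a op_graph" and G0 G1 :: "('a \<Rightarrow> complex) \<Rightarrow> complex"
  assumes symmetric: "nonneg_symmetric M A"
    and triplet: "complex_boundary_triplet M A G0 G1"
    and L2_ae: "\<And>f f'. f \<in> L2 M \<Longrightarrow> ae_equal M f f' \<Longrightarrow> f' \<in> L2 M"
    and form_bound: "\<And>f g. (f, g) \<in> op_adjoint M A \<Longrightarrow>
      Re (G1 f * cnj (G0 f)) \<le> Re (l2_inner M g f)"
    and negative_direction: "\<And>s. s < 0 \<Longrightarrow>
      \<exists>f g. (f, g) \<in> op_adjoint M A \<and> G0 f = 1 \<and> G1 f = of_real s \<and> Re (l2_inner M g f) < 0"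
    and defect: "\<exists>c>0. \<exists>\<phi>. (\<phi>, \<lambda>x. - of_real c * \<phi> x) \<in> op_adjoint M A \<and> \<not> ae_equal M \<phi> (\<lambda>x. 0)"
begin

lemma A_L2: "A \<subseteq> L2 M \<times> L2 M"
  using symmetric by (auto simp: nonneg_symmetric_def linear_operator_def)

lemma adjoint_L2: "(f, g) \<in> op_adjoint M A \<Longrightarrow> f \<in> L2 M \<and> g \<in> L2 M"
  by (simp add: op_adjoint_def)

lemma boundary_map:
  assumes "\<Gamma> \<in> {G0, G1}" "(f, f') \<in> op_adjoint M A" "(g, g') \<in> op_adjoint M A"
  shows "ae_equal M f g \<Longrightarrow> \<Gamma> f = \<Gamma> g" "\<Gamma> (\<lambda>x. f x + g x) = \<Gamma> f + \<Gamma> g" "\<Gamma> (\<lambda>x. c * f x) = c * \<Gamma> f"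
proof -
  have "(ae_equal M f g \<longrightarrow> \<Gamma> f = \<Gamma> g) \<and> \<Gamma> (\<lambda>x. f x + g x) = \<Gamma> f + \<Gamma> g \<and>
      (\<forall>c. \<Gamma> (\<lambda>x. c * f x) = c * \<Gamma> f)"
    using triplet[unfolded complex_boundary_triplet_def, THEN conjunct1, THEN bspec, OF assms(1),
        THEN bspec, OF DomainI, OF assms(2), THEN bspec, OF DomainI, OF assms(3)] .
  then show "ae_equal M f g \<Longrightarrow> \<Gamma> f = \<Gamma> g" "\<Gamma> (\<lambda>x. f x + g x) = \<Gamma> f + \<Gamma> g" "\<Gamma> (\<lambda>x. c * f x) = c * \<Gamma> f"
    by (blast, blast, elim conjE) (erule spec)
qed

lemma boundary_add:
  assumes "(f, f') \<in> op_adjoint M A" "(g, g') \<in> op_adjoint M A"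
  shows "G0 (\<lambda>x. f x + g x) = G0 f + G0 g" "G1 (\<lambda>x. f x + g x) = G1 f + G1 g"
  using boundary_map(2)[OF _ assms] by blast+

lemma boundary_cmult:
  assumes "(f, f') \<in> op_adjoint M A"
  shows "G0 (\<lambda>x. c * f x) = c * G0 f" "G1 (\<lambda>x. c * f x) = c * G1 f"
  using boundary_map(3)[OF _ assms assms] by blast+

lemma boundary_diff:
  assumes "(f, f') \<in> op_adjoint M A" "(g, g') \<in> op_adjoint M A"
  shows "G0 (\<lambda>x. f x - g x) = G0 f - G0 g" "G1 (\<lambda>x. f x - g x) = G1 f - G1 g"
  using boundary_add[OF assms(1) op_adjoint_cmult[OF assms(2), of "-1"]]
    boundary_cmult[OF assms(2), of "-1"] by simp_all

lemma boundary_ae: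
  assumes "(f, f') \<in> op_adjoint M A" "(g, g') \<in> op_adjoint M A" "ae_equal M f g"
  shows "G0 f = G0 g" "G1 f = G1 g"
  using boundary_map(1)[OF _ assms] by blast+

lemma green:
  assumes "(f, f') \<in> op_adjoint M A" "(g, g') \<in> op_adjoint M A"
  shows "l2_inner M f' g - l2_inner M f g' = G1 f * cnj (G0 g) - G0 f * cnj (G1 g)"
  using triplet assms unfolding complex_boundary_triplet_def by blast

lemma boundary_surj: "\<exists>f g. (f, g) \<in> op_adjoint M A \<and> G0 f = a \<and> G1 f = s"
proof -
  have "(\<lambda>f. (G0 f, G1 f)) ` Domain (op_adjoint M A) = UNIV"
    using triplet unfolding complex_boundary_triplet_def by (elim conjE)
  then have "(a, s) \<in> (\<lambda>f. (G0 f, G1 f)) ` Domain (op_adjoint M A)" by (simp only: UNIV_I)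
  then show ?thesis by auto
qed

lemma adjoint_ae:
  assumes "(f, g) \<in> op_adjoint M A" "ae_equal M f f'" "ae_equal M g g'"
  shows "(f', g') \<in> op_adjoint M A"
  using op_adjoint_ae[OF L2_ae A_L2 assms] .

lemma adjoint_single_valued:
  assumes "(f, g) \<in> op_adjoint M A" "(f', g') \<in> op_adjoint M A" "ae_equal M f f'"
  shows "ae_equal M g g'"
  using symmetric op_adjoint_single_valued[OF _ A_L2 assms] by (simp add: nonneg_symmetric_def)

lemma A_in_adjoint: "A \<subseteq> op_adjoint M A"
  using symmetric by (simp add: nonneg_symmetric_def)

text \<open>By surjectivity of the boundary maps, a vector whose Green pairing with every element of the
  domain of the adjoint vanishes has zero boundary values.\<close>

lemma A_boundary_zero:
  assumes "(u, v) \<in> A"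
  shows "G0 u = 0" "G1 u = 0"
proof -
  have 0: "G1 u * cnj (G0 g) - G0 u * cnj (G1 g) = 0" if "(g, g') \<in> op_adjoint M A" for g g'
    using green[OF subsetD[OF A_in_adjoint assms] that] that assms by (auto simp: op_adjoint_def)
  obtain g g' where "(g, g') \<in> op_adjoint M A" "G0 g = 1" "G1 g = 0"
    using boundary_surj[of 1 0] by blast
  with 0 show "G1 u = 0" by fastforce
  obtain g g' where "(g, g') \<in> op_adjoint M A" "G0 g = 0" "G1 g = 1"
    using boundary_surj[of 0 1] by blast
  with 0 show "G0 u = 0" by fastforce
qed

text \<open>Homogeneous coordinates \<open>(p, r)\<close> for the slope \<open>t = p / r\<close>, so that \<open>\<Gamma>\<^sub>0 f = 0\<close> is the pair
  \<open>(1, 0)\<close>.\<close>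

definition extension :: "real \<Rightarrow> real \<Rightarrow> 'a op_graph" where
  "extension p r = {(f, g). (f, g) \<in> op_adjoint M A \<and> of_real p * G0 f = of_real r * G1 f}"

lemma A_subset_extension: "A \<subseteq> extension p r"
proof
  fix z assume "z \<in> A"
  then show "z \<in> extension p r"
    using A_boundary_zero[of "fst z" "snd z"] A_in_adjoint by (auto simp: extension_def)
qed

text \<open>The boundary values of an extension form a real line in \<open>\<complex>\<^sup>2\<close>. Such a line is its own
  annihilator under the form \<open>\<Gamma>\<^sub>1 f cnj (\<Gamma>\<^sub>0 g) - \<Gamma>\<^sub>0 f cnj (\<Gamma>\<^sub>1 g)\<close>.\<close>

lemma extension_selfadjoint:
  assumes "(p, r) \<noteq> (0, 0)"
  shows "op_adjoint M (extension p r) = extension p r"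
proof (intro equalityI subsetI)
  fix z assume z: "z \<in> op_adjoint M (extension p r)"
  obtain f g where fg: "z = (f, g)" by fastforce
  have D: "(f, g) \<in> op_adjoint M A"
    using z fg op_adjoint_antimono[OF A_subset_extension] by blast
  obtain h h' where h: "(h, h') \<in> op_adjoint M A" "G0 h = of_real r" "G1 h = of_real p"
    using boundary_surj by blast
  then have "(h, h') \<in> extension p r" by (simp add: extension_def)
  then have "l2_inner M h' f = l2_inner M h g"
    using z fg by (auto simp: op_adjoint_def)
  then have "of_real p * cnj (G0 f) - of_real r * cnj (G1 f) = 0"
    using green[OF h(1) D] h by simp
  then have "cnj (of_real p * cnj (G0 f) - of_real r * cnj (G1 f)) = 0" by simp
  then show "z \<in> extension p r"
    using D fg by (simp add: extension_def)
next
  fix z assume z: "z \<in> extension p r"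
  obtain f g where fg: "z = (f, g)" by fastforce
  have D: "(f, g) \<in> op_adjoint M A" and fz: "of_real p * G0 f = of_real r * G1 f"
    using z fg by (auto simp: extension_def)
  have "l2_inner M v f = l2_inner M u g" if uv: "(u, v) \<in> extension p r" for u v
  proof -
    have Du: "(u, v) \<in> op_adjoint M A" and uz: "of_real p * G0 u = of_real r * G1 u"
      using uv by (auto simp: extension_def)
    have fz': "of_real p * cnj (G0 f) = of_real r * cnj (G1 f)"
      using arg_cong[OF fz, of cnj] by simp
    have "of_real r * (G1 u * cnj (G0 f) - G0 u * cnj (G1 f))
        = (of_real r * G1 u) * cnj (G0 f) - G0 u * (of_real r * cnj (G1 f))"
      by (simp add: algebra_simps)
    also have "\<dots> = 0"
      unfolding uz[symmetric] fz'[symmetric] by (simp add: algebra_simps)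
    finally have r: "of_real r * (G1 u * cnj (G0 f) - G0 u * cnj (G1 f)) = 0" .
    have "of_real p * (G1 u * cnj (G0 f) - G0 u * cnj (G1 f))
        = G1 u * (of_real p * cnj (G0 f)) - (of_real p * G0 u) * cnj (G1 f)"
      by (simp add: algebra_simps)
    also have "\<dots> = 0"
      unfolding uz fz' by (simp add: algebra_simps)
    finally have "G1 u * cnj (G0 f) - G0 u * cnj (G1 f) = 0"
      using r assms by auto
    then show ?thesis using green[OF Du D] by simp
  qed
  then show "z \<in> op_adjoint M (extension p r)"
    using fg adjoint_L2[OF D] by (auto simp: op_adjoint_def)
qed

lemma extension_linear: "linear_operator M (extension p r)"
  unfolding linear_operator_def
proof (intro conjI)
  show "extension p r \<subseteq> L2 M \<times> L2 M"
    using adjoint_L2 by (auto simp: extension_def)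
  show "(\<lambda>x. 0, \<lambda>x. 0) \<in> extension p r"
    using symmetric A_subset_extension by (auto simp: nonneg_symmetric_def linear_operator_def)
  show "\<forall>(f, g)\<in>extension p r. \<forall>(f', g')\<in>extension p r.
      (\<lambda>x. f x + f' x, \<lambda>x. g x + g' x) \<in> extension p r"
    by (auto simp: extension_def op_adjoint_add[OF A_L2] boundary_add ring_distribs)
  show "\<forall>(f, g)\<in>extension p r. \<forall>c. (\<lambda>x. c * f x, \<lambda>x. c * g x) \<in> extension p r"
    by (auto simp: extension_def op_adjoint_cmult boundary_cmult mult.left_commute)
  show "\<forall>(f, g)\<in>extension p r. \<forall>f' g'. ae_equal M f f' \<longrightarrow> ae_equal M g g' \<longrightarrow>
      (f', g') \<in> extension p r"
  proof clarify
    fix f g f' g' assume "(f, g) \<in> extension p r" and ae: "ae_equal M f f'" "ae_equal M g g'"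
    then have D: "(f, g) \<in> op_adjoint M A" and e: "of_real p * G0 f = of_real r * G1 f"
      by (auto simp: extension_def)
    have D': "(f', g') \<in> op_adjoint M A" using adjoint_ae[OF D ae] .
    show "(f', g') \<in> extension p r"
      using D' e boundary_ae[OF D D' ae(1)] by (simp add: extension_def)
  qed
  show "\<forall>(f, g)\<in>extension p r. \<forall>(f', g')\<in>extension p r. ae_equal M f f' \<longrightarrow> ae_equal M g g'"
    using adjoint_single_valued by (auto simp: extension_def)
qed

lemma extension_dense: "densely_defined M (extension p r)"
  using symmetric A_subset_extension[of p r]
  unfolding nonneg_symmetric_def densely_defined_def by (meson Domain_mono subsetD)

lemma selfadjoint_form_real:
  assumes "S = op_adjoint M S" "(f, g) \<in> S"
  shows "l2_inner M g f \<in> \<real>"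
proof -
  have "(f, g) \<in> op_adjoint M S" using assms by blast
  then have "l2_inner M g f = l2_inner M f g"
    using assms(2) by (auto simp: op_adjoint_def)
  then show ?thesis using l2_inner_commute[of M f g]
    by (simp add: Reals_cnj_iff)
qed

lemma extension_nonneg_selfadjoint:
  assumes "(p, r) \<noteq> (0, 0)" and "0 \<le> p * r"
  shows "nonneg_selfadjoint_extension M A (extension p r)"
  unfolding nonneg_selfadjoint_extension_def
proof (intro conjI)
  show "nonneg_operator M (extension p r)"
    unfolding nonneg_operator_def
  proof clarify
    fix f g assume fg: "(f, g) \<in> extension p r"
    then have D: "(f, g) \<in> op_adjoint M A" and e: "of_real p * G0 f = of_real r * G1 f"
      by (auto simp: extension_def)
    have "0 \<le> Re (G1 f * cnj (G0 f))"
    proof (cases "r = 0")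
      case True
      then show ?thesis using e assms(1) by auto
    next
      case False
      have "of_real r * (G1 f * cnj (G0 f)) = of_real p * (G0 f * cnj (G0 f))"
        using e by (simp add: mult.assoc[symmetric])
      then have "of_real (r\<^sup>2) * (G1 f * cnj (G0 f)) = of_real (p * r) * (G0 f * cnj (G0 f))"
        by (simp add: power2_eq_square mult.assoc mult.left_commute)
      then have "of_real (r\<^sup>2) * (G1 f * cnj (G0 f)) = of_real (p * r * (cmod (G0 f))\<^sup>2)"
        by (simp only: complex_norm_square of_real_mult)
      then have "r\<^sup>2 * Re (G1 f * cnj (G0 f)) = p * r * (cmod (G0 f))\<^sup>2"
        by (drule_tac arg_cong[where f = Re]) (simp del: of_real_power of_real_mult)
      then show ?thesis using assms(2) False
        by (smt (verit) mult_nonneg_nonneg mult_pos_neg zero_le_power2 zero_less_power2)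
    qed
    then have "0 \<le> Re (l2_inner M g f)"
      using form_bound[OF D] by linarith
    moreover have "l2_inner M g f \<in> \<real>"
      using selfadjoint_form_real[OF extension_selfadjoint[OF assms(1), symmetric] fg] .
    ultimately show "l2_inner M g f \<in> \<real>\<^sub>\<ge>\<^sub>0"
      by (simp add: complex_nonneg_Reals_iff complex_is_Real_iff)
  qed
qed (use A_subset_extension extension_linear extension_dense extension_selfadjoint[OF assms(1)]
      in auto)

text \<open>Isotropy of the boundary values of \<open>S\<close> forces them onto one real line: the ratio \<open>\<Gamma>\<^sub>1 f / \<Gamma>\<^sub>0 f\<close> is
  real at one element and then the same at all others.\<close>

lemma selfadjoint_extension_cases:
  assumes "A \<subseteq> S" and S: "S = op_adjoint M S"
  obtains "S = extension 1 0" | t where "S = extension t 1"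
proof -
  have SD: "S \<subseteq> op_adjoint M A"
    using assms op_adjoint_antimono by blast
  have iso: "G1 f * cnj (G0 g) = G0 f * cnj (G1 g)" if "(f, f') \<in> S" "(g, g') \<in> S" for f f' g g'
  proof -
    have "(g, g') \<in> op_adjoint M S" using S that by blast
    then have "l2_inner M f' g = l2_inner M f g'" using that(1) by (auto simp: op_adjoint_def)
    then show ?thesis using green[of f f' g g'] SD that by auto
  qed
  \<comment> \<open>A symmetric extension of a self-adjoint operator coincides with it.\<close>
  have max: "S = extension p r" if sub: "S \<subseteq> extension p r" and "(p, r) \<noteq> (0, 0)" for p r
    using sub op_adjoint_antimono[OF sub, of M] S extension_selfadjoint[OF that(2)] by auto
  show thesis
  proof (cases "\<forall>(f, g)\<in>S. G0 f = 0")
    case True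
    then have "S \<subseteq> extension 1 0" using SD by (auto simp: extension_def)
    then show thesis using max that(1) by auto
  next
    case False
    then obtain f0 g0 where f0: "(f0, g0) \<in> S" "G0 f0 \<noteq> 0" by auto
    define t where "t = Re (G1 f0 / G0 f0)"
    have "G1 f0 / G0 f0 = cnj (G1 f0 / G0 f0)"
      using iso[OF f0(1) f0(1)] f0(2) by (simp add: field_simps)
    then have "G1 f0 / G0 f0 = of_real t"
      unfolding t_def by (metis Reals_cnj_iff of_real_Re)
    then have t: "G1 f0 = of_real t * G0 f0" using f0(2) by (simp add: field_simps)
    have "S \<subseteq> extension t 1"
    proof
      fix z assume z: "z \<in> S"
      obtain f g where fg: "z = (f, g)" by fastforce
      have "G1 f * cnj (G0 f0) = of_real t * G0 f * cnj (G0 f0)"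
        using iso[of f g f0 g0] z fg f0(1) by (simp add: t mult_ac)
      then have "of_real t * G0 f = G1 f" using f0(2) by simp
      then show "z \<in> extension t 1"
        using SD z fg by (auto simp: extension_def)
    qed
    then have "S = extension t 1" by (rule max) simp
    then show thesis by (rule that(2))
  qed
qed

lemma nonneg_selfadjoint_extension_cases:
  assumes "nonneg_selfadjoint_extension M A S"
  obtains "S = extension 1 0" | t where "0 \<le> t" "S = extension t 1"
proof -
  have S: "A \<subseteq> S" "S = op_adjoint M S" "nonneg_operator M S"
    using assms by (auto simp: nonneg_selfadjoint_extension_def)
  from S(1,2) show thesis
  proof (cases rule: selfadjoint_extension_cases)
    case 1
    then show thesis using that(1) by simp
  next
    case (2 t)
    have "0 \<le> t"
    proof (rule ccontr)
      assume "\<not> 0 \<le> t"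
      then obtain f g where fg: "(f, g) \<in> op_adjoint M A" "G0 f = 1" "G1 f = of_real t"
          "Re (l2_inner M g f) < 0"
        using negative_direction[of t] by auto
      then have "(f, g) \<in> S" by (simp add: 2 extension_def)
      then have "l2_inner M g f \<in> \<real>\<^sub>\<ge>\<^sub>0" using S(3) by (auto simp: nonneg_operator_def)
      then show False using fg(4) by (simp add: complex_nonneg_Reals_iff)
    qed
    then show thesis using that(2) 2 by simp
  qed
qed

text \<open>Solutions of \<open>(A\<^sup>* + c) f = h\<close> differ by an eigenvector \<open>\<phi>\<close> of \<open>A\<^sup>*\<close> for the eigenvalue \<open>-c\<close>.
  The difference of the resolvent forms is a Green pairing of the two solutions, and the form bound
  at \<open>\<phi>\<close> controls the boundary values.\<close>

lemma resolvent_difference: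
  assumes D: "(f1, g1) \<in> op_adjoint M A" "(f2, g2) \<in> op_adjoint M A"
    and h: "h = (\<lambda>x. g1 x + of_real c * f1 x)" "h = (\<lambda>x. g2 x + of_real c * f2 x)"
  defines "\<phi> \<equiv> \<lambda>x. f2 x - f1 x"
  shows "Re (l2_inner M f2 h) - Re (l2_inner M f1 h)
      = Re (G0 f2 * cnj (G1 f1)) - Re (G1 f2 * cnj (G0 f1))"
    and "Re ((G1 f2 - G1 f1) * cnj (G0 f2 - G0 f1)) \<le> - c * (l2_norm M \<phi>)\<^sup>2"
proof -
  have L: "f1 \<in> L2 M" "g1 \<in> L2 M" "f2 \<in> L2 M" "g2 \<in> L2 M"
    using D adjoint_L2 by blast+
  have "l2_inner M f2 h = l2_inner M f2 g1 + of_real c * l2_inner M f2 f1"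
    unfolding h(1) using L by (simp add: l2_inner_add_right l2_inner_cmult_right L2_cmult)
  moreover have "l2_inner M f1 h = l2_inner M f1 g2 + of_real c * l2_inner M f1 f2"
    unfolding h(2) using L by (simp add: l2_inner_add_right l2_inner_cmult_right L2_cmult)
  ultimately have "Re (l2_inner M f2 h) - Re (l2_inner M f1 h)
      = Re (l2_inner M f2 g1 - l2_inner M g2 f1)"
    using l2_inner_commute[of M f1 g2] l2_inner_commute[of M f1 f2] by simp
  then show "Re (l2_inner M f2 h) - Re (l2_inner M f1 h)
      = Re (G0 f2 * cnj (G1 f1)) - Re (G1 f2 * cnj (G0 f1))"
    using arg_cong[OF green[OF D(2,1)], of Re] by simp
  have eq: "g2 x - g1 x = - of_real c * \<phi> x" for x
    using fun_cong[OF trans[OF h(1)[symmetric] h(2)], of x] by (simp add: \<phi>_def algebra_simps)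
  have "(\<phi>, \<lambda>x. - of_real c * \<phi> x) \<in> op_adjoint M A"
    using op_adjoint_diff[OF A_L2 D(2,1)] unfolding eq \<phi>_def[symmetric] .
  from form_bound[OF this]
  show "Re ((G1 f2 - G1 f1) * cnj (G0 f2 - G0 f1)) \<le> - c * (l2_norm M \<phi>)\<^sup>2"
    using boundary_diff[OF D(2,1)] l2_inner_cmult_left[of M "- of_real c" \<phi> \<phi>]
    by (simp add: l2_inner_self \<phi>_def del: of_real_power)
qed

text \<open>With \<open>a = \<Gamma>\<^sub>0 f2 = \<Gamma>\<^sub>0 \<phi>\<close> the difference of the forms is the real part of
  \<open>t \<bar>a\<bar>\<^sup>2 - \<Gamma>\<^sub>1 \<phi> cnj a\<close>, where \<open>\<Gamma>\<^sub>1 \<phi> cnj a\<close> has real part at most \<open>- c \<parallel>\<phi>\<parallel>\<^sup>2\<close> by the form bound at \<open>\<phi>\<close>.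
  Keeping this norm gives strictness, which is what uniqueness needs.\<close>

lemma resolvent_le_from_G0_kernel:
  assumes "(f1, g1) \<in> extension 1 0" "(f2, g2) \<in> extension t 1" "0 \<le> t"
    and h: "h = (\<lambda>x. g1 x + of_real c * f1 x)" "h = (\<lambda>x. g2 x + of_real c * f2 x)"
  shows "Re (l2_inner M f1 h) + c * (l2_norm M (\<lambda>x. f2 x - f1 x))\<^sup>2 \<le> Re (l2_inner M f2 h)"
proof -
  have D: "(f1, g1) \<in> op_adjoint M A" "(f2, g2) \<in> op_adjoint M A"
    and b: "G0 f1 = 0" "G1 f2 = of_real t * G0 f2"
    using assms(1,2) by (auto simp: extension_def)
  note d = resolvent_difference[OF D h]
  have "Re ((of_real t * G0 f2 - G1 f1) * cnj (G0 f2))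
      = t * (cmod (G0 f2))\<^sup>2 - Re (G0 f2 * cnj (G1 f1))"
    unfolding cmod_power2 by (simp add: algebra_simps power2_eq_square)
  moreover have "0 \<le> t * (cmod (G0 f2))\<^sup>2" using assms(3) by simp
  ultimately show ?thesis using d b by simp
qed

text \<open>Here the difference of the forms is \<open>t Re (\<Gamma>\<^sub>0 f2 cnj (\<Gamma>\<^sub>0 f1))\<close>, while \<open>\<Gamma>\<^sub>1 \<phi> = - t \<Gamma>\<^sub>0 f1\<close>, so
  the form bound at \<open>\<phi>\<close> compares it with \<open>t \<bar>\<Gamma>\<^sub>0 f1\<bar>\<^sup>2\<close>.\<close>

lemma resolvent_le_to_G1_kernel:
  assumes "(f1, g1) \<in> extension t 1" "(f2, g2) \<in> extension 0 1" "0 \<le> t"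
    and h: "h = (\<lambda>x. g1 x + of_real c * f1 x)" "h = (\<lambda>x. g2 x + of_real c * f2 x)"
  shows "Re (l2_inner M f1 h) + c * (l2_norm M (\<lambda>x. f2 x - f1 x))\<^sup>2 \<le> Re (l2_inner M f2 h)"
proof -
  have D: "(f1, g1) \<in> op_adjoint M A" "(f2, g2) \<in> op_adjoint M A"
    and b: "G1 f1 = of_real t * G0 f1" "G1 f2 = 0"
    using assms(1,2) by (auto simp: extension_def)
  note d = resolvent_difference[OF D h]
  have "Re ((0 - of_real t * G0 f1) * cnj (G0 f2 - G0 f1))
      = t * (cmod (G0 f1))\<^sup>2 - Re (G0 f2 * cnj (of_real t * G0 f1))"
    unfolding cmod_power2 by (simp add: algebra_simps power2_eq_square)
  moreover have "0 \<le> t * (cmod (G0 f1))\<^sup>2" using assms(3) by simp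
  ultimately show ?thesis using d unfolding b by simp
qed

text \<open>Two extensions with complementary boundary conditions are separated by their resolvents: the
  eigenvector in \<open>defect\<close> is a difference of elements of their domains.\<close>

lemma complementary_resolvents_differ:
  assumes "p1 * r2 \<noteq> p2 * r1"
  shows "\<exists>c>0. \<exists>f1 g1 f2 g2. (f1, g1) \<in> extension p1 r1 \<and> (f2, g2) \<in> extension p2 r2 \<and>
    (\<lambda>x. g1 x + of_real c * f1 x) = (\<lambda>x. g2 x + of_real c * f2 x) \<and>
    0 < l2_norm M (\<lambda>x. f2 x - f1 x)"
proof -
  obtain c \<phi> where c: "c > 0" and \<phi>: "(\<phi>, \<lambda>x. - of_real c * \<phi> x) \<in> op_adjoint M A"
    and nz: "\<not> ae_equal M \<phi> (\<lambda>x. 0)"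
    using defect by blast
  \<comment> \<open>Cramer's rule for \<open>\<kappa> (r2, p2) - (G0 \<phi>, G1 \<phi>)\<close> to lie on the line of \<open>(r1, p1)\<close>\<close>
  define \<kappa> where "\<kappa> = (of_real p1 * G0 \<phi> - of_real r1 * G1 \<phi>) / of_real (p1 * r2 - p2 * r1)"
  obtain f2 g2 where D2: "(f2, g2) \<in> op_adjoint M A"
    and b2: "G0 f2 = \<kappa> * of_real r2" "G1 f2 = \<kappa> * of_real p2"
    using boundary_surj by blast
  define f1 g1 where "f1 = (\<lambda>x. f2 x - \<phi> x)" and "g1 = (\<lambda>x. g2 x - (- of_real c * \<phi> x))"
  have D1: "(f1, g1) \<in> op_adjoint M A"
    unfolding f1_def g1_def using op_adjoint_diff[OF A_L2 D2 \<phi>] .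
  have b1: "G0 f1 = \<kappa> * of_real r2 - G0 \<phi>" "G1 f1 = \<kappa> * of_real p2 - G1 \<phi>"
    unfolding f1_def using boundary_diff[OF D2 \<phi>] b2 by auto
  have "of_real (p1 * r2 - p2 * r1) \<noteq> (0 :: complex)"
    unfolding of_real_eq_0_iff using assms by simp
  then have "\<kappa> * of_real (p1 * r2 - p2 * r1) = of_real p1 * G0 \<phi> - of_real r1 * G1 \<phi>"
    unfolding \<kappa>_def by (simp del: of_real_diff of_real_mult)
  then have "of_real p1 * G0 f1 = of_real r1 * G1 f1"
    unfolding b1 by (simp add: algebra_simps)
  then have "(f1, g1) \<in> extension p1 r1" using D1 by (simp add: extension_def)
  moreover have "(f2, g2) \<in> extension p2 r2" using D2 b2 by (simp add: extension_def)
  moreover have "(\<lambda>x. g1 x + of_real c * f1 x) = (\<lambda>x. g2 x + of_real c * f2 x)"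
    by (simp add: f1_def g1_def algebra_simps)
  moreover have "0 < l2_norm M (\<lambda>x. f2 x - f1 x)"
    using l2_norm_eq_0[of \<phi> M] nz adjoint_L2[OF \<phi>] l2_norm_nonneg[of M \<phi>]
    by (auto simp: f1_def less_le)
  ultimately show ?thesis using c by blast
qed

lemma Friedrichs: "is_Friedrichs_extension M A (extension 1 0)"
  unfolding is_Friedrichs_extension_def
proof (intro conjI allI impI)
  show "nonneg_selfadjoint_extension M A (extension 1 0)"
    by (rule extension_nonneg_selfadjoint) auto
  fix S' and c :: real assume S': "nonneg_selfadjoint_extension M A S'" and c: "0 < c"
  show "op_le M (shifted_inverse c (extension 1 0)) (shifted_inverse c S')"
    unfolding op_le_def
  proof (intro allI impI)
    fix h f f'
    assume "(h, f) \<in> shifted_inverse c (extension 1 0)" "(h, f') \<in> shifted_inverse c S'"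
    then obtain g g' where fg: "(f, g) \<in> extension 1 0" "(f', g') \<in> S'"
      and h: "h = (\<lambda>x. g x + of_real c * f x)" "h = (\<lambda>x. g' x + of_real c * f' x)"
      unfolding shifted_inverse_def by blast
    from S' show "Re (l2_inner M f h) \<le> Re (l2_inner M f' h)"
    proof (cases rule: nonneg_selfadjoint_extension_cases)
      case 1
      have D: "(f, g) \<in> op_adjoint M A" "(f', g') \<in> op_adjoint M A" and "G0 f = 0" "G0 f' = 0"
        using fg 1 by (auto simp: extension_def)
      then show ?thesis using resolvent_difference(1)[OF D h] by simp
    next
      case (2 t)
      have "0 \<le> c * (l2_norm M (\<lambda>x. f' x - f x))\<^sup>2" using c by simp
      then show ?thesis
        using resolvent_le_from_G0_kernel[OF fg(1) _ 2(1) h] fg(2) 2(2) by fastforce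
    qed
  qed
qed (rule symmetric)

lemma Krein: "is_Krein_extension M A (extension 0 1)"
  unfolding is_Krein_extension_def
proof (intro conjI allI impI)
  show "nonneg_selfadjoint_extension M A (extension 0 1)"
    by (rule extension_nonneg_selfadjoint) auto
  fix S' and c :: real assume S': "nonneg_selfadjoint_extension M A S'" and c: "0 < c"
  show "op_le M (shifted_inverse c S') (shifted_inverse c (extension 0 1))"
    unfolding op_le_def
  proof (intro allI impI)
    fix h f f'
    assume "(h, f) \<in> shifted_inverse c S'" "(h, f') \<in> shifted_inverse c (extension 0 1)"
    then obtain g g' where fg: "(f, g) \<in> S'" "(f', g') \<in> extension 0 1"
      and h: "h = (\<lambda>x. g x + of_real c * f x)" "h = (\<lambda>x. g' x + of_real c * f' x)"
      unfolding shifted_inverse_def by blast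
    have c0: "0 \<le> c * (l2_norm M (\<lambda>x. f' x - f x))\<^sup>2" using c by simp
    from S' show "Re (l2_inner M f h) \<le> Re (l2_inner M f' h)"
    proof (cases rule: nonneg_selfadjoint_extension_cases)
      case 1
      then show ?thesis
        using resolvent_le_from_G0_kernel[OF _ fg(2) order_refl h] fg(1) c0 by fastforce
    next
      case (2 t)
      then show ?thesis
        using resolvent_le_to_G1_kernel[OF _ fg(2) 2(1) h] fg(1) c0 by fastforce
    qed
  qed
qed (rule symmetric)

text \<open>A strict order between two members of the family, evaluated at the pair with a common image under
  \<open>A\<^sup>* + c\<close>, contradicts the reversed order.\<close>

lemma strict_order_not_reversed:
  assumes le: "\<forall>c>0. op_le M (shifted_inverse c (extension p2 r2)) (shifted_inverse c (extension p1 r1))"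
    and "p1 * r2 \<noteq> p2 * r1"
    and strict: "\<And>c f1 g1 f2 g2 h. \<lbrakk>(f1, g1) \<in> extension p1 r1; (f2, g2) \<in> extension p2 r2;
      h = (\<lambda>x. g1 x + of_real c * f1 x); h = (\<lambda>x. g2 x + of_real c * f2 x)\<rbrakk> \<Longrightarrow>
      Re (l2_inner M f1 h) + c * (l2_norm M (\<lambda>x. f2 x - f1 x))\<^sup>2 \<le> Re (l2_inner M f2 h)"
  shows False
proof -
  obtain c f1 g1 f2 g2 where c: "c > 0"
    and f: "(f1, g1) \<in> extension p1 r1" "(f2, g2) \<in> extension p2 r2"
    and eq: "(\<lambda>x. g1 x + of_real c * f1 x) = (\<lambda>x. g2 x + of_real c * f2 x)"
    and pos: "0 < l2_norm M (\<lambda>x. f2 x - f1 x)"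
    using complementary_resolvents_differ[OF assms(2)] by blast
  define h where "h = (\<lambda>x. g1 x + of_real c * f1 x)"
  have "(h, f1) \<in> shifted_inverse c (extension p1 r1)"
    using f(1) unfolding shifted_inverse_def h_def by blast
  moreover have "(h, f2) \<in> shifted_inverse c (extension p2 r2)"
    using f(2) unfolding shifted_inverse_def h_def eq by blast
  ultimately have "Re (l2_inner M f2 h) \<le> Re (l2_inner M f1 h)"
    using le c unfolding op_le_def by blast
  moreover have "0 < c * (l2_norm M (\<lambda>x. f2 x - f1 x))\<^sup>2" using c pos by simp
  ultimately show False
    using strict[OF f h_def] eq unfolding h_def by fastforce
qed

lemma Friedrichs_unique:
  assumes "is_Friedrichs_extension M A S"
  shows "S = extension 1 0"
proof -
  have S: "nonneg_selfadjoint_extension M A S"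
    using assms by (simp add: is_Friedrichs_extension_def)
  then show ?thesis
  proof (cases rule: nonneg_selfadjoint_extension_cases)
    case (2 t)
    have le: "\<forall>c>0. op_le M (shifted_inverse c S) (shifted_inverse c (extension 1 0))"
      using assms Friedrichs by (simp add: is_Friedrichs_extension_def)
    show ?thesis
      using strict_order_not_reversed[of t 1 1 0] le resolvent_le_from_G0_kernel[OF _ _ 2(1)] 2(2)
      by auto
  qed
qed

lemma Krein_unique:
  assumes "is_Krein_extension M A S"
  shows "S = extension 0 1"
proof -
  have S: "nonneg_selfadjoint_extension M A S"
    using assms by (simp add: is_Krein_extension_def)
  have le: "\<forall>c>0. op_le M (shifted_inverse c (extension 0 1)) (shifted_inverse c S)"
    using assms Krein by (simp add: is_Krein_extension_def)
  from S show ?thesis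
  proof (cases rule: nonneg_selfadjoint_extension_cases)
    case 1
    then show ?thesis
      using strict_order_not_reversed[of 0 1 1 0] le resolvent_le_from_G0_kernel[OF _ _ order_refl]
      by auto
  next
    case (2 t)
    show ?thesis
    proof (cases "t = 0")
      case False
      then show ?thesis
        using strict_order_not_reversed[of 0 1 t 1] le resolvent_le_to_G1_kernel[OF _ _ 2(1)] 2(2)
        by auto
    qed (use 2 in simp)
  qed
qed

theorem extremal_extensions:
  shows "\<exists>!S. is_Friedrichs_extension M A S" "\<exists>!S. is_Krein_extension M A S"
    and "Domain (Friedrichs_extension M A) = {f \<in> Domain (op_adjoint M A). G0 f = 0}"
    and "Domain (Krein_extension M A) = {f \<in> Domain (op_adjoint M A). G1 f = 0}"
proof -
  show F: "\<exists>!S. is_Friedrichs_extension M A S" and K: "\<exists>!S. is_Krein_extension M A S"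
    using Friedrichs Friedrichs_unique Krein Krein_unique by blast+
  have "Friedrichs_extension M A = extension 1 0"
    unfolding Friedrichs_extension_def using Friedrichs Friedrichs_unique by (rule the_equality)
  then show "Domain (Friedrichs_extension M A) = {f \<in> Domain (op_adjoint M A). G0 f = 0}"
    by (auto simp: extension_def)
  have "Krein_extension M A = extension 0 1"
    unfolding Krein_extension_def using Krein Krein_unique by (rule the_equality)
  then show "Domain (Krein_extension M A) = {f \<in> Domain (op_adjoint M A). G1 f = 0}"
    by (auto simp: extension_def)
qed

end

section \<open>Products of indefinite integrals\<close>

lemma absolutely_integrable_bound_continuous:
  fixes p Q :: "real \<Rightarrow> 'a :: {euclidean_space, real_normed_field}"
  assumes "p absolutely_integrable_on {a..b}" "continuous_on {a..b} Q"
  shows "(\<lambda>x. p x * Q x) absolutely_integrable_on {a..b}"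
proof -
  have "(\<lambda>x. Q x * p x) absolutely_integrable_on {a..b}"
  proof (rule absolutely_integrable_bounded_measurable_product[where h = "(*)"])
    show "bilinear ((*) :: 'a \<Rightarrow> 'a \<Rightarrow> 'a)"
      by (simp add: bilinear_conv_bounded_bilinear bounded_bilinear_mult)
    show "Q \<in> borel_measurable (lebesgue_on {a..b})"
      using assms(2) by (rule continuous_imp_measurable_on_sets_lebesgue) auto
    show "bounded (Q ` {a..b})"
      using assms(2) by (intro compact_imp_bounded compact_continuous_image) auto
  qed (use assms in auto)
  then show ?thesis by (simp add: mult.commute)
qed

lemma indefinite_integral_continuous:
  fixes p :: "real \<Rightarrow> 'a :: {euclidean_space, real_normed_field}"
  assumes "p absolutely_integrable_on {a..b}" "\<And>x. x \<in> {a..b} \<Longrightarrow> P x = P a + integral {a..x} p"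
  shows "continuous_on {a..b} P"
  using assms(1) by (subst continuous_on_cong[OF refl assms(2)])
    (auto intro!: continuous_intros indefinite_integral_continuous_1 simp: absolutely_integrable_on_def)

lemma indefinite_integral_increment:
  fixes p :: "real \<Rightarrow> 'a :: {euclidean_space, real_normed_field}"
  assumes "p integrable_on {a..b}" "a \<le> x" "x \<le> y" "y \<le> b"
    and "\<And>x. x \<in> {a..b} \<Longrightarrow> P x = P a + integral {a..x} p"
  shows "P y = P x + integral {x..y} p"
proof -
  have "integral {a..x} p + integral {x..y} p = integral {a..y} p"
    using assms by (intro Henstock_Kurzweil_Integration.integral_combine)
      (auto intro: integrable_on_subinterval)
  then show ?thesis using assms(2-4) assms(5)[of x] assms(5)[of y] by simp
qed

lemma norm_increment_le_integral_norm:
  fixes p :: "real \<Rightarrow> 'a :: {euclidean_space, real_normed_field}"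
  assumes "p absolutely_integrable_on {x..y}" "x \<le> s" "s \<le> t" "t \<le> y"
  shows "norm (integral {s..t} p) \<le> integral {x..y} (\<lambda>x. norm (p x))"
proof -
  have sub: "p absolutely_integrable_on {s..t}"
    using assms by (auto intro: absolutely_integrable_on_subinterval)
  then have "norm (integral {s..t} p) \<le> integral {s..t} (\<lambda>x. norm (p x))"
    by (intro integral_norm_bound_integral) (auto simp: absolutely_integrable_on_def)
  also have "\<dots> \<le> integral {x..y} (\<lambda>x. norm (p x))"
    using assms sub by (intro integral_subset_le) (auto simp: absolutely_integrable_on_def)
  finally show ?thesis .
qed

text \<open>Over a short interval the increment of \<open>P Q - \<integral>(p Q + P q)\<close> is at most twice the product of the
  integrals of \<open>\<parallel>p\<parallel>\<close> and \<open>\<parallel>q\<parallel>\<close>, hence an arbitrarily small multiple of the integral of \<open>\<parallel>p\<parallel>\<close>.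
  Bisection adds these estimates up.\<close>

proposition integral_product_rule:
  fixes p q P Q :: "real \<Rightarrow> 'a :: {euclidean_space, real_normed_field}"
  assumes ab: "a \<le> b"
    and p: "p absolutely_integrable_on {a..b}" and q: "q absolutely_integrable_on {a..b}"
    and P: "\<And>x. x \<in> {a..b} \<Longrightarrow> P x = P a + integral {a..x} p"
    and Q: "\<And>x. x \<in> {a..b} \<Longrightarrow> Q x = Q a + integral {a..x} q"
  shows "integral {a..b} (\<lambda>x. p x * Q x + P x * q x) = P b * Q b - P a * Q a"
    and "(\<lambda>x. p x * Q x + P x * q x) absolutely_integrable_on {a..b}"
proof -
  have pi: "p integrable_on {a..b}" and qi: "q integrable_on {a..b}"
    using p q by (auto simp: absolutely_integrable_on_def)
  have cP: "continuous_on {a..b} P" by (rule indefinite_integral_continuous[OF p P])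
  have cQ: "continuous_on {a..b} Q" by (rule indefinite_integral_continuous[OF q Q])
  let ?r = "\<lambda>x. p x * Q x + P x * q x"
  show r: "?r absolutely_integrable_on {a..b}"
    using absolutely_integrable_bound_continuous[OF p cQ] absolutely_integrable_bound_continuous[OF q cP]
    by (intro set_integral_add) (auto simp: mult.commute)
  define \<Phi> where "\<Phi> x y = P y * Q y - P x * Q x - integral {x..y} ?r" for x y
  define N where "N x y = integral {x..y} (\<lambda>x. norm (p x))" for x y
  define K where "K x y = integral {x..y} (\<lambda>x. norm (q x))" for x y
  have abs: "p absolutely_integrable_on {x..y}" "q absolutely_integrable_on {x..y}"
      "?r absolutely_integrable_on {x..y}" if "a \<le> x" "y \<le> b" for x y
    using p q r that by (auto intro: absolutely_integrable_on_subinterval)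
  have small: "norm (\<Phi> x y) \<le> 2 * N x y * K x y" if xy: "a \<le> x" "x \<le> y" "y \<le> b" for x y
  proof -
    note ax = abs[OF xy(1,3)]
    have cxy: "continuous_on {x..y} P" "continuous_on {x..y} Q"
      using cP cQ xy by (auto intro: continuous_on_subset)
    have "integral {x..y} (\<lambda>t. p t * (Q y - Q t) + q t * (P x - P t))
        = integral {x..y} (\<lambda>t. p t * Q y + P x * q t - ?r t)"
      by (rule integral_cong) (simp add: algebra_simps)
    also have "\<dots> = integral {x..y} p * Q y + P x * integral {x..y} q - integral {x..y} ?r"
      using ax by (subst integral_diff, simp_all add: absolutely_integrable_on_def integrable_add
          integrable_on_mult_left integrable_on_mult_right)
        (subst integral_add, simp_all add: absolutely_integrable_on_def
          integrable_on_mult_left integrable_on_mult_right)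
    also have "\<dots> = \<Phi> x y"
      using indefinite_integral_increment[OF pi xy P] indefinite_integral_increment[OF qi xy Q]
      by (simp add: \<Phi>_def algebra_simps)
    finally have eq: "\<Phi> x y = integral {x..y} (\<lambda>t. p t * (Q y - Q t) + q t * (P x - P t))" ..
    have "norm (\<Phi> x y) \<le> integral {x..y} (\<lambda>t. norm (p t) * K x y + norm (q t) * N x y)"
      unfolding eq
    proof (rule integral_norm_bound_integral)
      have "(\<lambda>t. p t * (Q y - Q t)) absolutely_integrable_on {x..y}"
        "(\<lambda>t. q t * (P x - P t)) absolutely_integrable_on {x..y}"
        by (intro absolutely_integrable_bound_continuous ax continuous_intros cxy)+
      then show "(\<lambda>t. p t * (Q y - Q t) + q t * (P x - P t)) integrable_on {x..y}"
        by (simp add: absolutely_integrable_on_def integrable_add)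
      show "(\<lambda>t. norm (p t) * K x y + norm (q t) * N x y) integrable_on {x..y}"
        using ax by (intro integrable_add integrable_on_mult_left)
          (auto simp: absolutely_integrable_on_def)
      fix t assume t: "t \<in> {x..y}"
      have "norm (Q y - Q t) \<le> K x y"
        using indefinite_integral_increment[OF qi _ _ _ Q, of t y] t xy
          norm_increment_le_integral_norm[OF ax(2), of t y] by (simp add: K_def)
      moreover have "norm (P x - P t) \<le> N x y"
        using indefinite_integral_increment[OF pi _ _ _ P, of x t] t xy
          norm_increment_le_integral_norm[OF ax(1), of x t] by (simp add: N_def norm_minus_commute)
      ultimately show "norm (p t * (Q y - Q t) + q t * (P x - P t)) \<le> norm (p t) * K x y + norm (q t) * N x y"
        by (intro norm_triangle_le add_mono) (auto simp: norm_mult intro: mult_left_mono)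
    qed
    also have "\<dots> = N x y * K x y + K x y * N x y"
      using ax unfolding N_def K_def
      by (subst integral_add) (auto simp: absolutely_integrable_on_def intro: integrable_on_mult_left)
    finally show ?thesis by (simp add: mult.commute mult.left_commute)
  qed
  have N0: "0 \<le> N x y" "0 \<le> K x y" if "a \<le> x" "y \<le> b" for x y
    unfolding N_def K_def using abs[OF that]
    by (auto intro!: integral_nonneg simp: absolutely_integrable_on_def)
  have "norm (\<Phi> a b) \<le> e * N a b" if e: "e > 0" for e
  proof -
    have "a \<le> a \<longrightarrow> b \<le> b \<longrightarrow> norm (\<Phi> a b) \<le> e * N a b"
      using ab
    proof (rule Bolzano[where P = "\<lambda>x y. a \<le> x \<longrightarrow> y \<le> b \<longrightarrow> norm (\<Phi> x y) \<le> e * N x y"])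
      fix x y z assume le: "x \<le> y" "y \<le> z"
        and 1: "a \<le> x \<longrightarrow> y \<le> b \<longrightarrow> norm (\<Phi> x y) \<le> e * N x y"
        and 2: "a \<le> y \<longrightarrow> z \<le> b \<longrightarrow> norm (\<Phi> y z) \<le> e * N y z"
      show "a \<le> x \<longrightarrow> z \<le> b \<longrightarrow> norm (\<Phi> x z) \<le> e * N x z"
      proof (intro impI)
        assume xz: "a \<le> x" "z \<le> b"
        have "\<Phi> x z = \<Phi> x y + \<Phi> y z" "N x z = N x y + N y z"
          unfolding \<Phi>_def N_def using abs[OF xz] le
          by (auto simp: absolutely_integrable_on_def
              Henstock_Kurzweil_Integration.integral_combine[symmetric, of x y z])
        moreover have "norm (\<Phi> x y) \<le> e * N x y" "norm (\<Phi> y z) \<le> e * N y z"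
          using 1 2 xz le by auto
        ultimately show "norm (\<Phi> x z) \<le> e * N x z"
          using norm_triangle_ineq[of "\<Phi> x y" "\<Phi> y z"] by (simp add: distrib_left)
      qed
    next
      fix x assume x: "a \<le> x" "x \<le> b"
      have "continuous_on {a..b} (\<lambda>x. integral {a..x} (\<lambda>x. norm (q x)))"
        using q by (intro indefinite_integral_continuous_1) (auto simp: absolutely_integrable_on_def)
      then obtain d where d: "d > 0"
        and dd: "\<And>y. y \<in> {a..b} \<Longrightarrow> dist y x < d \<Longrightarrow>
          dist (integral {a..y} (\<lambda>x. norm (q x))) (integral {a..x} (\<lambda>x. norm (q x))) < e / 4"
        using x e unfolding continuous_on_iff by (metis atLeastAtMost_iff divide_pos_pos zero_less_numeral)
      show "\<exists>d>0. \<forall>y z. y \<le> x \<and> x \<le> z \<and> z - y < d \<longrightarrow>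
          (a \<le> y \<longrightarrow> z \<le> b \<longrightarrow> norm (\<Phi> y z) \<le> e * N y z)"
      proof (intro exI[of _ d] conjI d allI impI)
        fix y z assume *: "y \<le> x \<and> x \<le> z \<and> z - y < d" and yz: "a \<le> y" "z \<le> b"
        have "integral {a..y} (\<lambda>x. norm (q x)) + K y z = integral {a..z} (\<lambda>x. norm (q x))"
          unfolding K_def using abs[of a z] * yz
          by (intro Henstock_Kurzweil_Integration.integral_combine) (auto simp: absolutely_integrable_on_def)
        moreover have "dist (integral {a..y} (\<lambda>x. norm (q x))) (integral {a..x} (\<lambda>x. norm (q x))) < e / 4"
          "dist (integral {a..z} (\<lambda>x. norm (q x))) (integral {a..x} (\<lambda>x. norm (q x))) < e / 4"
          by (rule dd; use * yz in \<open>auto simp: dist_real_def\<close>)+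
        ultimately have K: "K y z \<le> e / 2"
          unfolding dist_real_def by linarith
        have "norm (\<Phi> y z) \<le> 2 * N y z * K y z" using small * yz by simp
        also have "\<dots> \<le> 2 * N y z * (e / 2)"
          using K N0[of y z] yz by (intro mult_left_mono) auto
        finally show "norm (\<Phi> y z) \<le> e * N y z" by (simp add: mult.commute)
      qed
    qed
    then show ?thesis by simp
  qed
  then have "norm (\<Phi> a b) \<le> 0 + e" if "e > 0" for e
    using that N0[of a b] \<open>a \<le> b\<close>
  proof -
    have "norm (\<Phi> a b) \<le> (e / (N a b + 1)) * N a b"
      using \<open>\<And>e. 0 < e \<Longrightarrow> norm (\<Phi> a b) \<le> e * N a b\<close>[of "e / (N a b + 1)"] that N0(1)[of a b]
      by (simp add: add_nonneg_pos)
    also have "\<dots> \<le> e"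
      using that N0[of a b] by (simp add: field_simps)
    finally show ?thesis by simp
  qed
  then have "norm (\<Phi> a b) \<le> 0" by (rule field_le_epsilon)
  then show "integral {a..b} ?r = P b * Q b - P a * Q a"
    by (simp add: \<Phi>_def)
qed

lemma has_vector_derivative_of_real:
  "(f has_real_derivative f') F \<Longrightarrow>
    ((\<lambda>x. complex_of_real (f x)) has_vector_derivative complex_of_real f') F"
  using bounded_linear.has_vector_derivative[OF bounded_linear_of_real, of f f' F]
  by (simp add: has_real_derivative_iff_has_vector_derivative)

lemma C1_imp_indefinite_integral:
  fixes P p :: "real \<Rightarrow> complex"
  assumes "\<And>x. x \<in> {a..b} \<Longrightarrow> (P has_vector_derivative p x) (at x)" "continuous_on {a..b} p"
  shows "p absolutely_integrable_on {a..b}"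
    and "\<And>x. x \<in> {a..b} \<Longrightarrow> P x = P a + integral {a..x} p"
proof -
  show "p absolutely_integrable_on {a..b}"
    using assms(2) by (rule absolutely_integrable_continuous_real)
  fix x assume x: "x \<in> {a..b}"
  have "(p has_integral (P x - P a)) {a..x}"
    using x by (intro fundamental_theorem_of_calculus)
      (auto intro!: has_vector_derivative_at_within assms)
  then show "P x = P a + integral {a..x} p" by (simp add: integral_unique)
qed

section \<open>Square integrable functions on an interval\<close>

lemma L2_interval_ae:
  assumes "f \<in> L2 (lebesgue_on S)" "ae_equal (lebesgue_on S) f f'" "S \<in> sets lebesgue"
  shows "f' \<in> L2 (lebesgue_on S)"
proof -
  have m: "f' \<in> borel_measurable (lebesgue_on S)"
  proof (rule borel_measurable_if_D, rule borel_measurable_AE)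
    show "(\<lambda>x. if x \<in> S then f x else 0) \<in> borel_measurable lebesgue"
      using assms by (intro borel_measurable_if_I) (auto simp: L2_def)
    show "AE x in lebesgue. (if x \<in> S then f x else 0) = (if x \<in> S then f' x else 0)"
      using assms(2,3) by (auto simp: ae_equal_def AE_restrict_space_iff elim: eventually_mono)
  qed
  have "integrable (lebesgue_on S) (\<lambda>x. (cmod (f' x))\<^sup>2) \<longleftrightarrow> integrable (lebesgue_on S) (\<lambda>x. (cmod (f x))\<^sup>2)"
    using assms m unfolding ae_equal_def
    by (intro integrable_cong_AE) (auto simp: L2_def elim: eventually_mono)
  then show ?thesis using m assms(1) by (simp add: L2_def)
qed

lemma integrable_Ioo_iff:
  fixes f :: "real \<Rightarrow> complex"
  shows "integrable (lebesgue_on {a<..<b}) f \<longleftrightarrow> f absolutely_integrable_on {a..b}"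
  by (subst absolutely_integrable_on_Icc_iff_Ioo, unfold set_integrable_def,
      subst integrable_restrict_space) auto

lemma LINT_Ioo:
  fixes f :: "real \<Rightarrow> complex"
  assumes "integrable (lebesgue_on {a<..<b}) f"
  shows "(LINT x|lebesgue_on {a<..<b}. f x) = integral {a..b} f"
  using lebesgue_integral_eq_integral[OF assms] by (simp add: integral_open_interval_real)

lemma L2_mult_absolutely_integrable:
  fixes f g :: "real \<Rightarrow> complex"
  assumes "f \<in> L2 (lebesgue_on {a<..<b})" "g \<in> L2 (lebesgue_on {a<..<b})"
  shows "(\<lambda>x. f x * g x) absolutely_integrable_on {a..b}"
  using L2_integrable_mult[OF assms] by (simp add: integrable_Ioo_iff)

lemma l2_inner_Ioo:
  fixes f g :: "real \<Rightarrow> complex"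
  assumes "f \<in> L2 (lebesgue_on {a<..<b})" "g \<in> L2 (lebesgue_on {a<..<b})"
  shows "l2_inner (lebesgue_on {a<..<b}) f g = integral {a..b} (\<lambda>x. f x * cnj (g x))"
  unfolding l2_inner_def by (rule LINT_Ioo) (rule L2_integrable_inner[OF assms])

lemma L2_restrict:
  assumes "f \<in> L2 M" "{x \<in> space M. P x} \<in> sets M"
  shows "(\<lambda>x. if P x then f x else 0) \<in> L2 M"
proof -
  have "(\<lambda>x. if P x then f x else 0) \<in> borel_measurable M"
    using assms by (intro measurable_If) (auto simp: L2_def)
  then show ?thesis by (rule L2_dominated[OF assms(1)]) simp
qed

lemma L2_interval_restrict:
  fixes f :: "real \<Rightarrow> complex"
  assumes "f \<in> L2 (lebesgue_on {a<..<b})"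
  shows "(\<lambda>x. if x \<le> c then f x else 0) \<in> L2 (lebesgue_on {a<..<b})"
    and "(\<lambda>x. if x \<le> c then 0 else f x) \<in> L2 (lebesgue_on {a<..<b})"
proof -
  have "{x \<in> space (lebesgue_on {a<..<b}). x \<le> c} = {a<..<b} \<inter> {..c}"
    "{x \<in> space (lebesgue_on {a<..<b}). \<not> x \<le> c} = {a<..<b} \<inter> {c<..}"
    by auto
  then have s: "{x \<in> space (lebesgue_on {a<..<b}). x \<le> c} \<in> sets (lebesgue_on {a<..<b})"
    "{x \<in> space (lebesgue_on {a<..<b}). \<not> x \<le> c} \<in> sets (lebesgue_on {a<..<b})"
    by (auto simp: sets_restrict_space)
  show "(\<lambda>x. if x \<le> c then f x else 0) \<in> L2 (lebesgue_on {a<..<b})"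
    using L2_restrict[OF assms s(1)] .
  show "(\<lambda>x. if x \<le> c then 0 else f x) \<in> L2 (lebesgue_on {a<..<b})"
  proof -
    have "(\<lambda>x. if x \<le> c then 0 else f x) = (\<lambda>x. if \<not> x \<le> c then f x else 0)" by auto
    then show ?thesis using L2_restrict[OF assms s(2)] by (simp only:)
  qed
qed

text \<open>The singularity at \<open>0\<close> is square integrable below the exponent \<open>1/2\<close>; this is where \<open>\<nu> < 1\<close> enters
  for the second solution.\<close>

lemma L2_powr_bound:
  fixes f :: "real \<Rightarrow> complex"
  assumes f: "f \<in> borel_measurable (lebesgue_on {0<..<b})" and b: "0 < b"
    and le: "\<And>x. 0 < x \<Longrightarrow> x < b \<Longrightarrow> cmod (f x) \<le> C * x powr (- s)" and s: "s < 1 / 2"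
  shows "f \<in> L2 (lebesgue_on {0<..<b})"
proof -
  have "(\<lambda>x. x powr (- 2 * s)) absolutely_integrable_on {0..b}"
    using s b by (intro nonnegative_absolutely_integrable_1 integrable_on_powr_from_0) auto
  then have i: "integrable (lebesgue_on {0<..<b}) (\<lambda>x. C\<^sup>2 * x powr (- 2 * s))"
    unfolding absolutely_integrable_on_Icc_iff_Ioo
    by (intro integrable_mult_right absolutely_integrable_imp_integrable) auto
  have "integrable (lebesgue_on {0<..<b}) (\<lambda>x. (cmod (f x))\<^sup>2)"
  proof (rule Bochner_Integration.integrable_bound[OF i])
    show "AE x in lebesgue_on {0<..<b}. norm ((cmod (f x))\<^sup>2) \<le> norm (C\<^sup>2 * x powr (- 2 * s))"
    proof (rule AE_I2)
      fix x assume "x \<in> space (lebesgue_on {0<..<b})"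
      then have x: "0 < x" "x < b" by auto
      have "(cmod (f x))\<^sup>2 \<le> (C * x powr (- s))\<^sup>2"
        using le[OF x] by (intro power_mono) auto
      also have "(x powr (- s))\<^sup>2 = x powr (- 2 * s)"
        by (simp add: power2_eq_square flip: powr_add)
      then have "(C * x powr (- s))\<^sup>2 = C\<^sup>2 * x powr (- 2 * s)"
        by (simp add: power_mult_distrib)
      finally show "norm ((cmod (f x))\<^sup>2) \<le> norm (C\<^sup>2 * x powr (- 2 * s))" by simp
    qed
    show "(\<lambda>x. (cmod (f x))\<^sup>2) \<in> borel_measurable (lebesgue_on {0<..<b})" using f by simp
  qed
  then show ?thesis using f by (simp add: L2_def)
qed

lemma L2_bounded_continuous:
  fixes f :: "real \<Rightarrow> complex"
  assumes "continuous_on {0<..<b} f" and "0 < b" and "\<And>x. 0 < x \<Longrightarrow> x < b \<Longrightarrow> cmod (f x) \<le> C"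
  shows "f \<in> L2 (lebesgue_on {0<..<b})"
  using assms by (intro L2_powr_bound[where C = C and s = 0])
    (auto intro!: continuous_imp_measurable_on_sets_lebesgue)

lemma L2_one: "0 < b \<Longrightarrow> (\<lambda>x. 1) \<in> L2 (lebesgue_on {0<..<b::real})"
  using L2_bounded_continuous[of b "\<lambda>x. 1" 1] by simp

lemma L2_absolutely_integrable:
  fixes f :: "real \<Rightarrow> complex"
  assumes "0 < b" "f \<in> L2 (lebesgue_on {0<..<b})"
  shows "f absolutely_integrable_on {0..b}"
  using L2_mult_absolutely_integrable[OF L2_one[OF assms(1)] assms(2)] by simp

text \<open>Cauchy-Schwarz with the weight \<open>w\<close> cut off beyond \<open>x\<close>.\<close>

lemma initial_integral_bound:
  fixes g w :: "real \<Rightarrow> complex"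
  assumes g: "g \<in> L2 (lebesgue_on {0<..<b})" and w: "w \<in> L2 (lebesgue_on {0<..<b})"
    and x: "0 \<le> x" "x \<le> b" and W: "\<And>t. 0 < t \<Longrightarrow> t \<le> x \<Longrightarrow> cmod (w t) \<le> W"
  shows "cmod (integral {0..x} (\<lambda>t. w t * g t)) \<le> W * sqrt x * l2_norm (lebesgue_on {0<..<b}) g"
proof (cases "x = 0")
  case False
  let ?M = "lebesgue_on {0<..<b}"
  define v where "v = (\<lambda>t. if t \<le> x then w t else 0)"
  have v: "v \<in> L2 ?M" unfolding v_def by (rule L2_interval_restrict[OF w])
  have W0: "0 \<le> W" using W[of x] x False norm_ge_zero order_trans by (metis less_eq_real_def order_refl)
  have "integral {0..x} (\<lambda>t. w t * g t) = integral {0..x} (\<lambda>t. v t * g t)"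
    by (rule integral_cong) (simp add: v_def)
  also have "\<dots> = integral ({0..x} \<inter> {0..b}) (\<lambda>t. v t * g t)"
    using x by (simp add: Int_absorb2)
  also have "\<dots> = integral {0..b} (\<lambda>t. if t \<in> {0..x} then v t * g t else 0)"
    by (rule Henstock_Kurzweil_Integration.integral_restrict_Int[symmetric])
  also have "\<dots> = integral {0..b} (\<lambda>t. v t * g t)"
    by (rule integral_cong) (simp add: v_def)
  also have "\<dots> = l2_inner ?M v (\<lambda>t. cnj (g t))"
    using l2_inner_Ioo[OF v L2_cnj[OF g]] by simp
  finally have 1: "cmod (integral {0..x} (\<lambda>t. w t * g t)) \<le> l2_norm ?M v * l2_norm ?M g"
    using l2_Cauchy_Schwarz[OF v L2_cnj[OF g]] by (simp add: l2_norm_def)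
  define J where "J = {0<..<b} \<inter> {0..x}"
  have J: "J \<in> sets ?M" unfolding J_def by (auto simp: sets_restrict_space)
  have mJ: "emeasure ?M J = emeasure lebesgue J" "measure ?M J = measure lebesgue J"
    by (auto simp: J_def emeasure_restrict_space measure_restrict_space)
  have fin: "J \<in> lmeasurable" unfolding J_def
    by (rule fmeasurable_Int_fmeasurable) auto
  have "(LINT t|?M. (cmod (v t))\<^sup>2) \<le> (LINT t|?M. indicator J t * W\<^sup>2)"
  proof (rule integral_mono)
    show "integrable ?M (\<lambda>t. (cmod (v t))\<^sup>2)" using v by (simp add: L2_def)
    show "integrable ?M (\<lambda>t. indicator J t * W\<^sup>2)"
      using J fin mJ by (intro integrable_mult_left integrable_real_indicator)
        (auto simp: fmeasurable_def)
    fix t assume "t \<in> space ?M"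
    then show "(cmod (v t))\<^sup>2 \<le> indicator J t * W\<^sup>2"
      using W[of t] by (auto simp: v_def indicator_def J_def intro!: power_mono)
  qed
  also have "\<dots> = W\<^sup>2 * measure lebesgue J"
    using sets.sets_into_space[OF J] by (simp add: mJ Int_absorb2)
  also have "measure lebesgue J \<le> measure lebesgue {0..x}"
    using fin by (intro measure_mono_fmeasurable) (auto simp: J_def)
  also have "\<dots> = x" using x by simp
  finally have "(LINT t|?M. (cmod (v t))\<^sup>2) \<le> W\<^sup>2 * x"
    by (simp add: mult_left_mono)
  then have "l2_norm ?M v \<le> sqrt (W\<^sup>2 * x)" by (simp add: l2_norm_def)
  also have "\<dots> = W * sqrt x" using W0 by (simp add: real_sqrt_mult)
  finally show ?thesis
    using 1 mult_right_mono[OF _ l2_norm_nonneg[of ?M g]] order_trans by blast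
qed simp

lemma L2_mult_continuous:
  fixes f h :: "real \<Rightarrow> complex"
  assumes f: "f \<in> L2 (lebesgue_on {a<..<b})" and h: "continuous_on {a..b} h"
  shows "(\<lambda>x. f x * h x) \<in> L2 (lebesgue_on {a<..<b})"
proof -
  let ?M = "lebesgue_on {a<..<b}"
  have "bounded (h ` {a..b})"
    using h by (intro compact_imp_bounded compact_continuous_image) auto
  then obtain B where B: "\<And>x. x \<in> {a..b} \<Longrightarrow> cmod (h x) \<le> B"
    unfolding bounded_iff by (metis imageI)
  have hm: "h \<in> borel_measurable ?M"
    using h by (intro continuous_imp_measurable_on_sets_lebesgue continuous_on_subset[OF h]) auto
  then have m: "(\<lambda>x. f x * h x) \<in> borel_measurable ?M"
    using f by (auto simp: L2_def)
  show ?thesis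
  proof (rule L2_dominated[OF L2_cmult[OF f, of "of_real B"] m])
    fix x assume "x \<in> space ?M"
    then have "cmod (h x) \<le> \<bar>B\<bar>" using B[of x] by auto
    from mult_right_mono[OF this, of "cmod (f x)"]
    show "cmod (f x * h x) \<le> cmod (of_real B * f x)"
      by (simp add: norm_mult mult.commute)
  qed
qed

lemma powr_tendsto_0_at_right: "0 < p \<Longrightarrow> ((\<lambda>x. x powr p) \<longlongrightarrow> 0) (at_right (0::real))"
  by (rule tendsto_zero_powrI[OF tendsto_ident_at tendsto_const])
    (auto intro: eventually_mono[OF eventually_at_right_less])

lemma AE_interval_witness:
  fixes U :: "real set"
  assumes ae: "AE x in lebesgue_on {a<..<b}. Q x" and U: "open U" "U \<noteq> {}" "U \<subseteq> {a<..<b}"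
  shows "\<exists>x\<in>U. Q x"
proof (rule ccontr)
  assume no: "\<not> (\<exists>x\<in>U. Q x)"
  have "AE x in lebesgue. x \<in> {a<..<b} \<longrightarrow> Q x"
    using ae by (simp add: AE_restrict_space_iff)
  then have "AE x in lebesgue. x \<notin> U"
    using no U(3) by (auto elim!: eventually_mono)
  moreover have "U \<in> sets lebesgue" using U(1) by auto
  ultimately have "U \<in> null_sets lebesgue" by (simp add: AE_iff_null_sets)
  then have "negligible U" by (simp add: negligible_iff_null_sets)
  then show False using open_not_negligible U by blast
qed

lemma continuous_ae_equal_imp_equal:
  fixes f g :: "real \<Rightarrow> complex"
  assumes "ae_equal (lebesgue_on {a<..<b}) f g" "continuous_on {a<..<b} f" "continuous_on {a<..<b} g"
    and x: "x \<in> {a<..<b}"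
  shows "f x = g x"
proof (rule ccontr)
  assume ne: "f x \<noteq> g x"
  let ?U = "{a<..<b} \<inter> (\<lambda>x. f x - g x) -` (- {0})"
  have "open ?U"
    by (rule continuous_open_preimage) (auto intro!: continuous_intros assms(2,3))
  moreover have "?U \<noteq> {}" using ne x by auto
  ultimately have "\<exists>x\<in>?U. f x = g x"
    using assms(1) unfolding ae_equal_def by (intro AE_interval_witness[where a = a and b = b]) auto
  then show False by auto
qed

lemma integral_cong_ae_equal:
  fixes f g :: "real \<Rightarrow> complex"
  assumes "ae_equal (lebesgue_on {a<..<b}) f g" "{c..d} \<subseteq> {a..b}"
  shows "integral {c..d} (\<lambda>t. w t * f t) = integral {c..d} (\<lambda>t. w t * g t)"
proof -
  have "AE x in lebesgue. x \<in> {a<..<b} \<longrightarrow> f x = g x"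
    using assms(1) by (simp add: ae_equal_def AE_restrict_space_iff)
  then obtain N where N: "{x. \<not> (x \<in> {a<..<b} \<longrightarrow> f x = g x)} \<subseteq> N" "N \<in> null_sets lebesgue"
    unfolding eventually_ae_filter by auto
  have "negligible (N \<union> {a, b})"
    using N(2) by (auto simp: negligible_iff_null_sets[symmetric])
  then show ?thesis
  proof (rule integral_spike)
    fix x assume x: "x \<in> {c..d} - (N \<union> {a, b})"
    then have "x \<in> {a<..<b}" using assms(2) by (auto simp: less_le)
    then show "w x * g x = w x * f x" using x N(1) by auto
  qed
qed

section \<open>Zero-energy solutions of the Bessel equation\<close>

locale bessel =
  fixes \<nu> b :: real
  assumes nu: "0 \<le> \<nu>" "\<nu> < 1" and b_pos: "0 < b"
begin

abbreviation M where "M \<equiv> lebesgue_Ioo0 b"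

definition u :: "real \<Rightarrow> real" where "u x = x powr (1/2 + \<nu>)"
definition u' :: "real \<Rightarrow> real" where "u' x = (1/2 + \<nu>) * x powr (\<nu> - 1/2)"
definition q :: "real \<Rightarrow> real" where "q x = (\<nu>\<^sup>2 - 1/4) / x\<^sup>2"

text \<open>The primitive \<open>\<integral> 1 / u\<^sup>2\<close> over \<open>(x, b)\<close> in closed form.\<close>

definition \<rho> :: "real \<Rightarrow> real" where
  "\<rho> x = (if \<nu> = 0 then ln (b / x) else (x powr (- 2 * \<nu>) - b powr (- 2 * \<nu>)) / (2 * \<nu>))"

text \<open>The second solution, obtained from \<open>u\<close> by reduction of order and normalised to vanish at \<open>b\<close>. It
  spans the kernel of \<open>A\<^sup>*\<close>.\<close>

definition k :: "real \<Rightarrow> real" where "k x = u x * \<rho> x"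
definition k' :: "real \<Rightarrow> real" where "k' x = u' x * \<rho> x - 1 / u x"

lemma u_pos: "0 < x \<Longrightarrow> 0 < u x" by (simp add: u_def)

lemma u_sq: "(u x)\<^sup>2 = x powr (1 + 2 * \<nu>)"
  by (simp add: u_def power2_eq_square flip: powr_add)

lemma u_deriv: "0 < x \<Longrightarrow> (u has_real_derivative u' x) (at x)"
  unfolding u_def[abs_def] u'_def
  using has_real_derivative_powr[of x "1/2 + \<nu>"] by (simp add: algebra_simps)

lemma u'_deriv: "0 < x \<Longrightarrow> (u' has_real_derivative q x * u x) (at x)"
proof -
  assume x: "0 < x"
  have "((\<lambda>x. (1/2 + \<nu>) * x powr (\<nu> - 1/2)) has_real_derivative
      (1/2 + \<nu>) * ((\<nu> - 1/2) * x powr (\<nu> - 1/2 - 1))) (at x)"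
    by (intro DERIV_cmult has_real_derivative_powr x)
  moreover have "x powr (\<nu> - 1/2 - 1) = u x / x\<^sup>2"
  proof -
    have "x powr (\<nu> - 1/2 - 1) = x powr ((1/2 + \<nu>) - 2)" by (simp add: algebra_simps)
    also have "\<dots> = u x / x powr 2" unfolding powr_diff u_def ..
    finally show ?thesis using x by (simp add: powr_numeral)
  qed
  moreover have "(1/2 + \<nu>) * ((\<nu> - 1/2) * (u x / x\<^sup>2)) = q x * u x"
    by (simp add: q_def field_simps power2_eq_square)
  ultimately show ?thesis
    unfolding u'_def[abs_def] by simp
qed

lemma \<rho>_deriv: "0 < x \<Longrightarrow> (\<rho> has_real_derivative - 1 / (u x)\<^sup>2) (at x)"
proof (cases "\<nu> = 0")
  case True
  assume x: "0 < x"
  have "((\<lambda>x. ln (b / x)) has_real_derivative - 1 / x) (at x)"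
    using x b_pos by (auto intro!: derivative_eq_intros simp: field_simps power2_eq_square)
  then show ?thesis using x unfolding u_sq \<rho>_def[abs_def] by (simp add: True)
next
  case False
  assume x: "0 < x"
  have "((\<lambda>x. (x powr (- 2 * \<nu>) - b powr (- 2 * \<nu>)) / (2 * \<nu>)) has_real_derivative
      ((- 2 * \<nu>) * x powr (- 2 * \<nu> - 1) - 0) / (2 * \<nu>)) (at x)"
    by (intro DERIV_cdivide DERIV_diff DERIV_const has_real_derivative_powr x)
  moreover have "x powr (- 2 * \<nu> - 1) = 1 / x powr (1 + 2 * \<nu>)"
    unfolding powr_minus_divide[symmetric] by (rule arg_cong) simp
  ultimately show ?thesis using False by (simp add: u_sq \<rho>_def[abs_def])
qed

lemma \<rho>_b [simp]: "\<rho> b = 0" using b_pos by (simp add: \<rho>_def)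

lemma \<rho>_antimono: "0 < x \<Longrightarrow> x \<le> y \<Longrightarrow> \<rho> y \<le> \<rho> x"
proof -
  assume x: "0 < x" "x \<le> y"
  show ?thesis
  proof (rule DERIV_nonpos_imp_nonincreasing[OF x(2)])
    fix z assume "x \<le> z"
    then show "\<exists>l. (\<rho> has_real_derivative l) (at z) \<and> l \<le> 0"
      using x \<rho>_deriv[of z] by (intro exI[of _ "- 1 / (u z)\<^sup>2"]) auto
  qed
qed

lemma \<rho>_nonneg: "0 < x \<Longrightarrow> x \<le> b \<Longrightarrow> 0 \<le> \<rho> x"
  using \<rho>_antimono[of x b] by simp

lemma k_nonneg: "0 < x \<Longrightarrow> x \<le> b \<Longrightarrow> 0 \<le> k x"
  using \<rho>_nonneg u_pos by (simp add: k_def less_imp_le)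

lemma \<rho>_pos: "0 < x \<Longrightarrow> x < b \<Longrightarrow> 0 < \<rho> x"
proof -
  assume x: "0 < x" "x < b"
  have "\<rho> b < \<rho> x"
  proof (rule DERIV_neg_imp_decreasing[OF x(2)])
    fix z assume "x \<le> z"
    then show "\<exists>l. (\<rho> has_real_derivative l) (at z) \<and> l < 0"
      using x \<rho>_deriv[of z] u_pos[of z] by (intro exI[of _ "- 1 / (u z)\<^sup>2"]) auto
  qed
  then show ?thesis by simp
qed

lemma k_pos: "0 < x \<Longrightarrow> x < b \<Longrightarrow> 0 < k x"
  using \<rho>_pos u_pos by (simp add: k_def)

lemma k_b [simp]: "k b = 0" by (simp add: k_def)

lemma k_deriv: "0 < x \<Longrightarrow> (k has_real_derivative k' x) (at x)"
proof -
  assume x: "0 < x"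
  have "((\<lambda>x. u x * \<rho> x) has_real_derivative u' x * \<rho> x + - 1 / (u x)\<^sup>2 * u x) (at x)"
    by (intro DERIV_mult u_deriv \<rho>_deriv x)
  then show ?thesis using u_pos[OF x]
    unfolding k_def[abs_def] k'_def by (simp add: power2_eq_square)
qed

lemma wronskian: "0 < x \<Longrightarrow> k x * u' x - u x * k' x = 1"
  using u_pos[of x] by (simp add: k_def k'_def field_simps)

lemma k'_deriv: "0 < x \<Longrightarrow> (k' has_real_derivative q x * k x) (at x)"
proof -
  assume x: "0 < x"
  have "((\<lambda>x. u' x * \<rho> x - 1 / u x) has_real_derivative
      q x * u x * \<rho> x + - 1 / (u x)\<^sup>2 * u' x - (0 * u x - 1 * u' x) / (u x * u x)) (at x)"
    using u_pos[OF x] by (intro DERIV_mult DERIV_diff DERIV_divide DERIV_const u_deriv u'_deriv \<rho>_deriv x) auto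
  then show ?thesis
    unfolding k'_def[abs_def] k_def by (simp add: power2_eq_square mult.assoc)
qed

lemma continuous_on_u: "continuous_on {0<..} u"
  by (rule DERIV_continuous_on[OF has_field_derivative_at_within[OF u_deriv]]) simp

lemma continuous_on_u': "continuous_on {0<..} u'"
  by (rule DERIV_continuous_on[OF has_field_derivative_at_within[OF u'_deriv]]) simp

lemma continuous_on_\<rho>: "continuous_on {0<..} \<rho>"
  by (rule DERIV_continuous_on[OF has_field_derivative_at_within[OF \<rho>_deriv]]) simp

lemma continuous_on_k: "continuous_on {0<..} k"
  by (rule DERIV_continuous_on[OF has_field_derivative_at_within[OF k_deriv]]) simp

lemma u_mono: "0 \<le> x \<Longrightarrow> x \<le> y \<Longrightarrow> u x \<le> u y"
  unfolding u_def using nu by (intro powr_mono2) auto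

text \<open>Convexity of the exponential function: with \<open>L = ln (b / x)\<close> one has
  \<open>x powr (-2\<nu>) = b powr (-2\<nu>) * exp (2 \<nu> L) \<ge> b powr (-2\<nu>) * (1 + 2 \<nu> L)\<close>.\<close>

lemma \<rho>_lower_bound: "0 < x \<Longrightarrow> b powr (- 2 * \<nu>) * ln (b / x) \<le> \<rho> x"
proof (cases "\<nu> = 0")
  case False
  assume x: "0 < x"
  have "x powr (- 2 * \<nu>) = b powr (- 2 * \<nu>) * exp (2 * \<nu> * ln (b / x))"
    using x b_pos by (simp add: powr_def ln_div flip: exp_add) (simp add: algebra_simps)
  also have "\<dots> \<ge> b powr (- 2 * \<nu>) * (1 + 2 * \<nu> * ln (b / x))"
    by (intro mult_left_mono exp_ge_add_one_self) auto
  finally have "2 * \<nu> * (b powr (- 2 * \<nu>) * ln (b / x)) \<le> x powr (- 2 * \<nu>) - b powr (- 2 * \<nu>)"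
    by (simp add: algebra_simps)
  then show ?thesis using False nu by (simp add: \<rho>_def field_simps)
qed (unfold \<rho>_def, use b_pos in simp)

lemma \<rho>_unbounded: "\<exists>x. 0 < x \<and> x < b \<and> C < \<rho> x"
proof -
  define L where "L = (\<bar>C\<bar> + 1) * b powr (2 * \<nu>)"
  define x where "x = b * exp (- L)"
  have "b powr (2 * \<nu>) > 0" using b_pos by simp
  then have L: "L > 0" unfolding L_def by simp
  then have x: "0 < x" "x < b" using b_pos by (auto simp: x_def)
  have "ln (b / x) = L" using b_pos by (simp add: x_def exp_minus field_simps ln_mult ln_div)
  then have "\<rho> x \<ge> b powr (- 2 * \<nu>) * L" using \<rho>_lower_bound[OF x(1)] by simp
  also have "b powr (- 2 * \<nu>) * L = \<bar>C\<bar> + 1"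
    using b_pos by (simp add: L_def powr_minus field_simps)
  finally show ?thesis using x by (intro exI[of _ x]) auto
qed

text \<open>The exponent lies between \<open>2 \<nu>\<close>, the order of growth of \<open>\<rho>\<close> when \<open>\<nu> > 0\<close>, and \<open>1 + \<nu>\<close>; it is
  positive also for \<open>\<nu> = 0\<close>, where it absorbs the logarithm.\<close>

lemma \<rho>_upper_bound: "\<exists>C\<ge>0. \<forall>x. 0 < x \<and> x \<le> b \<longrightarrow> \<rho> x \<le> C * x powr (- (1 + 3 * \<nu>) / 2)"
proof (cases "\<nu> = 0")
  case True
  show ?thesis
  proof (intro exI[of _ "2 * b powr (1/2)"] conjI allI impI)
    fix x assume x: "0 < x \<and> x \<le> b"
    then have "ln (b / x) \<le> (b / x) powr (1/2) / (1/2)"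
      by (intro ln_powr_bound) auto
    then show "\<rho> x \<le> 2 * b powr (1/2) * x powr (- (1 + 3 * \<nu>) / 2)"
      using x b_pos unfolding \<rho>_def by (simp add: True powr_divide powr_minus field_simps)
  qed simp
next
  case False
  show ?thesis
  proof (intro exI[of _ "b powr ((1 - \<nu>) / 2) / (2 * \<nu>)"] conjI allI impI)
    fix x assume x: "0 < x \<and> x \<le> b"
    have "x powr (- 2 * \<nu>) = x powr ((1 - \<nu>) / 2) * x powr (- (1 + 3 * \<nu>) / 2)"
      by (simp flip: powr_add) (simp add: field_simps)
    also have "\<dots> \<le> b powr ((1 - \<nu>) / 2) * x powr (- (1 + 3 * \<nu>) / 2)"
      using x nu by (intro mult_right_mono powr_mono2) auto
    finally have "x powr (- 2 * \<nu>) - b powr (- 2 * \<nu>) \<le> b powr ((1 - \<nu>) / 2) * x powr (- (1 + 3 * \<nu>) / 2)"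
      using powr_ge_zero[of b "- 2 * \<nu>"] by linarith
    then show "\<rho> x \<le> b powr ((1 - \<nu>) / 2) / (2 * \<nu>) * x powr (- (1 + 3 * \<nu>) / 2)"
      using False nu by (simp add: \<rho>_def divide_right_mono)
  qed (use nu in simp)
qed

lemma k_upper_bound: "\<exists>C\<ge>0. \<forall>x. 0 < x \<and> x \<le> b \<longrightarrow> k x \<le> C * x powr (- \<nu> / 2)"
proof -
  obtain C where C: "C \<ge> 0" "\<And>x. 0 < x \<Longrightarrow> x \<le> b \<Longrightarrow> \<rho> x \<le> C * x powr (- (1 + 3 * \<nu>) / 2)"
    using \<rho>_upper_bound by blast
  have "k x \<le> C * x powr (- \<nu> / 2)" if x: "0 < x" "x \<le> b" for x
  proof -
    have "k x \<le> u x * (C * x powr (- (1 + 3 * \<nu>) / 2))"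
      unfolding k_def using C(2)[OF x] u_pos[OF x(1)] by (intro mult_left_mono) auto
    also have "\<dots> = C * (x powr (1/2 + \<nu>) * x powr (- (1 + 3 * \<nu>) / 2))"
      by (simp add: u_def)
    also have "x powr (1/2 + \<nu>) * x powr (- (1 + 3 * \<nu>) / 2) = x powr (- \<nu> / 2)"
      by (simp flip: powr_add) (simp add: field_simps)
    finally show ?thesis .
  qed
  then show ?thesis using C(1) by blast
qed

abbreviation cu :: "real \<Rightarrow> complex" where "cu x \<equiv> of_real (u x)"
abbreviation ck :: "real \<Rightarrow> complex" where "ck x \<equiv> of_real (k x)"

lemma u_L2: "cu \<in> L2 M"
proof (rule L2_bounded_continuous[where C = "u b"])
  show "continuous_on {0<..<b} cu"
    by (intro continuous_on_of_real continuous_on_subset[OF continuous_on_u]) auto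
qed (use b_pos u_mono in \<open>auto simp: u_def\<close>)

lemma k_L2: "ck \<in> L2 M"
proof -
  obtain C where C: "\<And>x. 0 < x \<Longrightarrow> x \<le> b \<Longrightarrow> k x \<le> C * x powr (- \<nu> / 2)"
    using k_upper_bound by blast
  have "continuous_on {0<..<b} ck"
    by (intro continuous_on_of_real continuous_on_subset[OF continuous_on_k]) auto
  then show ?thesis
    using C k_nonneg nu b_pos
    by (intro L2_powr_bound[where C = C and s = "\<nu> / 2"] continuous_imp_measurable_on_sets_lebesgue)
      auto
qed

end

section \<open>Solutions of the inhomogeneous Bessel equation\<close>

context bessel
begin

text \<open>For \<open>f = sol a g\<close>, the functions \<open>Y a g\<close> and \<open>- Z g\<close> are the brackets of \<open>f\<close> with \<open>u\<close> and \<open>k\<close>, and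
  \<open>\<psi> = f / u\<close>. The first parameter is the value of the bracket with \<open>u\<close> at \<open>0\<close>; the missing second
  parameter is fixed by \<open>f b = 0\<close>.\<close>

definition Y :: "complex \<Rightarrow> (real \<Rightarrow> complex) \<Rightarrow> real \<Rightarrow> complex" where
  "Y a g x = a + integral {0..x} (\<lambda>t. cu t * g t)"

definition Z :: "(real \<Rightarrow> complex) \<Rightarrow> real \<Rightarrow> complex" where
  "Z g x = integral {x..b} (\<lambda>t. ck t * g t)"

definition sol :: "complex \<Rightarrow> (real \<Rightarrow> complex) \<Rightarrow> real \<Rightarrow> complex" where
  "sol a g x = ck x * Y a g x + cu x * Z g x"

definition \<psi> :: "complex \<Rightarrow> (real \<Rightarrow> complex) \<Rightarrow> real \<Rightarrow> complex" where
  "\<psi> a g x = of_real (\<rho> x) * Y a g x + Z g x"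

definition sol' :: "complex \<Rightarrow> (real \<Rightarrow> complex) \<Rightarrow> real \<Rightarrow> complex" where
  "sol' a g x = of_real (u' x) * \<psi> a g x - Y a g x / cu x"

lemma sol_eq_u_\<psi>: "sol a g x = cu x * \<psi> a g x"
  by (simp add: sol_def \<psi>_def k_def algebra_simps)

lemma u_0 [simp]: "u 0 = 0" using nu by (simp add: u_def)
lemma k_0 [simp]: "k 0 = 0" by (simp add: k_def)

lemma Y_0 [simp]: "Y a g 0 = a" by (simp add: Y_def)
lemma Z_b [simp]: "Z g b = 0" by (simp add: Z_def)

lemma ug_integrable: "g \<in> L2 M \<Longrightarrow> (\<lambda>t. cu t * g t) absolutely_integrable_on {0..b}"
  by (rule L2_mult_absolutely_integrable[OF u_L2])

lemma kg_integrable: "g \<in> L2 M \<Longrightarrow> (\<lambda>t. ck t * g t) absolutely_integrable_on {0..b}"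
  by (rule L2_mult_absolutely_integrable[OF k_L2])

lemma Y_increment:
  assumes "g \<in> L2 M" "0 \<le> x" "x \<le> y" "y \<le> b"
  shows "Y a g y = Y a g x + integral {x..y} (\<lambda>t. cu t * g t)"
  by (rule indefinite_integral_increment[where a = 0 and b = b])
    (use assms ug_integrable[OF assms(1)] in \<open>auto simp: Y_def absolutely_integrable_on_def\<close>)

lemma Z_increment:
  assumes "g \<in> L2 M" "0 \<le> x" "x \<le> y" "y \<le> b"
  shows "Z g y = Z g x + integral {x..y} (\<lambda>t. - (ck t * g t))"
proof -
  have "(\<lambda>t. ck t * g t) absolutely_integrable_on {x..b}"
    using kg_integrable[OF assms(1)] assms by (auto intro: absolutely_integrable_on_subinterval)
  then have "integral {x..y} (\<lambda>t. ck t * g t) + integral {y..b} (\<lambda>t. ck t * g t)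
      = integral {x..b} (\<lambda>t. ck t * g t)"
    using assms by (intro Henstock_Kurzweil_Integration.integral_combine)
      (auto simp: absolutely_integrable_on_def)
  then show ?thesis by (simp add: Z_def algebra_simps)
qed

lemma continuous_Y: "g \<in> L2 M \<Longrightarrow> continuous_on {0..b} (Y a g)"
  unfolding Y_def[abs_def] using ug_integrable[of g]
  by (intro continuous_intros indefinite_integral_continuous_1) (simp add: absolutely_integrable_on_def)

lemma continuous_Z: "g \<in> L2 M \<Longrightarrow> continuous_on {0..b} (Z g)"
  unfolding Z_def[abs_def] using kg_integrable[of g]
  by (intro indefinite_integral_continuous_1') (simp add: absolutely_integrable_on_def)

lemma sol_L2: "g \<in> L2 M \<Longrightarrow> sol a g \<in> L2 M"
  unfolding sol_def[abs_def]
  by (intro L2_add L2_mult_continuous u_L2 k_L2 continuous_Y continuous_Z)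

lemma sol_add: "\<lbrakk>g \<in> L2 M; g' \<in> L2 M; 0 \<le> x; x \<le> b\<rbrakk> \<Longrightarrow>
    sol (a + a') (\<lambda>x. g x + g' x) x = sol a g x + sol a' g' x"
proof -
  assume g: "g \<in> L2 M" "g' \<in> L2 M" and x: "0 \<le> x" "x \<le> b"
  have sub: "h absolutely_integrable_on {0..x} \<and> h absolutely_integrable_on {x..b}"
    if "h absolutely_integrable_on {0..b}" for h :: "real \<Rightarrow> complex"
    using x by (auto intro: absolutely_integrable_on_subinterval[OF that])
  show ?thesis
    using sub[OF ug_integrable[OF g(1)]] sub[OF ug_integrable[OF g(2)]]
      sub[OF kg_integrable[OF g(1)]] sub[OF kg_integrable[OF g(2)]]
    by (simp add: sol_def Y_def Z_def distrib_left absolutely_integrable_on_def integral_add)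
qed

lemma sol_cmult: "sol (c * a) (\<lambda>x. c * g x) x = c * sol a g x"
proof -
  have "(\<lambda>t. cu t * (c * g t)) = (\<lambda>t. c * (cu t * g t))" "(\<lambda>t. ck t * (c * g t)) = (\<lambda>t. c * (ck t * g t))"
    by (simp_all add: mult.left_commute)
  then show ?thesis by (simp add: sol_def Y_def Z_def algebra_simps)
qed

lemma sol_eq_k_plus: "sol a g x = a * ck x + sol 0 g x"
  by (simp add: sol_def Y_def algebra_simps)

text \<open>The equation \<open>-f'' + q f = g\<close> in factorised form: for \<open>f = u \<psi>\<close> it reads
  \<open>-(u\<^sup>2 \<psi>')' = u g\<close>, and \<open>u\<^sup>2 \<psi>' = -Y\<close>.\<close>

lemma \<psi>_increment:
  assumes g: "g \<in> L2 M" and x: "0 < x" "x \<le> y" "y \<le> b"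
  shows "\<psi> a g y = \<psi> a g x + integral {x..y} (\<lambda>t. - (Y a g t) / of_real ((u t)\<^sup>2))"
proof -
  have ug: "(\<lambda>t. cu t * g t) absolutely_integrable_on {x..y}"
    and kg: "(\<lambda>t. ck t * g t) absolutely_integrable_on {x..y}"
    using ug_integrable[OF g] kg_integrable[OF g] x by (auto intro: absolutely_integrable_on_subinterval)
  have c\<rho>: "continuous_on {x..y} (\<lambda>t. complex_of_real (- 1 / (u t)\<^sup>2))"
    using x u_pos by (intro continuous_intros continuous_on_subset[OF continuous_on_u]) (auto simp: less_imp_neq[symmetric])
  have \<rho>v: "((\<lambda>x. complex_of_real (\<rho> x)) has_vector_derivative of_real (- 1 / (u t)\<^sup>2)) (at t)"
    if "t \<in> {x..y}" for t
    using that x by (intro has_vector_derivative_of_real \<rho>_deriv) auto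
  note \<rho>i = C1_imp_indefinite_integral[OF \<rho>v c\<rho>]
  have Yi: "Y a g t = Y a g x + integral {x..t} (\<lambda>t. cu t * g t)" if "t \<in> {x..y}" for t
    using Y_increment[OF g, of x t] that x by auto
  note prod = integral_product_rule[OF x(2) \<rho>i(1) ug \<rho>i(2) Yi]
  have "integral {x..y} (\<lambda>t. of_real (- 1 / (u t)\<^sup>2) * Y a g t + of_real (\<rho> t) * (cu t * g t))
      + integral {x..y} (\<lambda>t. - (ck t * g t))
      = integral {x..y} (\<lambda>t. (of_real (- 1 / (u t)\<^sup>2) * Y a g t + of_real (\<rho> t) * (cu t * g t)) + - (ck t * g t))"
    using prod(2) kg
    by (intro integral_add[symmetric] integrable_neg) (auto simp: absolutely_integrable_on_def)
  also have "\<dots> = integral {x..y} (\<lambda>t. - (Y a g t) / of_real ((u t)\<^sup>2))"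
    by (rule integral_cong) (simp add: k_def)
  finally have eq: "integral {x..y} (\<lambda>t. of_real (- 1 / (u t)\<^sup>2) * Y a g t + of_real (\<rho> t) * (cu t * g t))
      + integral {x..y} (\<lambda>t. - (ck t * g t))
      = integral {x..y} (\<lambda>t. - (Y a g t) / of_real ((u t)\<^sup>2))" .
  have by_parts: "integral {x..y} (\<lambda>t. of_real (- 1 / (u t)\<^sup>2) * Y a g t + of_real (\<rho> t) * (cu t * g t))
      = of_real (\<rho> y) * Y a g y - of_real (\<rho> x) * Y a g x"
    using prod(1) by simp
  show ?thesis
    unfolding \<psi>_def eq[symmetric] by_parts Z_increment[OF g less_imp_le[OF x(1)] x(2,3)] by simp
qed

lemma continuous_\<psi>': "g \<in> L2 M \<Longrightarrow> 0 < x \<Longrightarrow> continuous_on {x..b} (\<lambda>t. - (Y a g t) / of_real ((u t)\<^sup>2))"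
  using u_pos by (intro continuous_intros continuous_on_subset[OF continuous_on_u]
      continuous_on_subset[OF continuous_Y]) (auto simp: less_imp_neq[symmetric])

lemma \<psi>_deriv:
  assumes g: "g \<in> L2 M" and x: "0 < x" "x < b"
  shows "(\<psi> a g has_vector_derivative - (Y a g x) / of_real ((u x)\<^sup>2)) (at x)"
proof -
  let ?p = "\<lambda>t. - (Y a g t) / of_real ((u t)\<^sup>2)"
  have "((\<lambda>t. integral {x/2..t} ?p) has_vector_derivative ?p x) (at x within {x/2..b})"
    using x g by (intro integral_has_vector_derivative continuous_\<psi>') auto
  then have "((\<lambda>t. integral {x/2..t} ?p) has_vector_derivative ?p x) (at x within {x/2<..<b})"
    by (rule has_vector_derivative_within_subset) auto
  then have "((\<lambda>t. integral {x/2..t} ?p) has_vector_derivative ?p x) (at x)"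
    using x by (simp add: at_within_open[of x "{x/2<..<b}"])
  then have "((\<lambda>t. \<psi> a g (x/2) + integral {x/2..t} ?p) has_vector_derivative ?p x) (at x)"
    using has_vector_derivative_add[OF has_vector_derivative_const, of _ "?p x"] by fastforce
  then show ?thesis
  proof (rule has_vector_derivative_transform_within_open[where S = "{x/2<..<b}"])
    fix t assume "t \<in> {x/2<..<b}"
    then show "\<psi> a g (x/2) + integral {x/2..t} ?p = \<psi> a g t"
      using \<psi>_increment[OF g, of "x/2" t] x by simp
  qed (use x in auto)
qed

lemma sol_deriv:
  assumes g: "g \<in> L2 M" and x: "0 < x" "x < b"
  shows "(sol a g has_vector_derivative sol' a g x) (at x)"
proof -
  have "((\<lambda>t. cu t * \<psi> a g t) has_vector_derivative
      cu x * (- (Y a g x) / of_real ((u x)\<^sup>2)) + of_real (u' x) * \<psi> a g x) (at x)"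
    by (intro has_vector_derivative_mult has_vector_derivative_of_real u_deriv \<psi>_deriv g x)
  then show ?thesis
    using u_pos[OF x(1)] by (simp add: sol'_def sol_eq_u_\<psi>[abs_def] power2_eq_square)
qed

lemma continuous_on_\<psi>: "g \<in> L2 M \<Longrightarrow> continuous_on {0<..b} (\<psi> a g)"
  unfolding \<psi>_def[abs_def]
  by (intro continuous_intros continuous_on_subset[OF continuous_on_\<rho>]
      continuous_on_subset[OF continuous_Y] continuous_on_subset[OF continuous_Z]) auto

lemma continuous_on_sol': "g \<in> L2 M \<Longrightarrow> continuous_on {0<..b} (sol' a g)"
  unfolding sol'_def[abs_def] using u_pos
  by (intro continuous_intros continuous_on_\<psi> continuous_on_subset[OF continuous_on_u']
      continuous_on_subset[OF continuous_on_u] continuous_on_subset[OF continuous_Y])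
    (auto simp: less_imp_neq[symmetric])

lemma bracket_sol_u: "0 < x \<Longrightarrow> sol a g x * of_real (u' x) - sol' a g x * cu x = Y a g x"
  using u_pos[of x] by (simp add: sol_eq_u_\<psi> sol'_def field_simps)

lemma bracket_sol_k: "0 < x \<Longrightarrow> sol a g x * of_real (k' x) - sol' a g x * ck x = - Z g x"
  using u_pos[of x] by (simp add: sol_eq_u_\<psi> sol'_def k_def k'_def \<psi>_def field_simps)

text \<open>Integrate by parts twice: \<open>Z g\<close> against \<open>Y a' g'\<close>, and \<open>Y a g\<close> against \<open>Z g'\<close>.\<close>

lemma sol_green:
  assumes g: "g \<in> L2 M" "g' \<in> L2 M"
  shows "l2_inner M g (sol a' g') - l2_inner M (sol a g) g' = Z g 0 * cnj a' - a * cnj (Z g' 0)"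
proof -
  have g'c: "(\<lambda>x. cnj (g' x)) \<in> L2 M" using L2_cnj[OF g(2)] .
  have cY: "cnj (Y a' g' x) = Y (cnj a') (\<lambda>x. cnj (g' x)) x" and cZ: "cnj (Z g' x) = Z (\<lambda>x. cnj (g' x)) x" for x
    by (simp_all add: Y_def Z_def Henstock_Kurzweil_Integration.integral_cnj)
  have Yi: "Y a g x = Y a g 0 + integral {0..x} (\<lambda>t. cu t * g t)"
    and Zi: "Z g x = Z g 0 + integral {0..x} (\<lambda>t. - (ck t * g t))"
    if "g \<in> L2 M" "x \<in> {0..b}" for a g x
    using Y_increment[OF that(1), of 0 x] Z_increment[OF that(1), of 0 x] that(2) by auto
  have kg: "(\<lambda>t. - (ck t * g t)) absolutely_integrable_on {0..b}" if "g \<in> L2 M" for g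
    using kg_integrable[OF that] by (simp add: set_integrable_def)
  note 1 = integral_product_rule[OF less_imp_le[OF b_pos] kg[OF g(1)] ug_integrable[OF g'c]
      Zi[OF g(1)] Yi[OF g'c, of _ "cnj a'"]]
  note 2 = integral_product_rule[OF less_imp_le[OF b_pos] ug_integrable[OF g(1)] kg[OF g'c]
      Yi[OF g(1), of _ a] Zi[OF g'c]]
  have "l2_inner M g (sol a' g') - l2_inner M (sol a g) g'
      = integral {0..b} (\<lambda>x. g x * cnj (sol a' g' x) - sol a g x * cnj (g' x))"
    using L2_mult_absolutely_integrable[OF g(1) L2_cnj[OF sol_L2[OF g(2), of a']]]
      L2_mult_absolutely_integrable[OF sol_L2[OF g(1), of a] g'c] g
    by (simp add: l2_inner_Ioo sol_L2 absolutely_integrable_on_def integral_diff)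
  also have "\<dots> = integral {0..b} (\<lambda>x.
      (cu x * g x * Z (\<lambda>x. cnj (g' x)) x + Y a g x * - (ck x * cnj (g' x)))
      - (- (ck x * g x) * Y (cnj a') (\<lambda>x. cnj (g' x)) x + Z g x * (cu x * cnj (g' x))))"
    by (rule integral_cong) (simp add: sol_def cY cZ algebra_simps)
  also have "\<dots> = (Y a g b * Z (\<lambda>x. cnj (g' x)) b - Y a g 0 * Z (\<lambda>x. cnj (g' x)) 0)
      - (Z g b * Y (cnj a') (\<lambda>x. cnj (g' x)) b - Z g 0 * Y (cnj a') (\<lambda>x. cnj (g' x)) 0)"
    using 1 2 by (subst integral_diff) (auto simp: absolutely_integrable_on_def)
  finally show ?thesis by (simp add: cZ)
qed

lemma Z_0: "g \<in> L2 M \<Longrightarrow> Z g 0 = l2_inner M g ck"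
  by (simp add: Z_def l2_inner_Ioo k_L2 mult.commute)

text \<open>Cauchy-Schwarz on \<open>(0, x)\<close>, where \<open>u\<close> is at most \<open>u x\<close>.\<close>

lemma Y_bound:
  assumes "g \<in> L2 M" "0 \<le> x" "x \<le> b"
  shows "cmod (Y 0 g x) \<le> u x * sqrt x * l2_norm M g"
  using initial_integral_bound[OF assms(1) u_L2 assms(2,3), of "u x"] u_mono
  by (simp add: Y_def u_def)

section \<open>Energy estimates and a negative eigenvalue\<close>

text \<open>On \<open>(\<epsilon>, b)\<close> integration by parts turns the form into \<open>\<integral> \<bar>Y\<bar>\<^sup>2 / u\<^sup>2\<close> plus the boundary term
  \<open>- Y(\<epsilon>) cnj (\<psi>(\<epsilon>))\<close>, which tends to zero by the decay of \<open>Y\<close>.\<close>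

lemma energy_nonneg:
  assumes g: "g \<in> L2 M"
  shows "0 \<le> Re (l2_inner M g (sol 0 g))"
proof -
  let ?I = "\<lambda>x. integral {x..b} (\<lambda>t. g t * cnj (sol 0 g t))"
  let ?N = "l2_norm M g"
  have int: "(\<lambda>t. g t * cnj (sol 0 g t)) absolutely_integrable_on {0..b}"
    by (intro L2_mult_absolutely_integrable L2_cnj sol_L2 g)
  have 1: "- (cmod (Y 0 g x) * cmod (\<psi> 0 g x)) \<le> Re (?I x)" if x: "0 < x" "x < b" for x
  proof -
    let ?p = "\<lambda>t. - (Y 0 g t) / of_real ((u t)\<^sup>2)"
    have ug: "(\<lambda>t. cu t * g t) absolutely_integrable_on {x..b}"
      using ug_integrable[OF g] x by (auto intro: absolutely_integrable_on_subinterval)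
    have pi: "(\<lambda>t. cnj (?p t)) absolutely_integrable_on {x..b}"
      by (intro absolutely_integrable_continuous_real continuous_on_cnj continuous_\<psi>'[OF g x(1)])
    have \<psi>i: "cnj (\<psi> 0 g t) = cnj (\<psi> 0 g x) + integral {x..t} (\<lambda>t. cnj (?p t))" if "t \<in> {x..b}" for t
    proof -
      have "cnj (\<psi> 0 g t) = cnj (\<psi> 0 g x + integral {x..t} ?p)"
        using \<psi>_increment[OF g x(1), of t 0] that by (metis atLeastAtMost_iff)
      then show ?thesis
        by (simp only: complex_cnj_add Henstock_Kurzweil_Integration.integral_cnj)
    qed
    have Yi: "Y 0 g t = Y 0 g x + integral {x..t} (\<lambda>t. cu t * g t)" if "t \<in> {x..b}" for t
      using Y_increment[OF g, of x t] that x by auto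
    note prod = integral_product_rule[OF less_imp_le[OF x(2)] ug pi Yi \<psi>i]
    have \<psi>b: "\<psi> 0 g b = 0" by (simp add: \<psi>_def)
    let ?e = "\<lambda>t. complex_of_real ((cmod (Y 0 g t))\<^sup>2 / (u t)\<^sup>2)"
    have ce: "continuous_on {x..b} ?e"
      using u_pos x by (intro continuous_intros continuous_on_subset[OF continuous_on_u]
          continuous_on_subset[OF continuous_Y[OF g]]) (auto simp: less_imp_neq[symmetric])
    have ei: "?e integrable_on {x..b}" using ce by (rule integrable_continuous_real)
    have "?I x = integral {x..b} (\<lambda>t. (cu t * g t * cnj (\<psi> 0 g t) + Y 0 g t * cnj (?p t)) + ?e t)"
    proof (rule integral_cong)
      fix t assume "t \<in> {x..b}"
      then have "u t \<noteq> 0" using u_pos[of t] x by auto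
      then show "g t * cnj (sol 0 g t) = (cu t * g t * cnj (\<psi> 0 g t) + Y 0 g t * cnj (?p t)) + ?e t"
        by (simp only: sol_eq_u_\<psi> of_real_divide complex_norm_square) (simp add: algebra_simps)
    qed
    also have "\<dots> = - Y 0 g x * cnj (\<psi> 0 g x) + integral {x..b} ?e"
      using prod ei \<psi>b by (subst integral_add) (auto simp: absolutely_integrable_on_def)
    finally have "Re (?I x) = Re (- Y 0 g x * cnj (\<psi> 0 g x)) + Re (integral {x..b} ?e)" by simp
    also have "Re (integral {x..b} ?e) = integral {x..b} (\<lambda>t. (cmod (Y 0 g t))\<^sup>2 / (u t)\<^sup>2)"
      using integral_linear[OF ei bounded_linear_Re] by (simp add: o_def)
    finally have "Re (?I x) = Re (- Y 0 g x * cnj (\<psi> 0 g x))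
        + integral {x..b} (\<lambda>t. (cmod (Y 0 g t))\<^sup>2 / (u t)\<^sup>2)" .
    moreover have "0 \<le> integral {x..b} (\<lambda>t. (cmod (Y 0 g t))\<^sup>2 / (u t)\<^sup>2)"
    proof (rule integral_nonneg)
      have "continuous_on {x..b} (\<lambda>t. Re (?e t))" by (intro continuous_intros ce)
      then show "(\<lambda>t. (cmod (Y 0 g t))\<^sup>2 / (u t)\<^sup>2) integrable_on {x..b}"
        by (intro integrable_continuous_real) simp
    qed auto
    moreover have "\<bar>Re (- Y 0 g x * cnj (\<psi> 0 g x))\<bar> \<le> cmod (Y 0 g x) * cmod (\<psi> 0 g x)"
      using abs_Re_le_cmod[of "- Y 0 g x * cnj (\<psi> 0 g x)"] by (simp add: norm_mult)
    ultimately show ?thesis by linarith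
  qed
  obtain C where C: "C \<ge> 0" "\<And>x. 0 < x \<Longrightarrow> x \<le> b \<Longrightarrow> k x \<le> C * x powr (- \<nu> / 2)"
    using k_upper_bound by blast
  have "bounded (Z g ` {0..b})"
    using continuous_Z[OF g] by (intro compact_imp_bounded compact_continuous_image) auto
  then obtain B where B: "\<And>x. x \<in> {0..b} \<Longrightarrow> cmod (Z g x) \<le> B"
    unfolding bounded_iff by (metis imageI)
  define R where "R x = ?N\<^sup>2 * u b * C * x powr (1 - \<nu> / 2) + u b * ?N * B * x powr (1/2)" for x
  have 2: "cmod (Y 0 g x) * cmod (\<psi> 0 g x) \<le> R x" if x: "0 < x" "x < b" for x
  proof -
    have ux: "0 < u x" "u x \<le> u b" using u_pos[of x] u_mono[of x b] x by auto
    have Y: "cmod (Y 0 g x) \<le> u x * sqrt x * ?N" using Y_bound[OF g, of x] x by auto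
    have "cmod (\<psi> 0 g x) \<le> cmod (of_real (\<rho> x) * Y 0 g x) + cmod (Z g x)"
      unfolding \<psi>_def by (rule norm_triangle_ineq)
    also have "\<dots> = \<rho> x * cmod (Y 0 g x) + cmod (Z g x)"
      using \<rho>_nonneg[of x] x by (simp add: norm_mult)
    also have "\<dots> \<le> \<rho> x * (u x * sqrt x * ?N) + B"
      using Y B[of x] \<rho>_nonneg[of x] x by (intro add_mono mult_left_mono) auto
    finally have "cmod (Y 0 g x) * cmod (\<psi> 0 g x)
        \<le> (u x * sqrt x * ?N) * (\<rho> x * (u x * sqrt x * ?N) + B)"
      using Y by (intro mult_mono) (use ux x in auto)
    also have "\<dots> = ?N\<^sup>2 * (u x * x * k x) + u x * ?N * B * sqrt x"
      using x by (simp add: k_def algebra_simps power2_eq_square)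
    also have "u x * x * k x \<le> u b * x * (C * x powr (- \<nu> / 2))"
      using ux x C k_nonneg[of x] by (intro mult_mono) auto
    also have "\<dots> = u b * C * x powr (1 - \<nu> / 2)"
      using x powr_add[of x 1 "- \<nu> / 2"] by simp
    also have "u x * ?N * B * sqrt x \<le> u b * ?N * B * sqrt x"
      using ux x order_trans[OF norm_ge_zero B[of 0]] b_pos by (intro mult_right_mono) auto
    finally show ?thesis
      using x by (simp add: R_def powr_half_sqrt mult.assoc mult_left_mono)
  qed
  have R0: "(R \<longlongrightarrow> 0) (at_right 0)"
  proof -
    have "(R \<longlongrightarrow> ?N\<^sup>2 * u b * C * 0 + u b * ?N * B * 0) (at_right 0)"
      unfolding R_def[abs_def] using nu by (intro tendsto_intros powr_tendsto_0_at_right) auto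
    then show ?thesis by simp
  qed
  have "continuous_on {0..b} ?I"
    using int by (intro indefinite_integral_continuous_1') (simp add: absolutely_integrable_on_def)
  then have "(?I \<longlongrightarrow> ?I 0) (at 0 within {0..b})"
    using b_pos by (simp add: continuous_on_def)
  then have "(?I \<longlongrightarrow> ?I 0) (at_right 0)"
    using b_pos by (simp add: at_within_Icc_at_right)
  then have "((\<lambda>x. Re (?I x) + R x) \<longlongrightarrow> Re (?I 0) + 0) (at_right 0)"
    by (intro tendsto_intros R0)
  moreover have "eventually (\<lambda>x. 0 \<le> Re (?I x) + R x) (at_right 0)"
    unfolding eventually_at_right[OF b_pos] using 1 2 b_pos by (intro exI[of _ b]) force
  ultimately have "0 \<le> Re (?I 0) + 0"
    by (intro tendsto_lowerbound) auto
  then show ?thesis using g by (simp add: l2_inner_Ioo sol_L2)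
qed

text \<open>The trial functions are \<open>k + R(\<lambda> g)\<close> with \<open>g = u\<close> on \<open>(0, \<epsilon>)\<close> and \<open>R = sol 0\<close>. Here
  \<open>\<langle>g, R g\<rangle> \<le> 2 m \<tau>\<close> for \<open>m = \<integral> u \<bar>g\<bar>\<close> and \<open>\<tau> = \<integral> k \<bar>g\<bar> = \<langle>g, k\<rangle>\<close>, while \<open>\<tau> \<ge> \<rho>(\<epsilon>) m\<close> because
  \<open>\<rho> = k / u\<close> decreases. Since \<open>\<rho>(\<epsilon>)\<close> is unbounded, the energy of \<open>R g\<close> is small compared with
  \<open>\<langle>g, k\<rangle>\<^sup>2\<close>.\<close>

lemma energy_negative_direction:
  assumes s: "s < 0"
  shows "\<exists>g\<in>L2 M. l2_inner M g ck = of_real s \<and> Re (l2_inner M g (sol 1 g)) < 0"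
proof -
  obtain \<epsilon> where \<epsilon>: "0 < \<epsilon>" "\<epsilon> < b" "- 2 * s < \<rho> \<epsilon>"
    using \<rho>_unbounded[of "- 2 * s"] by blast
  define g where "g = (\<lambda>t. if t \<le> \<epsilon> then cu t else 0)"
  have g: "g \<in> L2 M" unfolding g_def by (rule L2_interval_restrict[OF u_L2])
  define m where "m = integral {0..b} (\<lambda>t. cmod (cu t * g t))"
  define \<tau> where "\<tau> = integral {0..b} (\<lambda>t. cmod (ck t * g t))"
  note ug = ug_integrable[OF g] and kg = kg_integrable[OF g]
  have ugn: "(\<lambda>t. cmod (cu t * g t)) integrable_on {0..b}" and kgn: "(\<lambda>t. cmod (ck t * g t)) integrable_on {0..b}"
    using ug kg unfolding absolutely_integrable_on_def by blast+
  have \<tau>m: "\<rho> \<epsilon> * m \<le> \<tau>"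
  proof -
    have "integral {0..b} (\<lambda>t. \<rho> \<epsilon> * cmod (cu t * g t)) \<le> \<tau>"
      unfolding \<tau>_def
    proof (rule integral_le)
      show "(\<lambda>t. \<rho> \<epsilon> * cmod (cu t * g t)) integrable_on {0..b}"
        using ugn by (rule integrable_on_mult_right)
      fix t assume t: "t \<in> {0..b}"
      show "\<rho> \<epsilon> * cmod (cu t * g t) \<le> cmod (ck t * g t)"
      proof (cases "0 < t \<and> t \<le> \<epsilon>")
        case True
        then have "\<rho> \<epsilon> * u t \<le> k t"
          using \<rho>_antimono[of t \<epsilon>] u_pos[of t] by (simp add: k_def)
        from mult_right_mono[OF this, of "u t"] show ?thesis
          using True u_pos[of t] k_nonneg[of t] \<epsilon> by (simp add: g_def norm_mult)
      next
        case False
        then have "t = 0 \<or> g t = 0" using t by (auto simp: g_def)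
        then show ?thesis by auto
      qed
    qed (rule kgn)
    then show ?thesis by (simp add: m_def)
  qed
  have m: "0 < m"
  proof -
    have "0 < (\<epsilon> - \<epsilon> / 2) * (u (\<epsilon>/2))\<^sup>2" using \<epsilon> u_pos[of "\<epsilon>/2"] by simp
    also have "\<dots> = integral {\<epsilon>/2..\<epsilon>} (\<lambda>t. (u (\<epsilon>/2))\<^sup>2)" using \<epsilon> by simp
    also have "\<dots> \<le> integral {\<epsilon>/2..\<epsilon>} (\<lambda>t. cmod (cu t * g t))"
    proof (rule integral_le)
      show "(\<lambda>t. cmod (cu t * g t)) integrable_on {\<epsilon>/2..\<epsilon>}"
        using ugn \<epsilon> by (auto intro: integrable_on_subinterval)
      fix t assume t: "t \<in> {\<epsilon>/2..\<epsilon>}"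
      have "(u (\<epsilon>/2))\<^sup>2 \<le> (u t)\<^sup>2" using u_mono[of "\<epsilon>/2" t] t \<epsilon> u_pos[of "\<epsilon>/2"] by (intro power_mono) auto
      then show "(u (\<epsilon>/2))\<^sup>2 \<le> cmod (cu t * g t)"
        using t by (simp add: g_def norm_mult power2_eq_square)
    qed auto
    also have "\<dots> \<le> m"
      unfolding m_def using ugn \<epsilon> by (intro integral_subset_le) (auto intro: integrable_on_subinterval)
    finally show ?thesis .
  qed
  have \<rho>\<epsilon>: "0 < \<rho> \<epsilon>" using \<epsilon> s by linarith
  then have \<tau>: "0 < \<tau>" using \<tau>m m by (meson mult_pos_pos less_le_trans)
  have gk: "l2_inner M g ck = of_real \<tau>"
  proof -
    have "Z g 0 = integral {0..b} (\<lambda>t. complex_of_real (cmod (ck t * g t)))"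
      unfolding Z_def
    proof (rule integral_cong)
      fix t assume t: "t \<in> {0..b}"
      have "0 \<le> k t" using k_nonneg[of t] t by (cases "t = 0") auto
      moreover have "0 \<le> u t" by (simp add: u_def)
      ultimately show "ck t * g t = complex_of_real (cmod (ck t * g t))"
        by (simp add: g_def norm_mult)
    qed
    also have "\<dots> = of_real \<tau>"
      using integral_linear[OF kgn bounded_linear_of_real] by (simp add: \<tau>_def o_def)
    finally show ?thesis using Z_0[OF g] by simp
  qed
  have e: "Re (l2_inner M g (sol 0 g)) \<le> 2 * m * \<tau>"
  proof -
    have "cmod (integral {0..b} (\<lambda>t. g t * cnj (sol 0 g t)))
        \<le> integral {0..b} (\<lambda>t. m * cmod (ck t * g t) + \<tau> * cmod (cu t * g t))"
    proof (rule integral_norm_bound_integral)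
      show "(\<lambda>t. g t * cnj (sol 0 g t)) integrable_on {0..b}"
        using L2_mult_absolutely_integrable[OF g L2_cnj[OF sol_L2[OF g, of 0]]]
        by (simp add: absolutely_integrable_on_def)
      show "(\<lambda>t. m * cmod (ck t * g t) + \<tau> * cmod (cu t * g t)) integrable_on {0..b}"
        by (intro integrable_add integrable_on_mult_right ugn kgn)
      fix t assume t: "t \<in> {0..b}"
      have "cmod (Y 0 g t) \<le> m" "cmod (Z g t) \<le> \<tau>"
        unfolding Y_def Z_def m_def \<tau>_def
        using norm_increment_le_integral_norm[OF ug, of 0 t] norm_increment_le_integral_norm[OF kg, of t b] t
        by auto
      then have "cmod (sol 0 g t) \<le> cmod (ck t) * m + cmod (cu t) * \<tau>"
        unfolding sol_def
        by (intro norm_triangle_le add_mono) (auto simp: norm_mult intro!: mult_left_mono)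
      from mult_left_mono[OF this, of "cmod (g t)"]
      show "cmod (g t * cnj (sol 0 g t)) \<le> m * cmod (ck t * g t) + \<tau> * cmod (cu t * g t)"
        by (simp add: norm_mult algebra_simps)
    qed
    also have "\<dots> = m * \<tau> + \<tau> * m"
      using ugn kgn by (simp add: integral_add integrable_on_mult_right m_def \<tau>_def)
    also have "\<dots> = 2 * m * \<tau>" by simp
    finally show ?thesis
      unfolding l2_inner_Ioo[OF g sol_L2[OF g]] by (rule order_trans[OF complex_Re_le_cmod])
  qed
  define c where "c = s / \<tau>"
  define G where "G = (\<lambda>t. of_real c * g t)"
  have G: "G \<in> L2 M" unfolding G_def by (rule L2_cmult[OF g])
  have "l2_inner M G ck = of_real (c * \<tau>)"
    unfolding G_def l2_inner_cmult_left gk by simp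
  then have "l2_inner M G ck = of_real s" using \<tau> by (simp add: c_def)
  moreover have "Re (l2_inner M G (sol 1 G)) < 0"
  proof -
    have "sol 1 G = (\<lambda>x. ck x + of_real c * sol 0 g x)"
      unfolding G_def using sol_eq_k_plus[of 1] sol_cmult[of "of_real c" 0 g] by auto
    then have "l2_inner M G (sol 1 G) = of_real c * (of_real \<tau> + of_real c * l2_inner M g (sol 0 g))"
      using g by (simp add: G_def l2_inner_cmult_left l2_inner_cmult_right l2_inner_add_right
          L2_cmult k_L2 sol_L2 gk)
    then have "Re (l2_inner M G (sol 1 G)) = c * \<tau> + c\<^sup>2 * Re (l2_inner M g (sol 0 g))"
      by (simp add: power2_eq_square algebra_simps)
    also have "\<dots> \<le> c * \<tau> + c\<^sup>2 * (2 * m * \<tau>)"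
      using mult_left_mono[OF e, of "c\<^sup>2"] by simp
    also have "\<dots> = s + s * (2 * s * (m / \<tau>))"
      using \<tau> by (simp add: c_def power2_eq_square)
    also have "\<dots> < 0"
    proof -
      have "m / \<tau> \<le> 1 / \<rho> \<epsilon>" using \<tau>m \<tau> \<rho>\<epsilon> by (simp add: field_simps)
      then have "- 2 * s * (m / \<tau>) \<le> - 2 * s * (1 / \<rho> \<epsilon>)" using s by (intro mult_left_mono) auto
      also have "\<dots> < 1" using \<epsilon>(3) \<rho>\<epsilon> by (simp add: field_simps)
      finally have "s * (1 + 2 * s * (m / \<tau>)) < 0" using s by (intro mult_neg_pos) auto
      then show ?thesis by (simp add: algebra_simps)
    qed
    finally show ?thesis .
  qed
  ultimately show ?thesis using G by blast
qed

text \<open>Since \<open>k / u\<close> decreases, \<open>u(x) k(t) \<le> k(x) u(t)\<close> for \<open>x \<le> t\<close>. Hence \<open>R = sol 0\<close> is bounded in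
  the supremum norm weighted by \<open>1 / k\<close>.\<close>

lemma sol_k_bound:
  assumes h: "h \<in> L2 M" and H: "0 \<le> H" "\<And>x. 0 < x \<Longrightarrow> x < b \<Longrightarrow> cmod (h x) \<le> H * k x"
    and x: "0 < x" "x < b"
  shows "cmod (sol 0 h x) \<le> H * integral {0..b} (\<lambda>t. u t * k t) * k x"
proof -
  have "(\<lambda>t. cu t * ck t) integrable_on {0..b}"
    using L2_mult_absolutely_integrable[OF u_L2 k_L2] by (simp add: absolutely_integrable_on_def)
  then have uk: "(\<lambda>t. u t * k t) integrable_on {0..b}"
    using integrable_linear[OF _ bounded_linear_Re] by (fastforce simp: o_def)
  have uk': "(\<lambda>t. u t * k t) integrable_on {0..x}" "(\<lambda>t. u t * k t) integrable_on {x..b}"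
    using x by (auto intro: integrable_on_subinterval[OF uk])
  have u0: "0 \<le> u t" for t by (simp add: u_def)
  have k0: "0 \<le> k t" if "t \<in> {0..b}" for t
    using k_nonneg[of t] that by (cases "t = 0") auto
  have hi: "(\<lambda>t. cu t * h t) integrable_on {0..x}" "(\<lambda>t. ck t * h t) integrable_on {x..b}"
    using ug_integrable[OF h] kg_integrable[OF h] x
    by (auto simp: absolutely_integrable_on_def intro: integrable_on_subinterval)
  have "cmod (integral {0..x} (\<lambda>t. cu t * h t)) \<le> integral {0..x} (\<lambda>t. H * (u t * k t))"
  proof (rule integral_norm_bound_integral[OF hi(1)])
    show "(\<lambda>t. H * (u t * k t)) integrable_on {0..x}" using uk'(1) by (rule integrable_on_mult_right)
    fix t assume t: "t \<in> {0..x}"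
    show "cmod (cu t * h t) \<le> H * (u t * k t)"
    proof (cases "t = 0")
      case False
      then show ?thesis using mult_left_mono[OF H(2)[of t] u0[of t]] t x u0[of t]
        by (simp add: norm_mult algebra_simps)
    qed simp
  qed
  also have "\<dots> = H * integral {0..x} (\<lambda>t. u t * k t)" by simp
  finally have 1: "cmod (Y 0 h x) \<le> H * integral {0..x} (\<lambda>t. u t * k t)" by (simp add: Y_def)
  have "cmod (integral {x..b} (\<lambda>t. cu x * (ck t * h t))) \<le> integral {x..b} (\<lambda>t. k x * H * (u t * k t))"
  proof (rule integral_norm_bound_integral)
    show "(\<lambda>t. cu x * (ck t * h t)) integrable_on {x..b}" using hi(2) by (rule integrable_on_mult_right)
    show "(\<lambda>t. k x * H * (u t * k t)) integrable_on {x..b}" using uk'(2) by (rule integrable_on_mult_right)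
    fix t assume t: "t \<in> {x..b}"
    show "cmod (cu x * (ck t * h t)) \<le> k x * H * (u t * k t)"
    proof (cases "t = b")
      case False
      then have "t < b" using t by auto
      have "u x * k t \<le> k x * u t"
        using \<rho>_antimono[of x t] t x u0 by (simp add: k_def mult_left_mono mult.assoc mult.left_commute mult.commute)
      moreover have "cmod (h t) \<le> H * k t" using H(2)[of t] t x \<open>t < b\<close> by auto
      ultimately have "(u x * k t) * cmod (h t) \<le> (k x * u t) * (H * k t)"
        by (rule mult_mono) (use u0 k0[of x] x in auto)
      then show ?thesis using u0[of x] k0[of t] t x by (simp add: norm_mult algebra_simps)
    qed simp
  qed
  also have "\<dots> = k x * H * integral {x..b} (\<lambda>t. u t * k t)" by simp
  finally have 2: "cmod (cu x * Z h x) \<le> k x * H * integral {x..b} (\<lambda>t. u t * k t)" by (simp add: Z_def)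
  have "cmod (sol 0 h x) \<le> cmod (ck x * Y 0 h x) + cmod (cu x * Z h x)"
    unfolding sol_def by (rule norm_triangle_ineq)
  also have "cmod (ck x * Y 0 h x) \<le> k x * (H * integral {0..x} (\<lambda>t. u t * k t))"
    using 1 k0[of x] x by (simp add: norm_mult mult_left_mono)
  also have "cmod (cu x * Z h x) \<le> k x * H * integral {x..b} (\<lambda>t. u t * k t)" by (rule 2)
  also have "k x * (H * integral {0..x} (\<lambda>t. u t * k t)) + k x * H * integral {x..b} (\<lambda>t. u t * k t)
      = H * (integral {0..x} (\<lambda>t. u t * k t) + integral {x..b} (\<lambda>t. u t * k t)) * k x"
    by (simp add: algebra_simps)
  also have "integral {0..x} (\<lambda>t. u t * k t) + integral {x..b} (\<lambda>t. u t * k t) = integral {0..b} (\<lambda>t. u t * k t)"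
    using x uk by (intro Henstock_Kurzweil_Integration.integral_combine) auto
  finally show ?thesis by simp
qed

text \<open>A solution of \<open>\<phi> = k - c R \<phi>\<close> is the limit of the successive approximations
  \<open>k, k - c R k, \<dots>\<close>, which form a contraction for small \<open>c\<close>.\<close>

primrec picard :: "real \<Rightarrow> nat \<Rightarrow> real \<Rightarrow> complex" where
  "picard c 0 = (\<lambda>x. 0)"
| "picard c (Suc n) = sol 1 (\<lambda>x. - of_real c * picard c n x)"

lemma defect_vector:
  "\<exists>c>0. \<exists>\<phi>\<in>L2 M. (\<forall>x. 0 < x \<and> x < b \<longrightarrow> \<phi> x = sol 1 (\<lambda>x. - of_real c * \<phi> x) x) \<and>
    \<not> ae_equal M \<phi> (\<lambda>x. 0)"
proof -
  define D where "D = integral {0..b} (\<lambda>t. u t * k t)"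
  have D: "0 \<le> D"
  proof -
    have "cmod (sol 0 (\<lambda>x. 0) (b/2)) \<le> 1 * D * k (b/2)"
      unfolding D_def using b_pos by (intro sol_k_bound) (auto simp: k_nonneg)
    then have "0 \<le> 1 * D * k (b/2)" by (rule order_trans[OF norm_ge_zero])
    then show ?thesis using k_pos[of "b/2"] b_pos by (simp add: zero_le_mult_iff)
  qed
  define c where "c = 1 / (3 * (D + 1))"
  have c: "0 < c" "c * D \<le> 1/3" using D by (auto simp: c_def field_simps)
  let ?p = "picard c"
  have pL: "?p n \<in> L2 M" for n
  proof (induction n)
    case (Suc n)
    show ?case unfolding picard.simps by (intro sol_L2 L2_cmult Suc)
  qed simp
  have step: "cmod (?p (Suc n) x - ?p n x) \<le> (1/3)^n * k x" if "0 < x" "x < b" for n x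
    using that
  proof (induction n arbitrary: x)
    case 0
    then show ?case using k_nonneg[of x] by (simp add: sol_def Y_def Z_def)
  next
    case (Suc n)
    define h where "h = (\<lambda>x. - of_real c * (?p (Suc n) x - ?p n x))"
    have hL: "h \<in> L2 M" unfolding h_def by (intro L2_cmult L2_diff pL)
    have cp: "(\<lambda>x. - of_real c * ?p n x) \<in> L2 M" by (intro L2_cmult pL)
    have "?p (Suc (Suc n)) x = sol (1 + 0) (\<lambda>x. - of_real c * ?p n x + h x) x"
      by (simp add: h_def algebra_simps)
    also have "\<dots> = ?p (Suc n) x + sol 0 h x"
      using sol_add[OF cp hL, of x 1 0] Suc.prems
      by (simp only: picard.simps less_imp_le)
    finally have "?p (Suc (Suc n)) x - ?p (Suc n) x = sol 0 h x" by simp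
    also have "cmod (sol 0 h x) \<le> c * (1/3)^n * D * k x"
      unfolding D_def
    proof (rule sol_k_bound[OF hL])
      fix y assume "0 < y" "y < b"
      from mult_left_mono[OF Suc.IH[OF this], of c]
      show "cmod (h y) \<le> c * (1/3)^n * k y" using c by (simp add: h_def norm_mult)
    qed (use Suc.prems c in auto)
    also have "\<dots> = (c * D) * ((1/3)^n * k x)" by simp
    also have "\<dots> \<le> 1/3 * ((1/3)^n * k x)"
      using c k_nonneg[of x] Suc.prems by (intro mult_right_mono) auto
    finally show ?case by simp
  qed
  define d where "d n x = ?p (Suc n) x - ?p n x" for n x
  define \<phi> where "\<phi> x = (if 0 < x \<and> x < b then (\<Sum>n. d n x) else 0)" for x
  have geo: "summable (\<lambda>n. (1/3)^n * k x)" for x :: real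
    by (intro summable_mult2 summable_geometric) simp
  have ps: "?p n x = (\<Sum>i<n. d i x)" for n x
    using sum_lessThan_telescope[of "\<lambda>n. ?p n x" n] by (simp add: d_def)
  have lim: "(\<lambda>n. ?p n x) \<longlonglongrightarrow> \<phi> x" if x: "0 < x" "x < b" for x
  proof -
    have "summable (\<lambda>n. d n x)"
      using step[OF x] by (intro summable_comparison_test[OF _ geo[of x]]) (auto simp: d_def)
    then show ?thesis using x unfolding ps \<phi>_def by (simp add: summable_LIMSEQ)
  qed
  have sumbound: "cmod (?p (Suc n) x - ck x) \<le> 1/2 * k x" if x: "0 < x" "x < b" for n x
  proof -
    have "?p (Suc n) x = ck x + (\<Sum>i<n. d (Suc i) x)"
      unfolding ps sum.lessThan_Suc_shift by (simp add: d_def sol_def Y_def Z_def)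
    then have "cmod (?p (Suc n) x - ck x) \<le> (\<Sum>i<n. cmod (d (Suc i) x))" by (simp add: norm_sum)
    also have "\<dots> \<le> (\<Sum>i<n. (1/3)^(Suc i) * k x)"
      using step[OF x, of "Suc _"] unfolding d_def by (intro sum_mono) blast
    also have "\<dots> = (\<Sum>i<n. (1/3)^i) * (k x / 3)" by (simp add: sum_distrib_right)
    also have "\<dots> \<le> (3/2) * (k x / 3)"
    proof (rule mult_right_mono)
      have "(\<Sum>i<n. (1/3::real)^i) \<le> (\<Sum>i. (1/3)^i)"
        by (intro sum_le_suminf summable_geometric) auto
      then show "(\<Sum>i<n. (1/3::real)^i) \<le> 3/2" by (simp add: suminf_geometric)
    qed (use k_nonneg[of x] x in auto)
    finally show ?thesis by simp
  qed
  have pbound: "cmod (?p n x) \<le> 2 * k x" if x: "0 < x" "x < b" for n x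
  proof (cases n)
    case (Suc m)
    then show ?thesis
      using sumbound[OF x, of m] norm_triangle_sub[of "?p n x" "ck x"] k_nonneg[of x] x by simp
  qed (use k_nonneg[of x] x in auto)
  have \<phi>bound: "cmod (\<phi> x) \<le> 2 * k x" "cmod (\<phi> x - ck x) \<le> 1/2 * k x" if x: "0 < x" "x < b" for x
  proof -
    show "cmod (\<phi> x) \<le> 2 * k x"
      using pbound[OF x] by (intro tendsto_upperbound[OF tendsto_norm[OF lim[OF x]]]) auto
    have "(\<lambda>n. cmod (?p (Suc n) x - ck x)) \<longlonglongrightarrow> cmod (\<phi> x - ck x)"
      by (intro tendsto_intros LIMSEQ_Suc lim x)
    then show "cmod (\<phi> x - ck x) \<le> 1/2 * k x"
      using sumbound[OF x] by (intro tendsto_upperbound) auto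
  qed
  have \<phi>L: "\<phi> \<in> L2 M"
  proof -
    have m: "\<phi> \<in> borel_measurable M"
      by (rule borel_measurable_LIMSEQ_metric[where f = ?p]) (auto intro!: L2_measurable pL lim)
    show ?thesis
    proof (rule L2_dominated[OF L2_cmult[OF k_L2, of 2] m])
      fix x assume "x \<in> space M"
      then have x: "0 < x" "x < b" by auto
      show "cmod (\<phi> x) \<le> cmod (2 * ck x)"
        using \<phi>bound(1)[OF x] k_nonneg[of x] x by (simp add: norm_mult)
    qed
  qed
  have "\<phi> x = sol 1 (\<lambda>x. - of_real c * \<phi> x) x" if x: "0 < x" "x < b" for x
  proof -
    define h where "h = (\<lambda>n x. - of_real c * ?p n x)"
    define H where "H = (\<lambda>x. - of_real c * \<phi> x)"
    have hL: "h n \<in> L2 M" and HL: "H \<in> L2 M" for n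
      unfolding h_def H_def by (intro L2_cmult pL \<phi>L)+
    have hlim: "(\<lambda>n. h n t) \<longlonglongrightarrow> H t" if "0 < t" "t < b" for t
      unfolding h_def H_def by (intro tendsto_intros lim that)
    have hbound: "cmod (h n t) \<le> 2 * c * k t" if "0 < t" "t < b" for n t
      using mult_left_mono[OF pbound[OF that], of c] c by (simp add: h_def norm_mult)
    have Ylim: "(\<lambda>n. integral {0..x} (\<lambda>t. cu t * h n t)) \<longlonglongrightarrow> integral {0..x} (\<lambda>t. cu t * H t)"
    proof (rule dominated_convergence(2))
      show "(\<lambda>t. cu t * h n t) integrable_on {0..x}" for n
        using ug_integrable[OF hL[of n]] x by (auto simp: absolutely_integrable_on_def intro: integrable_on_subinterval)
      have "(\<lambda>t. cu t * (2 * of_real c * ck t)) absolutely_integrable_on {0..b}"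
        by (intro ug_integrable L2_cmult k_L2)
      then have "(\<lambda>t. cu t * (2 * of_real c * ck t)) absolutely_integrable_on {0..x}"
        using x by (auto intro: absolutely_integrable_on_subinterval)
      then show "(\<lambda>t. cmod (cu t * (2 * of_real c * ck t))) integrable_on {0..x}"
        unfolding absolutely_integrable_on_def by blast
      show "norm (cu t * h n t) \<le> cmod (cu t * (2 * of_real c * ck t))" if t: "t \<in> {0..x}" for n t
      proof (cases "t = 0")
        case False
        then have "cmod (h n t) \<le> cmod (2 * of_real c * ck t)"
          using hbound[of t n] k_nonneg[of t] t x c by (simp add: norm_mult)
        then show ?thesis by (simp add: norm_mult mult_left_mono del: norm_of_real)
      qed simp
      show "(\<lambda>n. cu t * h n t) \<longlonglongrightarrow> cu t * H t" if t: "t \<in> {0..x}" for t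
      proof (cases "t = 0")
        case False
        then show ?thesis using t x by (intro tendsto_intros hlim) auto
      qed simp
    qed
    have Zlim: "(\<lambda>n. Z (h n) x) \<longlonglongrightarrow> Z H x"
      unfolding Z_def
    proof (rule dominated_convergence(2))
      show "(\<lambda>t. ck t * h n t) integrable_on {x..b}" for n
        using kg_integrable[OF hL[of n]] x by (auto simp: absolutely_integrable_on_def intro: integrable_on_subinterval)
      have "(\<lambda>t. ck t * (2 * of_real c * ck t)) absolutely_integrable_on {0..b}"
        by (intro kg_integrable L2_cmult k_L2)
      then have "(\<lambda>t. ck t * (2 * of_real c * ck t)) absolutely_integrable_on {x..b}"
        using x by (auto intro: absolutely_integrable_on_subinterval)
      then show "(\<lambda>t. cmod (ck t * (2 * of_real c * ck t))) integrable_on {x..b}"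
        unfolding absolutely_integrable_on_def by blast
      show "norm (ck t * h n t) \<le> cmod (ck t * (2 * of_real c * ck t))" if t: "t \<in> {x..b}" for n t
      proof (cases "t = b")
        case False
        then have "cmod (h n t) \<le> cmod (2 * of_real c * ck t)"
          using hbound[of t n] k_nonneg[of t] t x c by (simp add: norm_mult)
        then show ?thesis by (simp add: norm_mult mult_left_mono del: norm_of_real)
      qed simp
      show "(\<lambda>n. ck t * h n t) \<longlonglongrightarrow> ck t * H t" if t: "t \<in> {x..b}" for t
      proof (cases "t = b")
        case False
        then show ?thesis using t x by (intro tendsto_intros hlim) auto
      qed simp
    qed
    have "(\<lambda>n. sol 1 (h n) x) \<longlonglongrightarrow> sol 1 H x"
      unfolding sol_def Y_def by (intro tendsto_intros Ylim Zlim)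
    moreover have "(\<lambda>n. sol 1 (h n) x) = (\<lambda>n. ?p (Suc n) x)" by (simp add: h_def)
    ultimately have "(\<lambda>n. ?p (Suc n) x) \<longlonglongrightarrow> sol 1 H x" by simp
    moreover have "(\<lambda>n. ?p (Suc n) x) \<longlonglongrightarrow> \<phi> x" by (intro LIMSEQ_Suc lim x)
    ultimately show ?thesis unfolding H_def by (rule LIMSEQ_unique[rotated])
  qed
  moreover have "\<not> ae_equal M \<phi> (\<lambda>x. 0)"
  proof
    assume "ae_equal M \<phi> (\<lambda>x. 0)"
    then have "\<exists>x\<in>{0<..<b}. \<phi> x = 0"
      using b_pos unfolding ae_equal_def by (intro AE_interval_witness[where a = 0 and b = b]) auto
    then show False using \<phi>bound(2) k_pos by fastforce
  qed
  ultimately show ?thesis using c(1) \<phi>L by blast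
qed

end

section \<open>Hardy's inequality\<close>

text \<open>Integrate \<open>(P\<^sup>2 / x)' = 2 P p / x - P\<^sup>2 / x\<^sup>2\<close> over \<open>(\<epsilon>, b)\<close> and absorb half of \<open>P\<^sup>2 / x\<^sup>2\<close> into
  the right-hand side. The boundary term at \<open>\<epsilon>\<close> is bounded by the Cauchy-Schwarz inequality.\<close>

lemma Hardy:
  fixes p :: "real \<Rightarrow> complex"
  assumes b: "0 < b" and p: "p \<in> L2 (lebesgue_on {0<..<b})"
  shows "(\<lambda>x. of_real (integral {0..x} (\<lambda>t. cmod (p t)) / x)) \<in> L2 (lebesgue_on {0<..<b})"
proof -
  let ?M = "lebesgue_on {0<..<b}"
  let ?N = "l2_norm ?M p"
  note one = L2_one[OF b]
  have np: "(\<lambda>x. complex_of_real (cmod (p x))) \<in> L2 ?M"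
    using p by (auto simp: L2_def)
  have pa: "(\<lambda>t. cmod (p t)) absolutely_integrable_on {0..b}"
    using L2_absolutely_integrable[OF b p] by (simp add: absolutely_integrable_on_def)
  then have pi: "(\<lambda>t. cmod (p t)) integrable_on {0..b}" by (simp add: absolutely_integrable_on_def)
  have p2: "(\<lambda>t. (cmod (p t))\<^sup>2) integrable_on {0..b}" "integral {0..b} (\<lambda>t. (cmod (p t))\<^sup>2) = ?N\<^sup>2"
  proof -
    have i: "integrable ?M (\<lambda>t. (cmod (p t))\<^sup>2)" using p by (simp add: L2_def)
    show "(\<lambda>t. (cmod (p t))\<^sup>2) integrable_on {0..b}"
      using integrable_on_lebesgue_on[OF i] by (simp add: integrable_on_Icc_iff_Ioo)
    show "integral {0..b} (\<lambda>t. (cmod (p t))\<^sup>2) = ?N\<^sup>2"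
    proof -
      have "?N\<^sup>2 = (LINT t|?M. (cmod (p t))\<^sup>2)" by (simp add: l2_norm_def)
      also have "\<dots> = integral {0..b} (\<lambda>t. (cmod (p t))\<^sup>2)"
        using lebesgue_integral_eq_integral[OF i] by (simp add: integral_open_interval_real)
      finally show ?thesis ..
    qed
  qed
  define P where "P x = integral {0..x} (\<lambda>t. cmod (p t))" for x
  have Pc: "continuous_on {0..b} P"
    unfolding P_def using pi by (rule indefinite_integral_continuous_1)
  have P_bound: "(P x)\<^sup>2 / x \<le> ?N\<^sup>2" if x: "0 < x" "x \<le> b" for x
  proof -
    have i: "(\<lambda>t. cmod (p t)) integrable_on {0..x}" using pi x by (auto intro: integrable_on_subinterval)
    have P0: "0 \<le> P x" unfolding P_def using i by (intro integral_nonneg) auto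
    have "integral {0..x} (\<lambda>t. 1 * complex_of_real (cmod (p t))) = of_real (P x)"
      using integral_linear[OF i bounded_linear_of_real] by (simp add: P_def o_def)
    then have "P x \<le> sqrt x * ?N"
      using initial_integral_bound[OF np one, of x 1] x P0 by (simp add: l2_norm_def)
    then have "(P x)\<^sup>2 \<le> (sqrt x * ?N)\<^sup>2" using P0 by (intro power_mono)
    then show ?thesis using x by (simp add: power_mult_distrib field_simps)
  qed
  have cut: "integral {\<epsilon>..b} (\<lambda>x. (P x / x)\<^sup>2) \<le> 6 * ?N\<^sup>2" if \<epsilon>: "0 < \<epsilon>" "\<epsilon> < b" for \<epsilon>
  proof -
    have pe: "(\<lambda>t. cmod (p t)) absolutely_integrable_on {\<epsilon>..b}"
      using pa \<epsilon> by (auto intro: absolutely_integrable_on_subinterval)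
    have Pe: "P x = P \<epsilon> + integral {\<epsilon>..x} (\<lambda>t. cmod (p t))" if "x \<in> {\<epsilon>..b}" for x
      by (rule indefinite_integral_increment[OF pi]) (use that \<epsilon> in \<open>auto simp: P_def\<close>)
    have cPe: "continuous_on {\<epsilon>..b} P" using Pc \<epsilon> by (auto intro: continuous_on_subset)
    let ?s = "\<lambda>t. cmod (p t) * P t + P t * cmod (p t)"
    have P2: "(P x)\<^sup>2 = (P \<epsilon>)\<^sup>2 + integral {\<epsilon>..x} ?s" if x: "x \<in> {\<epsilon>..b}" for x
    proof -
      have pex: "(\<lambda>t. cmod (p t)) absolutely_integrable_on {\<epsilon>..x}"
        using x by (auto intro: absolutely_integrable_on_subinterval[OF pe])
      have Pex: "P t = P \<epsilon> + integral {\<epsilon>..t} (\<lambda>t. cmod (p t))" if "t \<in> {\<epsilon>..x}" for t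
        using Pe[of t] that x by simp
      show ?thesis
        using integral_product_rule(1)[OF _ pex pex Pex Pex] x by (simp add: power2_eq_square)
    qed
    note sa = integral_product_rule(2)[OF less_imp_le[OF \<epsilon>(2)] pe pe Pe Pe]
    have inv: "1 / x = 1 / \<epsilon> + integral {\<epsilon>..x} (\<lambda>t. - 1 / t\<^sup>2)" if x: "x \<in> {\<epsilon>..b}" for x :: real
    proof -
      have "((\<lambda>t. - 1 / t\<^sup>2) has_integral (1 / x - 1 / \<epsilon>)) {\<epsilon>..x}"
      proof (rule fundamental_theorem_of_calculus)
        fix t assume t: "t \<in> {\<epsilon>..x}"
        have "((\<lambda>t. 1 / t) has_real_derivative - 1 / t\<^sup>2) (at t within {\<epsilon>..x})"
          using t \<epsilon> by (auto intro!: derivative_eq_intros simp: power2_eq_square)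
        then show "((\<lambda>t. 1 / t) has_vector_derivative - 1 / t\<^sup>2) (at t within {\<epsilon>..x})"
          by (simp only: has_real_derivative_iff_has_vector_derivative)
      qed (use x in auto)
      from integral_unique[OF this] show ?thesis by linarith
    qed
    have inva: "(\<lambda>t. - 1 / t\<^sup>2 :: real) absolutely_integrable_on {\<epsilon>..b}"
      using \<epsilon> by (intro absolutely_integrable_continuous_real continuous_intros) auto
    note prod = integral_product_rule[where P = "\<lambda>x. (P x)\<^sup>2" and Q = "\<lambda>x. 1 / x",
        OF less_imp_le[OF \<epsilon>(2)] sa inva P2 inv]
    have I: "integral {\<epsilon>..b} (\<lambda>x. ?s x * (1 / x) + (P x)\<^sup>2 * (- 1 / x\<^sup>2)) = (P b)\<^sup>2 * (1 / b) - (P \<epsilon>)\<^sup>2 * (1 / \<epsilon>)"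
      and Ii: "(\<lambda>x. ?s x * (1 / x) + (P x)\<^sup>2 * (- 1 / x\<^sup>2)) absolutely_integrable_on {\<epsilon>..b}"
      by (rule prod; assumption)+
    have sq: "(\<lambda>x. (P x / x)\<^sup>2) integrable_on {\<epsilon>..b}"
      using \<epsilon> by (intro integrable_continuous_real continuous_intros cPe) auto
    have p2e: "(\<lambda>t. (cmod (p t))\<^sup>2) integrable_on {\<epsilon>..b}"
      using p2(1) \<epsilon> by (auto intro: integrable_on_subinterval)
    have "integral {\<epsilon>..b} (\<lambda>x. ?s x * (1 / x) + (P x)\<^sup>2 * (- 1 / x\<^sup>2))
        \<le> integral {\<epsilon>..b} (\<lambda>x. 2 * (cmod (p x))\<^sup>2 - (1/2) * (P x / x)\<^sup>2)"
    proof (rule integral_le)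
      show "(\<lambda>x. ?s x * (1 / x) + (P x)\<^sup>2 * (- 1 / x\<^sup>2)) integrable_on {\<epsilon>..b}"
        using Ii by (simp add: absolutely_integrable_on_def)
      show "(\<lambda>x. 2 * (cmod (p x))\<^sup>2 - (1/2) * (P x / x)\<^sup>2) integrable_on {\<epsilon>..b}"
        by (intro integrable_diff integrable_on_mult_right sq p2e)
      fix x assume "x \<in> {\<epsilon>..b}"
      have "0 \<le> 2 * (cmod (p x) - (1/2) * (P x / x))\<^sup>2" by simp
      also have "\<dots> = 2 * (cmod (p x))\<^sup>2 - 2 * cmod (p x) * (P x / x) + (1/2) * (P x / x)\<^sup>2"
        by (simp add: power2_eq_square algebra_simps)
      finally have "2 * cmod (p x) * (P x / x) \<le> 2 * (cmod (p x))\<^sup>2 + (1/2) * (P x / x)\<^sup>2" by simp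
      moreover have "?s x * (1 / x) + (P x)\<^sup>2 * (- 1 / x\<^sup>2) = 2 * cmod (p x) * (P x / x) - (P x / x)\<^sup>2"
        by (simp add: power_divide mult.commute)
      ultimately show "?s x * (1 / x) + (P x)\<^sup>2 * (- 1 / x\<^sup>2) \<le> 2 * (cmod (p x))\<^sup>2 - (1/2) * (P x / x)\<^sup>2"
        by linarith
    qed
    also have "\<dots> = 2 * integral {\<epsilon>..b} (\<lambda>x. (cmod (p x))\<^sup>2) - (1/2) * integral {\<epsilon>..b} (\<lambda>x. (P x / x)\<^sup>2)"
      using sq p2e by (simp add: integral_diff integrable_on_mult_right)
    also have "integral {\<epsilon>..b} (\<lambda>x. (cmod (p x))\<^sup>2) \<le> ?N\<^sup>2"
      unfolding p2(2)[symmetric] using p2 p2e \<epsilon> by (intro integral_subset_le) auto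
    finally have "(1/2) * integral {\<epsilon>..b} (\<lambda>x. (P x / x)\<^sup>2) \<le> 2 * ?N\<^sup>2 - (P b)\<^sup>2 / b + (P \<epsilon>)\<^sup>2 / \<epsilon>"
      unfolding I by simp
    moreover have "0 \<le> (P b)\<^sup>2 / b" using b by simp
    ultimately show ?thesis
      using P_bound[OF \<epsilon>(1) less_imp_le[OF \<epsilon>(2)]] by linarith
  qed
  have Pm: "(\<lambda>x. P x / x) \<in> borel_measurable ?M"
    by (intro continuous_imp_measurable_on_sets_lebesgue continuous_intros continuous_on_subset[OF Pc]) auto
  have "integrable ?M (\<lambda>x. (P x / x)\<^sup>2)"
  proof -
    define \<epsilon> where "\<epsilon> n = b / (real n + 2)" for n
    have \<epsilon>: "0 < \<epsilon> n" "\<epsilon> n < b" for n using b by (auto simp: \<epsilon>_def field_simps add_pos_nonneg)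
    define h where "h n x = (if x \<in> {\<epsilon> n..b} then (P x / x)\<^sup>2 else 0)" for n x
    have mono: "h m x \<le> h n x" if "m \<le> n" for m n x
    proof -
      have "\<epsilon> n \<le> \<epsilon> m" using that b unfolding \<epsilon>_def by (intro divide_left_mono) auto
      then show ?thesis by (auto simp: h_def)
    qed
    have hc: "continuous_on {\<epsilon> n..b} (\<lambda>x. (P x / x)\<^sup>2)" for n
      using \<epsilon>[of n] by (intro continuous_intros continuous_on_subset[OF Pc]) auto
    have hi: "integrable ?M (h n)" and hI: "integral\<^sup>L ?M (h n) \<le> 6 * ?N\<^sup>2" for n
    proof -
      have "(\<lambda>x. (P x / x)\<^sup>2) absolutely_integrable_on {\<epsilon> n..b}"
        using hc by (rule absolutely_integrable_continuous_real)
      then have "(\<lambda>x. if x \<in> {\<epsilon> n..b} then (P x / x)\<^sup>2 else 0) absolutely_integrable_on UNIV"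
        by (simp only: absolutely_integrable_restrict_UNIV)
      then have "h n absolutely_integrable_on {0..b}"
        unfolding h_def[abs_def] by (rule absolutely_integrable_on_subinterval) simp
      then have a: "h n absolutely_integrable_on {0<..<b}"
        by (simp only: absolutely_integrable_on_Icc_iff_Ioo)
      then show i: "integrable ?M (h n)"
        by (intro absolutely_integrable_imp_integrable) auto
      have "integral\<^sup>L ?M (h n) = integral {0..b} (h n)"
        using lebesgue_integral_eq_integral[OF i] by (simp add: integral_open_interval_real)
      also have "\<dots> = integral ({\<epsilon> n..b} \<inter> {0..b}) (\<lambda>x. (P x / x)\<^sup>2)"
        unfolding h_def[abs_def] by (rule Henstock_Kurzweil_Integration.integral_restrict_Int)
      also have "{\<epsilon> n..b} \<inter> {0..b} = {\<epsilon> n..b}" using \<epsilon>[of n] by auto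
      finally show "integral\<^sup>L ?M (h n) \<le> 6 * ?N\<^sup>2" using cut[OF \<epsilon>] by simp
    qed
    have "incseq (\<lambda>n. integral\<^sup>L ?M (h n))"
      by (intro incseq_SucI integral_mono hi mono) auto
    then obtain l where l: "(\<lambda>n. integral\<^sup>L ?M (h n)) \<longlonglongrightarrow> l"
      using incseq_convergent[of "\<lambda>n. integral\<^sup>L ?M (h n)" "6 * ?N\<^sup>2"] hI by blast
    show ?thesis
    proof (rule integrable_monotone_convergence[OF hi _ _ l])
      show "AE x in ?M. mono (\<lambda>n. h n x)" using mono by (intro AE_I2) (auto simp: mono_def)
      show "AE x in ?M. (\<lambda>n. h n x) \<longlonglongrightarrow> (P x / x)\<^sup>2"
      proof (rule AE_I2)
        fix x assume "x \<in> space ?M"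
        then have x: "0 < x" "x < b" by auto
        obtain m where m: "b / x \<le> real m" using real_arch_simple by blast
        have "h n x = (P x / x)\<^sup>2" if "n \<ge> m" for n
        proof -
          have "b / x \<le> real n + 2" using m that by linarith
          then have "\<epsilon> n \<le> x" using x b by (simp add: \<epsilon>_def field_simps)
          then show ?thesis using x by (simp add: h_def)
        qed
        then show "(\<lambda>n. h n x) \<longlonglongrightarrow> (P x / x)\<^sup>2"
          by (intro tendsto_eventually eventually_sequentiallyI)
      qed
    qed (use Pm in simp)
  qed
  moreover have "(\<lambda>x. complex_of_real (P x / x)) \<in> borel_measurable ?M"
    using Pm by measurable
  ultimately show ?thesis
    unfolding P_def[symmetric] L2_def by (simp only: mem_Collect_eq norm_of_real power2_abs)
qed

section \<open>Functions of class \<open>H\<^sup>2\<close>\<close>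

lemma LINT_Icc:
  fixes h :: "real \<Rightarrow> complex"
  assumes "h absolutely_integrable_on {a..b}" "x \<in> {a..b}"
  shows "(LINT t|lebesgue_on {a..x}. h t) = integral {a..x} h"
  using assms by (intro lebesgue_integral_eq_integral absolutely_integrable_imp_integrable)
    (auto intro: absolutely_integrable_on_subinterval)

lemma H2_functionD:
  assumes b: "0 < b" and H: "H2_function b f f1 f2"
  shows "f2 \<in> L2 (lebesgue_Ioo0 b)" "f2 absolutely_integrable_on {0..b}" "f1 absolutely_integrable_on {0..b}"
    and "\<And>x. x \<in> {0..b} \<Longrightarrow> f1 x = f1 0 + integral {0..x} f2"
    and "\<And>x. x \<in> {0..b} \<Longrightarrow> f x = f 0 + integral {0..x} f1"
    and "continuous_on {0..b} f1" "continuous_on {0..b} f"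
proof -
  show f2: "f2 \<in> L2 (lebesgue_Ioo0 b)" using H by (simp add: H2_function_def)
  show a2: "f2 absolutely_integrable_on {0..b}" by (rule L2_absolutely_integrable[OF b f2])
  show e1: "f1 x = f1 0 + integral {0..x} f2" if "x \<in> {0..b}" for x
    using H that LINT_Icc[OF a2 that] unfolding H2_function_def by metis
  show c1: "continuous_on {0..b} f1" by (rule indefinite_integral_continuous[OF a2 e1])
  show a1: "f1 absolutely_integrable_on {0..b}"
    using c1 by (rule absolutely_integrable_continuous_real)
  show e: "f x = f 0 + integral {0..x} f1" if "x \<in> {0..b}" for x
    using H that LINT_Icc[OF a1 that] unfolding H2_function_def by metis
  show "continuous_on {0..b} f" by (rule indefinite_integral_continuous[OF a1 e])
qed

lemma H2_functionI:
  assumes b: "0 < b" and f2: "f2 \<in> L2 (lebesgue_Ioo0 b)"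
    and e1: "\<And>x. x \<in> {0..b} \<Longrightarrow> f1 x = f1 0 + integral {0..x} f2"
    and e: "\<And>x. x \<in> {0..b} \<Longrightarrow> f x = f 0 + integral {0..x} f1"
  shows "H2_function b f f1 f2"
proof -
  note a2 = L2_absolutely_integrable[OF b f2]
  have a1: "f1 absolutely_integrable_on {0..b}"
    by (intro absolutely_integrable_continuous_real indefinite_integral_continuous[OF a2 e1])
  show ?thesis
    unfolding H2_function_def using f2 e1 e LINT_Icc[OF a2] LINT_Icc[OF a1] by metis
qed

lemma H2_function_add:
  assumes b: "0 < b" and "H2_function b f f1 f2" "H2_function b g g1 g2"
  shows "H2_function b (\<lambda>x. f x + g x) (\<lambda>x. f1 x + g1 x) (\<lambda>x. f2 x + g2 x)"
proof (rule H2_functionI[OF b])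
  note f = H2_functionD[OF b assms(2)] and g = H2_functionD[OF b assms(3)]
  have i: "h integrable_on {0..x}" if "h absolutely_integrable_on {0..b}" "x \<in> {0..b}" for h :: "real \<Rightarrow> complex" and x
    using that by (auto simp: absolutely_integrable_on_def intro: integrable_on_subinterval)
  show "(\<lambda>x. f2 x + g2 x) \<in> L2 (lebesgue_Ioo0 b)" by (intro L2_add f g)
  fix x assume x: "x \<in> {0..b}"
  show "f1 x + g1 x = f1 0 + g1 0 + integral {0..x} (\<lambda>x. f2 x + g2 x)"
    using f(4)[OF x] g(4)[OF x] i[OF f(2) x] i[OF g(2) x] by (simp add: integral_add)
  show "f x + g x = f 0 + g 0 + integral {0..x} (\<lambda>x. f1 x + g1 x)"
    using f(5)[OF x] g(5)[OF x] i[OF f(3) x] i[OF g(3) x] by (simp add: integral_add)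
qed

lemma H2_function_cmult:
  assumes b: "0 < b" and "H2_function b f f1 f2"
  shows "H2_function b (\<lambda>x. c * f x) (\<lambda>x. c * f1 x) (\<lambda>x. c * f2 x)"
proof (rule H2_functionI[OF b])
  note f = H2_functionD[OF b assms(2)]
  show "(\<lambda>x. c * f2 x) \<in> L2 (lebesgue_Ioo0 b)" by (intro L2_cmult f)
  fix x assume x: "x \<in> {0..b}"
  show "c * f1 x = c * f1 0 + integral {0..x} (\<lambda>x. c * f2 x)"
    using f(4)[OF x] by (simp add: distrib_left[symmetric])
  show "c * f x = c * f 0 + integral {0..x} (\<lambda>x. c * f1 x)"
    using f(5)[OF x] by (simp add: distrib_left[symmetric])
qed

text \<open>Cauchy-Schwarz for \<open>f1\<close>, the integral of \<open>f2\<close>, and another integration for \<open>f\<close>.\<close>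

lemma H2_function_bounds:
  assumes b: "0 < b" and H: "H2_function b f f1 f2" and 0: "f 0 = 0" "f1 0 = 0" and x: "0 \<le> x" "x \<le> b"
  shows "cmod (f1 x) \<le> sqrt x * l2_norm (lebesgue_Ioo0 b) f2"
    and "cmod (f x) \<le> x * (sqrt x * l2_norm (lebesgue_Ioo0 b) f2)"
proof -
  let ?N = "l2_norm (lebesgue_Ioo0 b) f2"
  note D = H2_functionD[OF b H]
  note one = L2_one[OF b]
  have f1: "cmod (f1 x) \<le> sqrt x * ?N" if x: "0 \<le> x" "x \<le> b" for x
    using initial_integral_bound[OF D(1) one x, of 1] D(4)[of x] 0 x by simp
  from f1[OF x] show "cmod (f1 x) \<le> sqrt x * ?N" .
  have "cmod (integral {0..x} f1) \<le> integral {0..x} (\<lambda>t. sqrt x * ?N)"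
  proof (rule integral_norm_bound_integral)
    show "f1 integrable_on {0..x}"
      using D(3) x by (auto simp: absolutely_integrable_on_def intro: integrable_on_subinterval)
    fix t assume t: "t \<in> {0..x}"
    then have "sqrt t * ?N \<le> sqrt x * ?N" by (intro mult_right_mono) auto
    then show "cmod (f1 t) \<le> sqrt x * ?N" using f1[of t] t x by auto
  qed auto
  then show "cmod (f x) \<le> x * (sqrt x * ?N)"
    using D(5)[of x] 0 x by (simp add: mult.commute mult.left_commute)
qed

text \<open>Apply Hardy's inequality to \<open>f1\<close>, and then to \<open>f1 x / x\<close>, whose integral over \<open>(0, x)\<close> bounds
  \<open>f x / x\<close>.\<close>

lemma H2_function_div_square_L2:
  assumes b: "0 < b" and H: "H2_function b f f1 f2" and 0: "f 0 = 0" "f1 0 = 0"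
  shows "(\<lambda>x. f x / of_real (x\<^sup>2)) \<in> L2 (lebesgue_Ioo0 b)"
proof -
  let ?M = "lebesgue_Ioo0 b"
  note D = H2_functionD[OF b H]
  have dominated: "v \<in> L2 ?M" if "continuous_on {0<..<b} v" "w \<in> L2 ?M" "\<And>x. 0 < x \<Longrightarrow> x < b \<Longrightarrow> cmod (v x) \<le> cmod (w x)"
    for v w :: "real \<Rightarrow> complex"
    by (rule L2_dominated[OF that(2) continuous_imp_measurable_on_sets_lebesgue[OF that(1)]])
      (use that(3) in auto)
  define g where "g x = f1 x / of_real x" for x :: real
  have gc: "continuous_on {0<..<b} g"
    unfolding g_def by (intro continuous_intros continuous_on_subset[OF D(6)]) auto
  have g: "g \<in> L2 ?M"
  proof (rule dominated[OF gc Hardy[OF b D(1)]])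
    fix x assume x: "0 < x" "x < b"
    have "cmod (f1 x) \<le> integral {0..x} (\<lambda>t. cmod (f2 t))"
      using D(4)[of x] 0 x norm_increment_le_integral_norm[of 0 x f2 0 x]
        absolutely_integrable_on_subinterval[OF D(2), of 0 x] by simp
    then show "cmod (g x) \<le> cmod (of_real (integral {0..x} (\<lambda>t. cmod (f2 t)) / x))"
      using x by (simp add: g_def norm_divide divide_right_mono)
  qed
  have ga: "g absolutely_integrable_on {0..b}" by (rule L2_absolutely_integrable[OF b g])
  show ?thesis
  proof (rule dominated[OF _ Hardy[OF b g]])
    show "continuous_on {0<..<b} (\<lambda>x. f x / of_real (x\<^sup>2))"
      by (intro continuous_intros continuous_on_subset[OF D(7)]) auto
    fix x assume x: "0 < x" "x < b"
    have gx: "(\<lambda>t. cmod (g t)) integrable_on {0..x}"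
      using absolutely_integrable_on_subinterval[OF ga, of 0 x] x
      by (simp add: absolutely_integrable_on_def)
    have "cmod (integral {0..x} f1) \<le> integral {0..x} (\<lambda>t. x * cmod (g t))"
    proof (rule integral_norm_bound_integral)
      show "f1 integrable_on {0..x}"
        using absolutely_integrable_on_subinterval[OF D(3), of 0 x] x
        by (simp add: absolutely_integrable_on_def)
      show "(\<lambda>t. x * cmod (g t)) integrable_on {0..x}" using gx by (rule integrable_on_mult_right)
      fix t assume t: "t \<in> {0..x}"
      show "cmod (f1 t) \<le> x * cmod (g t)"
      proof (cases "t = 0")
        case False
        then have "cmod (f1 t) = t * cmod (g t)" using t by (simp add: g_def norm_divide)
        then show ?thesis using t by (simp add: mult_right_mono)
      qed (use x 0 in simp)
    qed
    then have "cmod (f x) \<le> x * integral {0..x} (\<lambda>t. cmod (g t))"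
      using D(5)[of x] 0 x by simp
    then have "cmod (f x) / x\<^sup>2 \<le> x * integral {0..x} (\<lambda>t. cmod (g t)) / x\<^sup>2"
      by (rule divide_right_mono) simp
    also have "\<dots> = integral {0..x} (\<lambda>t. cmod (g t)) / x"
      using x by (simp add: power2_eq_square)
    finally show "cmod (f x / of_real (x\<^sup>2)) \<le> cmod (of_real (integral {0..x} (\<lambda>t. cmod (g t)) / x))"
      using x integral_nonneg[OF gx] by (simp add: norm_divide norm_power)
  qed
qed

section \<open>Density of the domain\<close>

lemma l2_norm_dominated_convergence:
  assumes "\<And>n. f n \<in> borel_measurable M" and "integrable M (\<lambda>x. (G x)\<^sup>2)"
    and "AE x in M. (\<lambda>n. f n x) \<longlonglongrightarrow> 0" and "\<And>n. AE x in M. cmod (f n x) \<le> G x"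
  shows "(\<lambda>n. l2_norm M (f n)) \<longlonglongrightarrow> 0"
proof -
  have "(\<lambda>n. LINT x|M. (cmod (f n x))\<^sup>2) \<longlonglongrightarrow> (LINT x|M. 0)"
  proof (rule integral_dominated_convergence)
    show "AE x in M. (\<lambda>n. (cmod (f n x))\<^sup>2) \<longlonglongrightarrow> 0"
      using assms(3)
    proof eventually_elim
      case (elim x)
      then have "(\<lambda>n. (cmod (f n x))\<^sup>2) \<longlonglongrightarrow> (cmod 0)\<^sup>2" by (intro tendsto_intros)
      then show ?case by simp
    qed
    show "AE x in M. norm ((cmod (f n x))\<^sup>2) \<le> (G x)\<^sup>2" for n
      using assms(4)[of n] by eventually_elim (auto intro!: power_mono)
  qed (use assms(1,2) in auto)
  then have "(\<lambda>n. sqrt (LINT x|M. (cmod (f n x))\<^sup>2)) \<longlonglongrightarrow> sqrt 0"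
    by (intro tendsto_real_sqrt) simp
  then show ?thesis by (simp add: l2_norm_def)
qed

lemma l2_norm_le_uniform:
  assumes "f \<in> L2 (lebesgue_on {0<..<b})" "0 < b" "\<And>x. 0 < x \<Longrightarrow> x < b \<Longrightarrow> cmod (f x) \<le> C"
  shows "l2_norm (lebesgue_on {0<..<b}) f \<le> C * sqrt b"
proof -
  let ?M = "lebesgue_on {0<..<b}"
  have C: "0 \<le> C" using assms(3)[of "b/2"] assms(2) norm_ge_zero order_trans by (metis half_gt_zero field_sum_of_halves less_add_same_cancel1)
  have "(LINT x|?M. (cmod (f x))\<^sup>2) \<le> (LINT x|?M. C\<^sup>2)"
    using assms by (intro integral_mono)
      (auto simp: L2_def intro!: power_mono finite_measure.integrable_const finite_measure_lebesgue_on)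
  also have "\<dots> = b * C\<^sup>2"
    using assms(2) by (simp add: measure_restrict_space)
  finally have "l2_norm ?M f \<le> sqrt (b * C\<^sup>2)" by (simp add: l2_norm_def)
  then show ?thesis using C by (simp add: real_sqrt_mult mult.commute)
qed

text \<open>Truncate \<open>f\<close> so that \<open>f / w\<close> is bounded, and approximate the quotient by continuous functions and
  then by polynomials.\<close>

lemma weighted_polynomials_dense:
  fixes f :: "real \<Rightarrow> complex" and w :: "real \<Rightarrow> real"
  assumes b: "0 < b" and f: "f \<in> L2 (lebesgue_on {0<..<b})"
    and w: "continuous_on {0..b} w" "\<And>x. 0 < x \<Longrightarrow> x < b \<Longrightarrow> 0 < w x" and e: "0 < e"
  shows "\<exists>p. polynomial_function p \<and>
    l2_norm (lebesgue_on {0<..<b}) (\<lambda>x. f x - of_real (w x) * p x) < e"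
proof -
  let ?M = "lebesgue_on {0<..<b}"
  have wm: "w \<in> borel_measurable ?M"
    by (intro continuous_imp_measurable_on_sets_lebesgue continuous_on_subset[OF w(1)]) auto
  have fm: "f \<in> borel_measurable ?M" using f by (simp add: L2_def)
  have "bounded (w ` {0..b})" using w(1) by (intro compact_imp_bounded compact_continuous_image) auto
  then obtain W where W: "\<And>x. x \<in> {0..b} \<Longrightarrow> \<bar>w x\<bar> \<le> W"
    unfolding bounded_iff real_norm_def by (metis imageI)
  have W0: "0 \<le> W" using order_trans[OF abs_ge_zero W[of 0]] b by simp
  define F where "F n x = (if 1 \<le> real (Suc n) * w x \<and> cmod (f x) \<le> real (Suc n) then f x / of_real (w x) else 0)" for n x
  have Fm: "F n \<in> borel_measurable ?M" for n
    unfolding F_def[abs_def] using wm fm by measurable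
  have wF: "of_real (w x) * F n x = (if 1 \<le> real (Suc n) * w x \<and> cmod (f x) \<le> real (Suc n) then f x else 0)" for n x
    by (auto simp: F_def)
  have "(\<lambda>n. l2_norm ?M (\<lambda>x. f x - of_real (w x) * F n x)) \<longlonglongrightarrow> 0"
  proof (rule l2_norm_dominated_convergence)
    show "(\<lambda>x. f x - of_real (w x) * F n x) \<in> borel_measurable ?M" for n
      using fm wm Fm[of n] by measurable
    show "integrable ?M (\<lambda>x. (cmod (f x))\<^sup>2)" using f by (simp add: L2_def)
    show "AE x in ?M. cmod (f x - of_real (w x) * F n x) \<le> cmod (f x)" for n
      unfolding wF by simp
    show "AE x in ?M. (\<lambda>n. f x - of_real (w x) * F n x) \<longlonglongrightarrow> 0"
    proof (rule AE_I2)
      fix x assume "x \<in> space ?M"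
      then have wx: "0 < w x" using w(2) by auto
      obtain N where N: "max (1 / w x) (cmod (f x)) \<le> real N" using real_arch_simple by blast
      have "f x - of_real (w x) * F n x = 0" if "n \<ge> N" for n
      proof -
        have "1 / w x \<le> real (Suc n)" "cmod (f x) \<le> real (Suc n)" using N that by auto
        then show ?thesis using wx unfolding wF by (simp add: field_simps)
      qed
      then show "(\<lambda>n. f x - of_real (w x) * F n x) \<longlonglongrightarrow> 0"
        by (intro tendsto_eventually eventually_sequentiallyI)
    qed
  qed
  then obtain n where n: "l2_norm ?M (\<lambda>x. f x - of_real (w x) * F n x) < e / 3"
    using order_tendstoD(2)[of _ 0 sequentially "e / 3"] e by (auto simp: eventually_sequentially)
  define B where "B = (real (Suc n))\<^sup>2"
  have B: "0 < B" by (simp add: B_def)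
  have FB: "cmod (F n x) \<le> B" for x
  proof (cases "1 \<le> real (Suc n) * w x \<and> cmod (f x) \<le> real (Suc n)")
    case True
    then have "0 < w x" by (smt (verit) mult_nonneg_nonpos of_nat_0_le_iff)
    then have "1 / w x \<le> real (Suc n)" using True by (simp add: field_simps)
    then have "cmod (f x) * (1 / w x) \<le> real (Suc n) * real (Suc n)"
      using True \<open>0 < w x\<close> by (intro mult_mono) auto
    then show ?thesis using True \<open>0 < w x\<close> by (simp add: F_def norm_divide B_def power2_eq_square)
  qed (use B in \<open>auto simp: F_def\<close>)
  have "F n measurable_on {0<..<b}"
    using Fm by (simp add: measurable_on_iff_borel_measurable)
  then obtain N g where N: "negligible N" and gc: "\<And>i. continuous_on UNIV (g i)"
    and glim: "\<And>x. x \<notin> N \<Longrightarrow> (\<lambda>i. g i x) \<longlonglongrightarrow> (if x \<in> {0<..<b} then F n x else 0)"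
    unfolding measurable_on_def by metis
  \<comment> \<open>radial projection onto the disc of radius \<open>B\<close>\<close>
  define cl :: "complex \<Rightarrow> complex" where "cl z = (B / max B (cmod z)) *\<^sub>R z" for z
  have clc: "continuous_on UNIV cl"
    unfolding cl_def using B by (intro continuous_intros) (auto simp: max_def)
  have clB: "cmod (cl z) \<le> B" for z
    using B by (auto simp: cl_def max_def field_simps)
  have cl_id: "cmod z \<le> B \<Longrightarrow> cl z = z" for z
    using B by (simp add: cl_def max_def)
  define h where "h i x = cl (g i x)" for i x
  have hc: "continuous_on UNIV (h i)" for i
    unfolding h_def by (rule continuous_on_compose2[OF clc gc]) auto
  have hm: "h i \<in> borel_measurable ?M" for i
    by (intro continuous_imp_measurable_on_sets_lebesgue continuous_on_subset[OF hc]) auto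
  have "(\<lambda>i. l2_norm ?M (\<lambda>x. of_real (w x) * F n x - of_real (w x) * h i x)) \<longlonglongrightarrow> 0"
  proof (rule l2_norm_dominated_convergence)
    show "(\<lambda>x. of_real (w x) * F n x - of_real (w x) * h i x) \<in> borel_measurable ?M" for i
      using hm[of i] wm Fm[of n] by measurable
    show "integrable ?M (\<lambda>x. (2 * B * W)\<^sup>2)"
      by (intro finite_measure.integrable_const finite_measure_lebesgue_on) auto
    show "AE x in ?M. cmod (of_real (w x) * F n x - of_real (w x) * h i x) \<le> 2 * B * W" for i
    proof (rule AE_I2)
      fix x assume "x \<in> space ?M"
      then have wx: "\<bar>w x\<bar> \<le> W" using W by auto
      have "cmod (F n x - h i x) \<le> 2 * B"
        using norm_triangle_ineq4[of "F n x" "h i x"] FB[of x] clB[of "g i x"] by (simp add: h_def)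
      then have "\<bar>w x\<bar> * cmod (F n x - h i x) \<le> W * (2 * B)"
        using wx W0 by (intro mult_mono) auto
      then show "cmod (of_real (w x) * F n x - of_real (w x) * h i x) \<le> 2 * B * W"
        unfolding right_diff_distrib[symmetric] norm_mult by (simp add: mult_ac)
    qed
    have "AE x in lebesgue. x \<notin> N"
      using N by (simp add: AE_not_in negligible_iff_null_sets)
    then have "AE x in ?M. x \<notin> N" by (auto simp: AE_restrict_space_iff elim: eventually_mono)
    then show "AE x in ?M. (\<lambda>i. of_real (w x) * F n x - of_real (w x) * h i x) \<longlonglongrightarrow> 0"
    proof (rule AE_mp, intro AE_I2 impI)
      fix x assume x: "x \<in> space ?M" "x \<notin> N"
      have "(\<lambda>i. g i x) \<longlonglongrightarrow> F n x" using glim[OF x(2)] x(1) by simp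
      then have "(\<lambda>i. h i x) \<longlonglongrightarrow> cl (F n x)"
        unfolding h_def by (intro continuous_on_tendsto_compose[OF clc]) auto
      then have "(\<lambda>i. of_real (w x) * F n x - of_real (w x) * h i x) \<longlonglongrightarrow> of_real (w x) * F n x - of_real (w x) * F n x"
        unfolding cl_id[OF FB] by (intro tendsto_intros)
      then show "(\<lambda>i. of_real (w x) * F n x - of_real (w x) * h i x) \<longlonglongrightarrow> 0" by simp
    qed
  qed
  then obtain i where i: "l2_norm ?M (\<lambda>x. of_real (w x) * F n x - of_real (w x) * h i x) < e / 3"
    using order_tendstoD(2)[of _ 0 sequentially "e / 3"] e by (auto simp: eventually_sequentially)
  obtain V where V: "0 < V" "W \<le> V" using W0 by (intro that[of "W + 1"]) auto
  define \<eta> where "\<eta> = e / (4 * V * sqrt b)"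
  have \<eta>: "0 < \<eta>" using e V b by (simp add: \<eta>_def)
  obtain p where p: "polynomial_function p" and ph: "\<And>x. x \<in> {0..b} \<Longrightarrow> cmod (h i x - p x) < \<eta>"
    using Stone_Weierstrass_polynomial_function[of "{0..b}" "h i" \<eta>] \<eta> continuous_on_subset[OF hc, of "{0..b}" i]
    by auto
  have cb: "v \<in> L2 ?M" if "continuous_on {0..b} v" for v :: "real \<Rightarrow> complex"
    using L2_mult_continuous[OF L2_one[OF b] that] by simp
  have cw: "continuous_on {0..b} (\<lambda>x. complex_of_real (w x))" using w(1) by (intro continuous_intros)
  have L: "(\<lambda>x. of_real (w x) * h i x) \<in> L2 ?M" "(\<lambda>x. of_real (w x) * p x) \<in> L2 ?M"
    by (intro cb continuous_intros cw continuous_on_subset[OF hc] continuous_on_polymonial_function p subset_UNIV)+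
  have LF: "(\<lambda>x. of_real (w x) * F n x) \<in> L2 ?M"
  proof -
    have "{x \<in> space ?M. 1 \<le> real (Suc n) * w x \<and> cmod (f x) \<le> real (Suc n)} \<in> sets ?M"
      using wm fm by measurable
    from L2_restrict[OF f this] show ?thesis unfolding wF .
  qed
  have 3: "l2_norm ?M (\<lambda>x. of_real (w x) * h i x - of_real (w x) * p x) \<le> e / 4"
  proof -
    have "l2_norm ?M (\<lambda>x. of_real (w x) * h i x - of_real (w x) * p x) \<le> (W * \<eta>) * sqrt b"
    proof (rule l2_norm_le_uniform[OF L2_diff[OF L] b])
      fix x assume x: "0 < x" "x < b"
      have "\<bar>w x\<bar> * cmod (h i x - p x) \<le> W * \<eta>"
        using W[of x] W0 ph[of x] x by (intro mult_mono) auto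
      then show "cmod (of_real (w x) * h i x - of_real (w x) * p x) \<le> W * \<eta>"
        by (simp add: norm_mult flip: right_diff_distrib)
    qed
    also have "\<dots> \<le> V * \<eta> * sqrt b" using \<eta> b V by (intro mult_right_mono) auto
    also have "\<dots> = e / 4" using V b by (simp add: \<eta>_def)
    finally show ?thesis .
  qed
  have "l2_norm ?M (\<lambda>x. f x - of_real (w x) * p x)
      = l2_norm ?M (\<lambda>x. (f x - of_real (w x) * F n x) + ((of_real (w x) * F n x - of_real (w x) * h i x)
        + (of_real (w x) * h i x - of_real (w x) * p x)))"
    by simp
  also have "\<dots> \<le> l2_norm ?M (\<lambda>x. f x - of_real (w x) * F n x) +
      (l2_norm ?M (\<lambda>x. of_real (w x) * F n x - of_real (w x) * h i x)
      + l2_norm ?M (\<lambda>x. of_real (w x) * h i x - of_real (w x) * p x))"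
    by (intro order_trans[OF l2_norm_triangle] add_left_mono l2_norm_triangle L2_add L2_diff f L LF)
  also have "\<dots> < e" using n i 3 e by linarith
  finally show ?thesis using p by blast
qed

lemma H2_function_C2:
  assumes b: "0 < b" and d: "\<And>x. (f has_vector_derivative f1 x) (at x)" "\<And>x. (f1 has_vector_derivative f2 x) (at x)"
    and c: "continuous_on {0..b} f2"
  shows "H2_function b f f1 f2"
proof (rule H2_functionI[OF b])
  show "f2 \<in> L2 (lebesgue_Ioo0 b)"
    using L2_mult_continuous[OF L2_one[OF b] c] by simp
  have "continuous_on {0..b} f1"
    using d(2) by (meson continuous_at_imp_continuous_on has_vector_derivative_continuous)
  then show "f x = f 0 + integral {0..x} f1" if "x \<in> {0..b}" for x
    using C1_imp_indefinite_integral(2)[OF d(1)] that by blast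
  show "f1 x = f1 0 + integral {0..x} f2" if "x \<in> {0..b}" for x
    using C1_imp_indefinite_integral(2)[OF d(2) c that] .
qed

text \<open>The weight \<open>x\<^sup>2 (b - x)\<close> turns polynomials into elements of the domain.\<close>

lemma bessel_operator_densely_defined:
  assumes b: "0 < b"
  shows "densely_defined (lebesgue_Ioo0 b) (bessel_operator \<nu> b)"
  unfolding densely_defined_def
proof (intro ballI allI impI)
  fix f :: "real \<Rightarrow> complex" and e :: real assume f: "f \<in> L2 (lebesgue_Ioo0 b)" and e: "0 < e"
  define w where "w x = x\<^sup>2 * (b - x)" for x :: real
  obtain p where p: "polynomial_function p"
    and pe: "l2_norm (lebesgue_Ioo0 b) (\<lambda>x. f x - of_real (w x) * p x) < e"
  proof -
    have "continuous_on {0..b} w" unfolding w_def by (intro continuous_intros)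
    moreover have "0 < w x" if "0 < x" "x < b" for x using that by (simp add: w_def)
    ultimately show ?thesis
      using weighted_polynomials_dense[OF b f _ _ e, of w] that by blast
  qed
  obtain p1 where p1: "polynomial_function p1" "\<And>x. (p has_vector_derivative p1 x) (at x)"
    using has_vector_derivative_polynomial_function[OF p] by blast
  obtain p2 where p2: "polynomial_function p2" "\<And>x. (p1 has_vector_derivative p2 x) (at x)"
    using has_vector_derivative_polynomial_function[OF p1(1)] by blast
  define u u1 u2 :: "real \<Rightarrow> complex"
    where "u = (\<lambda>x. of_real (w x) * p x)"
      and "u1 = (\<lambda>x. of_real (w x) * p1 x + of_real (2 * b * x - 3 * x\<^sup>2) * p x)"
      and "u2 = (\<lambda>x. (of_real (w x) * p2 x + of_real (2 * b * x - 3 * x\<^sup>2) * p1 x)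
        + (of_real (2 * b * x - 3 * x\<^sup>2) * p1 x + of_real (2 * b - 6 * x) * p x))"
  have wd: "(w has_real_derivative 2 * b * x - 3 * x\<^sup>2) (at x)"
    "((\<lambda>x. 2 * b * x - 3 * x\<^sup>2) has_real_derivative 2 * b - 6 * x) (at x)" for x
    unfolding w_def by (auto intro!: derivative_eq_intros simp: power2_eq_square algebra_simps)
  have "(u has_vector_derivative u1 x) (at x)" "(u1 has_vector_derivative u2 x) (at x)" for x
    unfolding u_def u1_def u2_def
    by (intro has_vector_derivative_mult has_vector_derivative_add has_vector_derivative_of_real wd p1(2) p2(2))+
  moreover have "continuous_on {0..b} u2"
    unfolding u2_def w_def by (intro continuous_intros continuous_on_polymonial_function p p1 p2)
  ultimately have "H2_function b u u1 u2" using b by (intro H2_function_C2)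
  moreover have "u 0 = 0" "u1 0 = 0" "u b = 0" by (simp_all add: u_def u1_def w_def)
  ultimately have "u \<in> Domain (bessel_operator \<nu> b)"
    unfolding bessel_operator_def using ae_equal_refl by blast
  then show "\<exists>u\<in>Domain (bessel_operator \<nu> b). l2_norm (lebesgue_Ioo0 b) (\<lambda>x. f x - u x) < e"
    using pe by (intro bexI[of _ u]) (simp_all add: u_def)
qed

section \<open>The minimal operator and its adjoint\<close>

context bessel
begin

abbreviation A :: "real op_graph" where "A \<equiv> bessel_operator \<nu> b"

text \<open>The two product rules behind Lagrange's identity, for a solution \<open>w\<close> of \<open>w'' = q w\<close> and an absolutely
  continuous \<open>P\<close>; that identity takes \<open>P = f\<close> in the second one and \<open>P = f'\<close> in the first.\<close>

lemma solution_products: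
  fixes P p :: "real \<Rightarrow> complex"
  assumes w: "\<And>x. 0 < x \<Longrightarrow> (w has_real_derivative w' x) (at x)"
      "\<And>x. 0 < x \<Longrightarrow> (w' has_real_derivative q x * w x) (at x)"
    and x: "0 < x" "x \<le> y"
    and p: "p absolutely_integrable_on {x..y}" and P: "\<And>t. t \<in> {x..y} \<Longrightarrow> P t = P x + integral {x..t} p"
  shows "integral {x..y} (\<lambda>t. p t * of_real (w t) + P t * of_real (w' t)) = P y * of_real (w y) - P x * of_real (w x)"
      "(\<lambda>t. p t * of_real (w t) + P t * of_real (w' t)) absolutely_integrable_on {x..y}"
      "integral {x..y} (\<lambda>t. p t * of_real (w' t) + P t * of_real (q t * w t)) = P y * of_real (w' y) - P x * of_real (w' x)"
      "(\<lambda>t. p t * of_real (w' t) + P t * of_real (q t * w t)) absolutely_integrable_on {x..y}"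
proof -
  have c: "continuous_on {x..y} w" "continuous_on {x..y} w'"
    by (rule DERIV_continuous_on[OF has_field_derivative_at_within[OF w(1)]]; use x in simp)
      (rule DERIV_continuous_on[OF has_field_derivative_at_within[OF w(2)]]; use x in simp)
  have cq: "continuous_on {x..y} q"
    unfolding q_def[abs_def] using x by (intro continuous_intros) auto
  have d: "((\<lambda>t. complex_of_real (w t)) has_vector_derivative of_real (w' t)) (at t)"
      "((\<lambda>t. complex_of_real (w' t)) has_vector_derivative of_real (q t * w t)) (at t)" if "t \<in> {x..y}" for t
    using that x by (auto intro!: has_vector_derivative_of_real w simp del: of_real_mult)
  have c': "continuous_on {x..y} (\<lambda>t. complex_of_real (w' t))" "continuous_on {x..y} (\<lambda>t. complex_of_real (q t * w t))"
    by (intro continuous_intros c cq)+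
  note i = C1_imp_indefinite_integral[OF d(1) c'(1)] C1_imp_indefinite_integral[OF d(2) c'(2)]
  show "integral {x..y} (\<lambda>t. p t * of_real (w t) + P t * of_real (w' t)) = P y * of_real (w y) - P x * of_real (w x)"
      "(\<lambda>t. p t * of_real (w t) + P t * of_real (w' t)) absolutely_integrable_on {x..y}"
    by (rule integral_product_rule[OF x(2) p i(1) P i(2)]; assumption)+
  show "integral {x..y} (\<lambda>t. p t * of_real (w' t) + P t * of_real (q t * w t)) = P y * of_real (w' y) - P x * of_real (w' x)"
      "(\<lambda>t. p t * of_real (w' t) + P t * of_real (q t * w t)) absolutely_integrable_on {x..y}"
    by (rule integral_product_rule[OF x(2) p i(3) P i(4)]; assumption)+
qed

lemma sol'_alt: "sol' a g x = of_real (k' x) * Y a g x + of_real (u' x) * Z g x"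
  by (simp add: sol'_def \<psi>_def k'_def algebra_simps)

text \<open>Variation of constants: differentiating \<open>k Y + u Z\<close> and \<open>k' Y + u' Z\<close>, where \<open>Y' = u g\<close> and
  \<open>Z' = -k g\<close>, and using that the Wronskian of \<open>k\<close> and \<open>u\<close> is one.\<close>

lemma sol_increments:
  assumes g: "g \<in> L2 M" and x: "0 < x" "x \<le> y" "y \<le> b"
  shows "sol a g y = sol a g x + integral {x..y} (sol' a g)"
    and "sol' a g y = sol' a g x + integral {x..y} (\<lambda>t. of_real (q t) * sol a g t - g t)"
proof -
  have ug: "(\<lambda>t. cu t * g t) absolutely_integrable_on {x..y}"
    using ug_integrable[OF g] x by (auto intro: absolutely_integrable_on_subinterval)
  have kg: "(\<lambda>t. - (ck t * g t)) absolutely_integrable_on {x..y}"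
    using kg_integrable[OF g] x
    by (auto simp: set_integrable_def intro: absolutely_integrable_on_subinterval[unfolded set_integrable_def])
  have Yi: "Y a g t = Y a g x + integral {x..t} (\<lambda>t. cu t * g t)"
    and Zi: "Z g t = Z g x + integral {x..t} (\<lambda>t. - (ck t * g t))" if "t \<in> {x..y}" for t
    using Y_increment[OF g, of x t] Z_increment[OF g, of x t] that x by auto
  note kY = solution_products[OF k_deriv k'_deriv x(1,2) ug Yi]
  note uZ = solution_products[OF u_deriv u'_deriv x(1,2) kg Zi]
  have "integral {x..y} (sol' a g) = integral {x..y} (\<lambda>t.
      (cu t * g t * ck t + Y a g t * of_real (k' t)) + (- (ck t * g t) * cu t + Z g t * of_real (u' t)))"
    by (rule integral_cong) (simp add: sol'_alt algebra_simps)
  also have "\<dots> = (Y a g y * ck y - Y a g x * ck x) + (Z g y * cu y - Z g x * cu x)"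
    using kY(1,2) uZ(1,2) by (subst integral_add) (auto simp: absolutely_integrable_on_def)
  finally show "sol a g y = sol a g x + integral {x..y} (sol' a g)"
    by (simp add: sol_def mult.commute)
  have "integral {x..y} (\<lambda>t. of_real (q t) * sol a g t - g t) = integral {x..y} (\<lambda>t.
      (cu t * g t * of_real (k' t) + Y a g t * of_real (q t * k t)) + (- (ck t * g t) * of_real (u' t) + Z g t * of_real (q t * u t)))"
  proof (rule integral_cong)
    fix t assume t: "t \<in> {x..y}"
    have "complex_of_real (k t * u' t - u t * k' t) = 1" using wronskian[of t] t x by simp
    then have W: "ck t * of_real (u' t) - cu t * of_real (k' t) = 1" by simp
    have "g t = g t * (ck t * of_real (u' t) - cu t * of_real (k' t))" unfolding W by simp
    then show "of_real (q t) * sol a g t - g t =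
      (cu t * g t * of_real (k' t) + Y a g t * of_real (q t * k t)) + (- (ck t * g t) * of_real (u' t) + Z g t * of_real (q t * u t))"
      by (simp add: sol_def algebra_simps)
  qed
  also have "\<dots> = (Y a g y * of_real (k' y) - Y a g x * of_real (k' x)) + (Z g y * of_real (u' y) - Z g x * of_real (u' x))"
    using kY(3,4) uZ(3,4) by (subst integral_add) (auto simp: absolutely_integrable_on_def)
  finally show "sol' a g y = sol' a g x + integral {x..y} (\<lambda>t. of_real (q t) * sol a g t - g t)"
    by (simp add: sol'_alt mult.commute)
qed

lemma sol_cong_ae:
  assumes "ae_equal M g g'" "0 \<le> x" "x \<le> b"
  shows "Y a g x = Y a g' x" "Z g x = Z g' x" "sol a g x = sol a g' x"
  using integral_cong_ae_equal[OF assms(1), of 0 x] integral_cong_ae_equal[OF assms(1), of x b] assms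
  by (auto simp: sol_def Y_def Z_def)

lemma ae_equalI: "(\<And>x. 0 < x \<Longrightarrow> x < b \<Longrightarrow> f x = g x) \<Longrightarrow> ae_equal M f g"
  unfolding ae_equal_def by (intro AE_I2) auto

text \<open>Functions in the domain of \<open>A\<close> are \<open>O(x powr (3/2))\<close> with derivative \<open>O(x powr (1/2))\<close>, so their brackets
  with \<open>u\<close> and \<open>k\<close> vanish at \<open>0\<close>. The brackets are \<open>Y\<close> and \<open>-Z\<close>, and the function is recovered from
  them since the Wronskian of \<open>k\<close> and \<open>u\<close> is one.\<close>

lemma H2_function_eq_sol:
  assumes H: "H2_function b f f1 f2" and 0: "f 0 = 0" "f1 0 = 0" and fb: "f b = 0"
  defines "v \<equiv> \<lambda>x. - f2 x + of_real (q x) * f x"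
  shows "v \<in> L2 M" "Z v 0 = 0" and "\<And>x. 0 < x \<Longrightarrow> x < b \<Longrightarrow> f x = sol 0 v x"
proof -
  note D = H2_functionD[OF b_pos H]
  let ?N = "l2_norm M f2"
  have "(\<lambda>x. of_real (\<nu>\<^sup>2 - 1/4) * (f x / of_real (x\<^sup>2)) + - 1 * f2 x) \<in> L2 M"
    by (intro L2_add L2_cmult D(1) H2_function_div_square_L2[OF b_pos H 0])
  moreover have "of_real (\<nu>\<^sup>2 - 1/4) * (f x / of_real (x\<^sup>2)) + - 1 * f2 x = v x" for x
    by (simp only: v_def q_def of_real_divide times_divide_eq_left times_divide_eq_right) simp
  ultimately show v: "v \<in> L2 M" by simp
  have brk: "integral {x..y} (\<lambda>t. of_real (w t) * v t)
      = (f y * of_real (w' y) - f1 y * of_real (w y)) - (f x * of_real (w' x) - f1 x * of_real (w x))"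
    if w: "\<And>x. 0 < x \<Longrightarrow> (w has_real_derivative w' x) (at x)"
      "\<And>x. 0 < x \<Longrightarrow> (w' has_real_derivative q x * w x) (at x)" and x: "0 < x" "x \<le> y" "y \<le> b"
    for w w' x y
  proof -
    have a: "f1 absolutely_integrable_on {x..y}" "f2 absolutely_integrable_on {x..y}"
      using x by (auto intro: absolutely_integrable_on_subinterval[OF D(3)] absolutely_integrable_on_subinterval[OF D(2)])
    have i: "f1 integrable_on {0..b}" "f2 integrable_on {0..b}"
      using D(2,3) by (auto simp: absolutely_integrable_on_def)
    have inc: "f t = f x + integral {x..t} f1" "f1 t = f1 x + integral {x..t} f2" if "t \<in> {x..y}" for t
      using indefinite_integral_increment[OF i(1) _ _ _ D(5), of x t]
        indefinite_integral_increment[OF i(2) _ _ _ D(4), of x t] that x by auto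
    note p = solution_products[OF w x(1,2) a(1) inc(1)]
    note p' = solution_products[OF w x(1,2) a(2) inc(2)]
    have "integral {x..y} (\<lambda>t. of_real (w t) * v t) = integral {x..y} (\<lambda>t.
        (f1 t * of_real (w' t) + f t * of_real (q t * w t)) - (f2 t * of_real (w t) + f1 t * of_real (w' t)))"
      by (rule integral_cong) (simp add: v_def algebra_simps)
    also have "\<dots> = (f y * of_real (w' y) - f x * of_real (w' x)) - (f1 y * of_real (w y) - f1 x * of_real (w x))"
      using p(3,4) p'(1,2) by (subst integral_diff) (auto simp: absolutely_integrable_on_def)
    finally show ?thesis by simp
  qed
  define Bu where "Bu x = f x * of_real (u' x) - f1 x * cu x" for x
  define Bk where "Bk x = f x * of_real (k' x) - f1 x * ck x" for x
  have bound: "cmod (f x * of_real w1 - f1 x * of_real w0) \<le> sqrt x * ?N * (\<bar>x * w1\<bar> + \<bar>w0\<bar>)"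
    if x: "0 < x" "x \<le> b" for x w1 w0
  proof -
    have f: "cmod (f1 x) \<le> sqrt x * ?N" "cmod (f x) \<le> x * (sqrt x * ?N)"
      using H2_function_bounds[OF b_pos H 0, of x] x by auto
    have "cmod (f x * of_real w1 - f1 x * of_real w0) \<le> cmod (f x) * \<bar>w1\<bar> + cmod (f1 x) * \<bar>w0\<bar>"
      by (rule order_trans[OF norm_triangle_ineq4]) (simp add: norm_mult)
    also have "\<dots> \<le> (x * (sqrt x * ?N)) * \<bar>w1\<bar> + (sqrt x * ?N) * \<bar>w0\<bar>"
      using f by (intro add_mono mult_right_mono) auto
    also have "\<dots> = sqrt x * ?N * (\<bar>x * w1\<bar> + \<bar>w0\<bar>)"
      using x by (simp add: abs_mult algebra_simps)
    finally show ?thesis .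
  qed
  have xu': "x * u' x = (1/2 + \<nu>) * u x" if "0 < x" for x
    using that powr_add[of x 1 "\<nu> - 1/2"] by (simp add: u'_def u_def add.commute)
  have Bu0: "(Bu \<longlongrightarrow> 0) (at_right 0)"
  proof (rule Lim_null_comparison)
    show "eventually (\<lambda>x. norm (Bu x) \<le> ?N * (3 * u b) * x powr (1/2)) (at_right 0)"
      unfolding eventually_at_right[OF b_pos]
    proof (intro exI[of _ b] conjI b_pos allI impI)
      fix x assume x: "0 < x" "x < b"
      have "\<bar>x * u' x\<bar> + \<bar>u x\<bar> = (3/2 + \<nu>) * u x"
        using xu'[OF x(1)] u_pos[OF x(1)] nu by (simp add: algebra_simps)
      also have "\<dots> \<le> 3 * u b" using nu u_pos[OF x(1)] u_mono[of x b] x by (intro mult_mono) auto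
      finally have le: "\<bar>x * u' x\<bar> + \<bar>u x\<bar> \<le> 3 * u b" .
      have "norm (Bu x) \<le> sqrt x * ?N * (\<bar>x * u' x\<bar> + \<bar>u x\<bar>)"
        unfolding Bu_def using x by (intro bound) auto
      also have "\<dots> \<le> sqrt x * ?N * (3 * u b)" using x le by (intro mult_left_mono) auto
      also have "\<dots> = ?N * (3 * u b) * x powr (1/2)" using x by (simp add: powr_half_sqrt)
      finally show "norm (Bu x) \<le> ?N * (3 * u b) * x powr (1/2)" .
    qed
    show "((\<lambda>x. ?N * (3 * u b) * x powr (1/2)) \<longlongrightarrow> 0) (at_right 0)"
      by (intro tendsto_mult_right_zero powr_tendsto_0_at_right) simp
  qed
  obtain C where C: "C \<ge> 0" "\<And>x. 0 < x \<Longrightarrow> x \<le> b \<Longrightarrow> k x \<le> C * x powr (- \<nu> / 2)"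
    using k_upper_bound by blast
  have Bk0: "(Bk \<longlongrightarrow> 0) (at_right 0)"
  proof (rule Lim_null_comparison)
    show "eventually (\<lambda>x. norm (Bk x) \<le> ?N * (3 * C) * x powr ((1 - \<nu>) / 2) + ?N * x powr (1 - \<nu>)) (at_right 0)"
      unfolding eventually_at_right[OF b_pos]
    proof (intro exI[of _ b] conjI b_pos allI impI)
      fix x assume x: "0 < x" "x < b"
      have k0: "0 \<le> k x" using k_nonneg[of x] x by simp
      have "x * k' x = (1/2 + \<nu>) * k x - x / u x"
        using xu'[OF x(1)] by (simp add: k'_def k_def right_diff_distrib mult.assoc[symmetric])
      moreover have "0 \<le> (1/2 + \<nu>) * k x" "0 \<le> x / u x" using k0 nu x u_pos[OF x(1)] by auto
      ultimately have "\<bar>x * k' x\<bar> + \<bar>k x\<bar> \<le> (3/2 + \<nu>) * k x + x / u x"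
        using k0 by (simp add: algebra_simps)
      also have "(3/2 + \<nu>) * k x \<le> 3 * (C * x powr (- \<nu> / 2))"
        using nu k0 C(2)[of x] x by (intro mult_mono) auto
      finally have "sqrt x * ?N * (\<bar>x * k' x\<bar> + \<bar>k x\<bar>) \<le> sqrt x * ?N * (3 * (C * x powr (- \<nu> / 2)) + x / u x)"
        using x by (intro mult_left_mono) auto
      also have "\<dots> = ?N * (3 * C) * (sqrt x * x powr (- \<nu> / 2)) + ?N * (sqrt x * (x / u x))"
        by (simp add: algebra_simps)
      also have "sqrt x * x powr (- \<nu> / 2) = x powr ((1 - \<nu>) / 2)"
        using x powr_add[of x "1/2" "- \<nu> / 2"] by (simp add: powr_half_sqrt[symmetric] diff_divide_distrib)
      also have "sqrt x * (x / u x) = x powr (1 - \<nu>)"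
      proof -
        have "x powr (1 - \<nu>) = x powr (1/2 + 1 - (1/2 + \<nu>))" by simp
        also have "\<dots> = x powr (1/2) * x powr 1 / x powr (1/2 + \<nu>)" unfolding powr_diff powr_add ..
        finally show ?thesis using x by (simp add: u_def powr_half_sqrt)
      qed
      finally show "norm (Bk x) \<le> ?N * (3 * C) * x powr ((1 - \<nu>) / 2) + ?N * x powr (1 - \<nu>)"
        using bound[of x "k' x" "k x"] x by (simp add: Bk_def)
    qed
    show "((\<lambda>x. ?N * (3 * C) * x powr ((1 - \<nu>) / 2) + ?N * x powr (1 - \<nu>)) \<longlongrightarrow> 0) (at_right 0)"
      using nu by (intro tendsto_add_zero tendsto_mult_right_zero powr_tendsto_0_at_right) auto
  qed
  have Zx: "Z v x = - Bk x" if x: "0 < x" "x \<le> b" for x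
    using brk[OF k_deriv k'_deriv, of x b] x fb by (simp add: Z_def Bk_def)
  have limZ: "(Z v \<longlongrightarrow> Z v 0) (at_right 0)" and limY: "(Y 0 v \<longlongrightarrow> Y 0 v 0) (at_right 0)"
    using continuous_Z[OF v] continuous_Y[OF v, of 0] b_pos
    by (auto simp: continuous_on_def at_within_Icc_at_right dest!: bspec[of _ _ 0])
  have "((\<lambda>x. - Bk x) \<longlongrightarrow> - 0) (at_right 0)" by (intro tendsto_minus Bk0)
  moreover have "eventually (\<lambda>x. - Bk x = Z v x) (at_right 0)"
    unfolding eventually_at_right[OF b_pos] using Zx b_pos by (intro exI[of _ b]) auto
  ultimately have "(Z v \<longlongrightarrow> 0) (at_right 0)" by (simp add: tendsto_cong)
  then show "Z v 0 = 0" using limZ by (intro tendsto_unique[of "at_right 0"]) auto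
  fix x assume x: "0 < x" "x < b"
  have "eventually (\<lambda>y. Y 0 v x - Y 0 v y = Bu x - Bu y) (at_right 0)"
    unfolding eventually_at_right[OF x(1)]
  proof (intro exI[of _ x] conjI x allI impI)
    fix y assume y: "0 < y" "y < x"
    show "Y 0 v x - Y 0 v y = Bu x - Bu y"
      using Y_increment[OF v, of y x 0] brk[OF u_deriv u'_deriv, of y x] x y by (simp add: Bu_def)
  qed
  moreover have "((\<lambda>y. Bu x - Bu y) \<longlongrightarrow> Bu x - 0) (at_right 0)" by (intro tendsto_intros Bu0)
  ultimately have "((\<lambda>y. Y 0 v x - Y 0 v y) \<longlongrightarrow> Bu x - 0) (at_right 0)" by (simp add: tendsto_cong)
  moreover have "((\<lambda>y. Y 0 v x - Y 0 v y) \<longlongrightarrow> Y 0 v x - Y 0 v 0) (at_right 0)" by (intro tendsto_intros limY)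
  ultimately have "Bu x - 0 = Y 0 v x - Y 0 v 0" by (intro tendsto_unique[of "at_right 0"]) auto
  then have Yx: "Y 0 v x = Bu x" by simp
  have "complex_of_real (k x * u' x - u x * k' x) = 1" using wronskian[of x] x by simp
  then have W: "ck x * of_real (u' x) - cu x * of_real (k' x) = 1" by simp
  have Zx': "Z v x = f1 x * ck x - f x * of_real (k' x)"
    using Zx[of x] x by (simp add: Bk_def)
  have "sol 0 v x = f x * (ck x * of_real (u' x) - cu x * of_real (k' x))"
    unfolding sol_def Yx Bu_def Zx' by (simp add: algebra_simps)
  then show "f x = sol 0 v x" unfolding W by simp
qed

lemma bessel_operatorD:
  assumes "(f, v) \<in> A"
  shows "f \<in> L2 M" "v \<in> L2 M" "Z v 0 = 0" "ae_equal M f (sol 0 v)"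
proof -
  obtain h h1 h2 where H: "H2_function b h h1 h2" "h 0 = 0" "h1 0 = 0" "h b = 0"
    and f: "ae_equal M f h" and v: "ae_equal M v (\<lambda>x. - h2 x + of_real (q x) * h x)"
    using assms unfolding bessel_operator_def q_def by auto
  let ?v = "\<lambda>x. - h2 x + of_real (q x) * h x"
  note D = H2_function_eq_sol[OF H]
  show vL: "v \<in> L2 M" using L2_interval_ae[OF D(1) ae_equal_sym[OF v]] by simp
  show "Z v 0 = 0" using sol_cong_ae(2)[OF v, of 0] D(2) b_pos by simp
  have "ae_equal M h (sol 0 v)"
    using D(3) sol_cong_ae(3)[OF v] by (intro ae_equalI) auto
  then show fs: "ae_equal M f (sol 0 v)" using f ae_equal_trans by blast
  show "f \<in> L2 M" using L2_interval_ae[OF sol_L2[OF vL] ae_equal_sym[OF fs]] by simp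
qed

text \<open>Right-hand sides that vanish near \<open>0\<close> and are orthogonal to \<open>k\<close> lie in the range of \<open>A\<close>, since the
  corresponding solution vanishes near \<open>0\<close>.\<close>

lemma sol_in_bessel_operator:
  assumes h: "h \<in> L2 M" and \<delta>: "0 < \<delta>" "\<delta> < b" and h0: "\<And>x. x \<le> \<delta> \<Longrightarrow> h x = 0" and Z0: "Z h 0 = 0"
  shows "(sol 0 h, h) \<in> A"
proof -
  have Yz: "Y 0 h x = 0" if x: "x \<le> \<delta>" for x
  proof -
    have "integral {0..x} (\<lambda>t. cu t * h t) = integral {0..x} (\<lambda>t. 0)"
      using x h0 by (intro integral_cong) auto
    then show ?thesis by (simp add: Y_def)
  qed
  have Zz: "Z h x = 0" if x: "0 \<le> x" "x \<le> \<delta>" for x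
  proof -
    have "integral {0..x} (\<lambda>t. - (ck t * h t)) = integral {0..x} (\<lambda>t. 0)"
      using x h0 by (intro integral_cong) auto
    then show ?thesis using Z_increment[OF h, of 0 x] Z0 x \<delta> by simp
  qed
  have sz: "sol 0 h x = 0" "sol' 0 h x = 0" if "0 \<le> x" "x \<le> \<delta>" for x
    using Yz Zz that by (auto simp: sol_def sol'_alt)
  define f f1 f2 where "f = (\<lambda>x. if x \<le> \<delta> then 0 else sol 0 h x)"
    and "f1 = (\<lambda>x. if x \<le> \<delta> then 0 else sol' 0 h x)"
    and "f2 = (\<lambda>x. if x \<le> \<delta> then 0 else of_real (q x) * sol 0 h x - h x)"
  have f2L: "f2 \<in> L2 M"
  proof -
    have "continuous_on {0..b} (\<lambda>x. complex_of_real (q (max \<delta> x)))"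
      unfolding q_def using \<delta> by (intro continuous_intros) auto
    then have "(\<lambda>x. sol 0 h x * of_real (q (max \<delta> x)) - h x) \<in> L2 M"
      by (intro L2_diff L2_mult_continuous sol_L2 h)
    then have "(\<lambda>x. if x \<le> \<delta> then 0 else sol 0 h x * of_real (q (max \<delta> x)) - h x) \<in> L2 M"
      by (rule L2_interval_restrict)
    also have "(\<lambda>x. if x \<le> \<delta> then 0 else sol 0 h x * of_real (q (max \<delta> x)) - h x) = f2"
      by (auto simp: f2_def fun_eq_iff max_def mult.commute)
    finally show ?thesis .
  qed
  have f2a: "f2 absolutely_integrable_on {0..b}" by (rule L2_absolutely_integrable[OF b_pos f2L])
  have split: "integral {0..x} p = integral {\<delta>..x} p"
    if "p integrable_on {0..b}" "x \<in> {\<delta>..b}" "\<And>t. t \<le> \<delta> \<Longrightarrow> p t = 0" for p :: "real \<Rightarrow> complex" and x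
  proof -
    have "p integrable_on {0..x}" using that(1,2) \<delta> by (auto intro: integrable_on_subinterval)
    then have "integral {0..\<delta>} p + integral {\<delta>..x} p = integral {0..x} p"
      using that(2) \<delta> by (intro Henstock_Kurzweil_Integration.integral_combine) auto
    moreover have "integral {0..\<delta>} p = integral {0..\<delta>} (\<lambda>t. 0)"
      using that(3) by (intro integral_cong) auto
    ultimately show ?thesis by simp
  qed
  have early: "integral {0..x} p = 0" if "x \<le> \<delta>" "\<And>t. t \<le> \<delta> \<Longrightarrow> p t = 0" for p :: "real \<Rightarrow> complex" and x
  proof -
    have "integral {0..x} p = integral {0..x} (\<lambda>t. 0)"
      using that by (intro integral_cong) auto
    then show ?thesis by simp
  qed
  have e1: "f1 x = f1 0 + integral {0..x} f2" if x: "x \<in> {0..b}" for x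
  proof (cases "x \<le> \<delta>")
    case True
    then show ?thesis using early[of x f2] \<delta> by (simp add: f1_def f2_def)
  next
    case False
    have "integral {0..x} f2 = integral {\<delta>..x} f2"
      using f2a False x by (intro split) (auto simp: f2_def absolutely_integrable_on_def)
    also have "\<dots> = integral {\<delta>..x} (\<lambda>t. of_real (q t) * sol 0 h t - h t)"
      using sz(1)[of \<delta>] h0[of \<delta>] \<delta> by (intro integral_cong) (auto simp: f2_def)
    also have "\<dots> = sol' 0 h x"
      using sol_increments(2)[OF h \<delta>(1), of x 0] False x sz(2)[of \<delta>] \<delta> by simp
    finally show ?thesis using False \<delta> by (simp add: f1_def)
  qed
  have f1i: "f1 integrable_on {0..b}"
    by (intro integrable_continuous_real indefinite_integral_continuous[OF f2a e1])
  have e0: "f x = f 0 + integral {0..x} f1" if x: "x \<in> {0..b}" for x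
  proof (cases "x \<le> \<delta>")
    case True
    then show ?thesis using early[of x f1] \<delta> by (simp add: f_def f1_def)
  next
    case False
    have "integral {0..x} f1 = integral {\<delta>..x} f1"
      using f1i False x by (intro split) (auto simp: f1_def)
    also have "\<dots> = integral {\<delta>..x} (sol' 0 h)"
      using sz(2)[of \<delta>] \<delta> by (intro integral_cong) (auto simp: f1_def)
    also have "\<dots> = sol 0 h x"
      using sol_increments(1)[OF h \<delta>(1), of x 0] False x sz(1)[of \<delta>] \<delta> by simp
    finally show ?thesis using False \<delta> by (simp add: f_def)
  qed
  have "H2_function b f f1 f2" using H2_functionI[OF b_pos f2L e1 e0] .
  moreover have "f 0 = 0" "f1 0 = 0" "f b = 0" using \<delta> by (auto simp: f_def f1_def sol_def)
  moreover have "ae_equal M (sol 0 h) f" using sz(1) by (intro ae_equalI) (auto simp: f_def)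
  moreover have "ae_equal M h (\<lambda>x. - f2 x + of_real (q x) * f x)"
    using h0 by (intro ae_equalI) (auto simp: f_def f2_def)
  ultimately show ?thesis unfolding bessel_operator_def q_def by blast
qed

text \<open>If \<open>g = A\<^sup>* f\<close>, then \<open>f - sol 0 g\<close> is orthogonal to the range of \<open>A\<close>. On every \<open>(\<delta>, b)\<close> this range
  contains the orthogonal complement of \<open>k\<close>, so \<open>f - sol 0 g\<close> is a multiple of \<open>k\<close> there. The factor
  does not depend on \<open>\<delta>\<close>.\<close>

lemma orthogonal_to_range_imp_multiple_of_k:
  assumes f: "f \<in> L2 M" and orth: "\<And>h. (sol 0 h, h) \<in> A \<Longrightarrow> l2_inner M h f = 0"
  shows "\<exists>c. ae_equal M f (\<lambda>x. c * ck x)"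
proof -
  have on_tail: "\<exists>c. AE x in M. \<delta> < x \<longrightarrow> f x = c * ck x" if \<delta>: "0 < \<delta>" "\<delta> < b" for \<delta>
  proof -
    define P :: "(real \<Rightarrow> complex) \<Rightarrow> real \<Rightarrow> complex" where "P g = (\<lambda>x. if x \<le> \<delta> then 0 else g x)" for g
    have PL: "P g \<in> L2 M" if "g \<in> L2 M" for g unfolding P_def by (rule L2_interval_restrict[OF that])
    define n where "n = l2_inner M (P ck) ck"
    have "n = l2_inner M (P ck) (P ck)"
      unfolding n_def l2_inner_def by (intro Bochner_Integration.integral_cong) (auto simp: P_def)
    then have n: "n = of_real ((l2_norm M (P ck))\<^sup>2)" by (simp only: l2_inner_self)
    have n0: "n \<noteq> 0"
    proof
      assume "n = 0"
      then have "ae_equal M (P ck) (\<lambda>x. 0)" using n by (intro l2_norm_eq_0 PL k_L2) simp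
      then have "\<exists>x\<in>{\<delta><..<b}. P ck x = 0"
        unfolding ae_equal_def using \<delta> by (intro AE_interval_witness[where a = 0 and b = b]) auto
      then obtain x where "\<delta> < x" "x < b" "k x = 0" by (auto simp: P_def)
      then show False using k_pos[of x] \<delta> by simp
    qed
    define c where "c = l2_inner M (P f) ck / n"
    define h where "h = (\<lambda>x. P f x - c * P ck x)"
    have hL: "h \<in> L2 M" unfolding h_def by (intro L2_diff L2_cmult PL f k_L2)
    have hk: "l2_inner M h ck = 0"
    proof -
      have "l2_inner M h ck = l2_inner M (P f) ck - c * n"
        unfolding h_def n_def using PL f k_L2
        by (simp only: l2_inner_diff_left L2_cmult l2_inner_cmult_left)
      then show ?thesis using n0 by (simp add: c_def)
    qed
    then have Zh: "Z h 0 = 0" by (simp only: Z_0[OF hL])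
    have "(sol 0 h, h) \<in> A"
      by (rule sol_in_bessel_operator[OF hL \<delta> _ Zh]) (simp add: h_def P_def)
    then have "l2_inner M h f = 0" by (rule orth)
    then have "l2_inner M h (\<lambda>x. f x - c * ck x) = 0"
      using hk hL f k_L2 by (simp add: l2_inner_diff_right L2_cmult l2_inner_cmult_right)
    moreover have "l2_inner M h (\<lambda>x. f x - c * ck x) = l2_inner M h h"
      unfolding l2_inner_def by (intro Bochner_Integration.integral_cong) (auto simp: h_def P_def)
    ultimately have "l2_norm M h = 0" by (simp add: l2_inner_self)
    then have "AE x in M. h x = 0" using l2_norm_eq_0[OF hL] by (simp add: ae_equal_def)
    then have "AE x in M. \<delta> < x \<longrightarrow> f x = c * ck x"
      by (rule AE_mp) (auto intro!: AE_I2 simp: h_def P_def)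
    then show ?thesis by blast
  qed
  obtain c where c: "AE x in M. b/2 < x \<longrightarrow> f x = c * ck x"
    using on_tail[of "b/2"] b_pos by auto
  have each: "AE x in M. \<delta> < x \<longrightarrow> f x = c * ck x" if \<delta>: "0 < \<delta>" "\<delta> < b" for \<delta>
  proof -
    obtain d where d: "AE x in M. \<delta> < x \<longrightarrow> f x = d * ck x" using on_tail[OF \<delta>] by blast
    have "AE x in M. (b/2 < x \<longrightarrow> f x = c * ck x) \<and> (\<delta> < x \<longrightarrow> f x = d * ck x)"
      using c d by (rule AE_conjI)
    then have "\<exists>x\<in>{max \<delta> (b/2)<..<b}. (b/2 < x \<longrightarrow> f x = c * ck x) \<and> (\<delta> < x \<longrightarrow> f x = d * ck x)"
      using \<delta> b_pos by (intro AE_interval_witness[where a = 0 and b = b]) auto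
    then obtain x where x: "\<delta> < x" "b/2 < x" "x < b" "c * ck x = d * ck x" by auto
    then have "c = d" using k_pos[of x] \<delta> by auto
    then show ?thesis using d by simp
  qed
  have "AE x in M. \<forall>n. b / (real n + 2) < x \<longrightarrow> f x = c * ck x"
    unfolding AE_all_countable
  proof
    fix n show "AE x in M. b / (real n + 2) < x \<longrightarrow> f x = c * ck x"
      using b_pos by (intro each) (auto simp: field_simps add_pos_nonneg)
  qed
  then have "AE x in M. f x = c * ck x"
  proof (rule AE_mp, intro AE_I2 impI)
    fix x assume x: "x \<in> space M" and all: "\<forall>n. b / (real n + 2) < x \<longrightarrow> f x = c * ck x"
    obtain n where "b / x \<le> real n" using real_arch_simple by blast
    then have "b / x < real n + 2" by linarith
    then have "b / (real n + 2) < x" using x by (simp add: field_simps)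
    then show "f x = c * ck x" using all by blast
  qed
  then show ?thesis by (auto simp: ae_equal_def)
qed

lemma adjoint_iff:
  "(f, g) \<in> op_adjoint M A \<longleftrightarrow> f \<in> L2 M \<and> g \<in> L2 M \<and> (\<exists>a. ae_equal M f (sol a g))"
proof safe
  assume fg: "(f, g) \<in> op_adjoint M A"
  then show f: "f \<in> L2 M" and g: "g \<in> L2 M" by (auto simp: op_adjoint_def)
  define f0 where "f0 = (\<lambda>x. f x - sol 0 g x)"
  have f0L: "f0 \<in> L2 M" unfolding f0_def by (intro L2_diff sol_L2 f g)
  have "l2_inner M h f0 = 0" if h: "(sol 0 h, h) \<in> A" for h
  proof -
    have "l2_inner M h f = l2_inner M (sol 0 h) g" using fg h by (auto simp: op_adjoint_def)
    moreover have "l2_inner M h (sol 0 g) - l2_inner M (sol 0 h) g = 0"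
      using sol_green[OF bessel_operatorD(2)[OF h] g, of 0 0] by simp
    ultimately show ?thesis
      using bessel_operatorD(2)[OF h] f g by (simp add: f0_def l2_inner_diff_right sol_L2)
  qed
  then obtain c where c: "ae_equal M f0 (\<lambda>x. c * ck x)"
    using orthogonal_to_range_imp_multiple_of_k[OF f0L] by blast
  have "ae_equal M f (sol c g)"
    using c unfolding ae_equal_def by (rule AE_mp) (auto intro!: AE_I2 simp: f0_def sol_eq_k_plus[of c] diff_eq_eq)
  then show "\<exists>a. ae_equal M f (sol a g)" ..
next
  fix a assume f: "f \<in> L2 M" and g: "g \<in> L2 M" and fa: "ae_equal M f (sol a g)"
  have "l2_inner M v f = l2_inner M u g" if uv: "(u, v) \<in> A" for u v
  proof -
    note D = bessel_operatorD[OF uv]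
    have "l2_inner M v f = l2_inner M v (sol a g)"
      using D f g fa by (intro l2_inner_cong_ae sol_L2) auto
    moreover have "l2_inner M u g = l2_inner M (sol 0 v) g"
      using D g by (intro l2_inner_cong_ae sol_L2) auto
    ultimately show ?thesis using sol_green[OF D(2) g, of a 0] D(3) by simp
  qed
  then show "(f, g) \<in> op_adjoint M A" using f g by (auto simp: op_adjoint_def)
qed

end

section \<open>Boundary values\<close>

lemma C1_rep_cong:
  assumes "ae_equal (lebesgue_Ioo0 b) f g"
  shows "C1_rep b f = C1_rep b g"
proof -
  have "ae_equal (lebesgue_Ioo0 b) f h \<longleftrightarrow> ae_equal (lebesgue_Ioo0 b) g h" for h
    using assms ae_equal_sym ae_equal_trans by blast
  then show ?thesis by (simp add: C1_rep_def)
qed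

context bessel
begin

text \<open>Two continuous representatives of one class agree on \<open>(0, b)\<close>, and so do their derivatives.\<close>

lemma C1_rep_eq_sol:
  assumes g: "g \<in> L2 M" and f: "ae_equal M f (sol a g)" and x: "0 < x" "x < b"
  shows "C1_rep b f x = sol a g x" and "vector_derivative (C1_rep b f) (at x) = sol' a g x"
proof -
  have c': "continuous_on {0<..<b} (sol' a g)"
    by (rule continuous_on_subset[OF continuous_on_sol'[OF g]]) auto
  have "sol a g C1_differentiable_on {0<..<b}"
    unfolding C1_differentiable_on_def using sol_deriv[OF g] c' by (intro exI[of _ "sol' a g"]) auto
  then have ex: "sol a g C1_differentiable_on {0<..<b} \<and> ae_equal M f (sol a g)" using f by blast
  have R: "C1_rep b f C1_differentiable_on {0<..<b} \<and> ae_equal M f (C1_rep b f)"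
    unfolding C1_rep_def by (rule someI[of _ "sol a g"]) (rule ex)
  have eq: "C1_rep b f y = sol a g y" if "y \<in> {0<..<b}" for y
  proof (rule continuous_ae_equal_imp_equal[where a = 0 and b = b])
    show "ae_equal M (C1_rep b f) (sol a g)" using R f ae_equal_sym ae_equal_trans by blast
    show "continuous_on {0<..<b} (C1_rep b f)" "continuous_on {0<..<b} (sol a g)"
      using R ex C1_differentiable_imp_continuous_on by blast+
  qed (rule that)
  then show "C1_rep b f x = sol a g x" using x by simp
  have "(C1_rep b f has_vector_derivative sol' a g x) (at x)"
    by (rule has_vector_derivative_transform_within_open[OF sol_deriv[OF g x], where S = "{0<..<b}"])
      (use x eq in auto)
  then show "vector_derivative (C1_rep b f) (at x) = sol' a g x" by (rule vector_derivative_at)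
qed

text \<open>On a function that agrees with \<open>p u + r k\<close> on \<open>(0, b)\<close> the bracket is a combination of \<open>Y\<close> and \<open>Z\<close>, which
  are continuous up to \<open>0\<close>.\<close>

lemma bracket0_sol:
  assumes g: "g \<in> L2 M" and f: "ae_equal M f (sol a g)"
    and w: "\<And>x. 0 < x \<Longrightarrow> x < b \<Longrightarrow> w x = p * u x + r * k x"
  shows "bracket0 b f (\<lambda>x. of_real (w x)) = of_real p * a - of_real r * Z g 0"
proof -
  let ?L = "lagrange_bracket (C1_rep b f) (\<lambda>x. of_real (w x))"
  have L: "of_real p * Y a g x - of_real r * Z g x = ?L x" if x: "0 < x" "x < b" for x
  proof -
    have "((\<lambda>x. p * u x + r * k x) has_real_derivative p * u' x + r * k' x) (at x)"
      by (intro DERIV_add DERIV_cmult u_deriv k_deriv x)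
    then have "((\<lambda>x. complex_of_real (p * u x + r * k x)) has_vector_derivative of_real (p * u' x + r * k' x)) (at x)"
      by (rule has_vector_derivative_of_real)
    then have "((\<lambda>x. complex_of_real (w x)) has_vector_derivative of_real (p * u' x + r * k' x)) (at x)"
      by (rule has_vector_derivative_transform_within_open[where S = "{0<..<b}"]) (use x w in auto)
    then have d: "vector_derivative (\<lambda>x. complex_of_real (w x)) (at x) = of_real (p * u' x + r * k' x)"
      by (rule vector_derivative_at)
    have "?L x = of_real p * (sol a g x * of_real (u' x) - sol' a g x * cu x)
        + of_real r * (sol a g x * of_real (k' x) - sol' a g x * ck x)"
      unfolding lagrange_bracket_def d C1_rep_eq_sol[OF g f x] w[OF x] by (simp add: algebra_simps)
    then show ?thesis using bracket_sol_u[OF x(1)] bracket_sol_k[OF x(1)] by simp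
  qed
  have "(Y a g \<longlongrightarrow> Y a g 0) (at_right 0)" "(Z g \<longlongrightarrow> Z g 0) (at_right 0)"
    using continuous_Y[OF g, of a] continuous_Z[OF g] b_pos
    by (auto simp: continuous_on_def at_within_Icc_at_right dest!: bspec[of _ _ 0])
  then have "((\<lambda>x. of_real p * Y a g x - of_real r * Z g x) \<longlongrightarrow> of_real p * Y a g 0 - of_real r * Z g 0) (at_right 0)"
    by (intro tendsto_intros)
  moreover have "eventually (\<lambda>x. of_real p * Y a g x - of_real r * Z g x = ?L x) (at_right 0)"
    unfolding eventually_at_right[OF b_pos] using L b_pos by (intro exI[of _ b]) auto
  ultimately have "(?L \<longlongrightarrow> of_real p * a - of_real r * Z g 0) (at_right 0)"
    by (simp add: tendsto_cong)
  then show ?thesis unfolding bracket0_def by (intro tendsto_Lim) auto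
qed

text \<open>The quotient \<open>\<Gamma>\<^sub>1 k / \<Gamma>\<^sub>0 k\<close>. Replacing \<open>\<Gamma>\<^sub>1\<close> by \<open>\<Gamma>\<^sub>1 - m\<^sub>0 \<Gamma>\<^sub>0\<close> makes \<open>k\<close> an element of its kernel.\<close>

definition m0 :: real where
  "m0 = (if \<nu> = 0 then ln b else - (b powr (- 2 * \<nu>)) / (2 * \<nu>))"

lemma Gamma0_sol:
  assumes "g \<in> L2 M" "ae_equal M f (sol a g)"
  shows "Gamma0 \<nu> b f = a"
  unfolding Gamma0_def using bracket0_sol[OF assms, of "\<lambda>x. x powr (1/2 + \<nu>)" 1 0]
  by (simp add: u_def)

lemma k_power:
  assumes "\<nu> \<noteq> 0"
  shows "2 * \<nu> * k x = u x * x powr (- 2 * \<nu>) - u x * b powr (- 2 * \<nu>)"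
proof -
  have "2 * \<nu> * \<rho> x = x powr (- 2 * \<nu>) - b powr (- 2 * \<nu>)" using assms by (simp add: \<rho>_def)
  then have "u x * (2 * \<nu> * \<rho> x) = u x * (x powr (- 2 * \<nu>) - b powr (- 2 * \<nu>))" by simp
  then show ?thesis by (simp add: k_def right_diff_distrib mult_ac)
qed

lemma Gamma1_sol:
  assumes "g \<in> L2 M" "ae_equal M f (sol a g)"
  shows "Gamma1 \<nu> b f = of_real m0 * a + Z g 0"
proof (cases "\<nu> = 0")
  case True
  have "bracket0 b f (\<lambda>x. of_real (x powr (1/2) * ln x)) = of_real (ln b) * a - of_real (- 1) * Z g 0"
  proof (rule bracket0_sol[OF assms])
    fix x assume "0 < x" "x < b"
    then show "x powr (1/2) * ln x = ln b * u x + - 1 * k x"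
      unfolding k_def u_def \<rho>_def using True b_pos by (simp add: ln_div algebra_simps)
  qed
  then show ?thesis unfolding Gamma1_def m0_def by (simp add: True)
next
  case False
  have "bracket0 b f (\<lambda>x. of_real (x powr (1/2 - \<nu>)))
      = of_real (b powr (- 2 * \<nu>)) * a - of_real (2 * \<nu>) * Z g 0"
  proof (rule bracket0_sol[OF assms])
    fix x assume x: "0 < x" "x < b"
    have "x powr (1/2 - \<nu>) = u x * x powr (- 2 * \<nu>)"
      unfolding u_def by (simp flip: powr_add)
    then show "x powr (1/2 - \<nu>) = b powr (- 2 * \<nu>) * u x + 2 * \<nu> * k x"
      unfolding k_power[OF False] by simp
  qed
  then show ?thesis using False by (simp add: Gamma1_def m0_def field_simps)
qed

lemma A_subset_L2: "A \<subseteq> L2 M \<times> L2 M"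
  using bessel_operatorD(1,2) by auto

lemma A_subset_adjoint: "A \<subseteq> op_adjoint M A"
  unfolding subset_iff split_paired_All adjoint_iff using bessel_operatorD by blast

text \<open>The Green identity and surjectivity are insensitive to adding a real multiple of \<open>\<Gamma>\<^sub>0\<close> to \<open>\<Gamma>\<^sub>1\<close>. The
  parameter \<open>m\<close> covers the given triplet, with \<open>m = 0\<close>, and the one adapted to the Krein extension.\<close>

lemma boundary_triplet: "complex_boundary_triplet M A (Gamma0 \<nu> b) (\<lambda>f. Gamma1 \<nu> b f - of_real m * Gamma0 \<nu> b f)"
  (is "complex_boundary_triplet M A ?G0 ?G1")
proof -
  have G: "?G0 f = a" "?G1 f = of_real (m0 - m) * a + Z g 0"
    if "g \<in> L2 M" "ae_equal M f (sol a g)" for f a g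
    using Gamma0_sol[OF that] Gamma1_sol[OF that] by (simp_all add: algebra_simps)
  have Zadd: "Z (\<lambda>x. g x + g' x) 0 = Z g 0 + Z g' 0" if "g \<in> L2 M" "g' \<in> L2 M" for g g'
    using that by (simp add: Z_0 L2_add l2_inner_add_left k_L2)
  have Zmult: "Z (\<lambda>x. c * g x) 0 = c * Z g 0" if "g \<in> L2 M" for g c
    using that by (simp add: Z_0 L2_cmult l2_inner_cmult_left)
  show ?thesis
    unfolding complex_boundary_triplet_def
  proof (intro conjI)
    show "\<forall>\<Gamma>\<in>{?G0, ?G1}. \<forall>f\<in>Domain (op_adjoint M A). \<forall>g\<in>Domain (op_adjoint M A).
        (ae_equal M f g \<longrightarrow> \<Gamma> f = \<Gamma> g) \<and>
        \<Gamma> (\<lambda>x. f x + g x) = \<Gamma> f + \<Gamma> g \<and>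
        (\<forall>c. \<Gamma> (\<lambda>x. c * f x) = c * \<Gamma> f)"
    proof (intro ballI conjI)
      fix \<Gamma> f g assume \<Gamma>: "\<Gamma> \<in> {?G0, ?G1}" and f: "f \<in> Domain (op_adjoint M A)" and g: "g \<in> Domain (op_adjoint M A)"
      show "ae_equal M f g \<longrightarrow> \<Gamma> f = \<Gamma> g"
      proof
        assume "ae_equal M f g"
        then have "bracket0 b f = bracket0 b g" by (simp add: bracket0_def C1_rep_cong fun_eq_iff)
        then show "\<Gamma> f = \<Gamma> g" using \<Gamma> by (auto simp: Gamma0_def Gamma1_def)
      qed
      obtain f' a where f': "f' \<in> L2 M" "ae_equal M f (sol a f')" using f by (auto simp: adjoint_iff)
      obtain g' a' where g': "g' \<in> L2 M" "ae_equal M g (sol a' g')" using g by (auto simp: adjoint_iff)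
      have "ae_equal M (\<lambda>x. sol a f' x + sol a' g' x) (sol (a + a') (\<lambda>x. f' x + g' x))"
        using sol_add[OF f'(1) g'(1)] by (intro ae_equalI) simp
      then have "ae_equal M (\<lambda>x. f x + g x) (sol (a + a') (\<lambda>x. f' x + g' x))"
        using ae_equal_trans[OF ae_equal_add[OF f'(2) g'(2)]] by blast
      from G[OF L2_add[OF f'(1) g'(1)] this] show "\<Gamma> (\<lambda>x. f x + g x) = \<Gamma> f + \<Gamma> g"
        using \<Gamma> G[OF f'] G[OF g'] Zadd[OF f'(1) g'(1)] by (auto simp: algebra_simps)
      show "\<forall>c. \<Gamma> (\<lambda>x. c * f x) = c * \<Gamma> f"
      proof
        fix c
        have "ae_equal M (\<lambda>x. c * f x) (sol (c * a) (\<lambda>x. c * f' x))"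
          using ae_equal_cmult[OF f'(2), of c] by (simp add: sol_cmult[abs_def])
        from G[OF L2_cmult[OF f'(1)] this] show "\<Gamma> (\<lambda>x. c * f x) = c * \<Gamma> f"
          using \<Gamma> G[OF f'] Zmult[OF f'(1)] by (auto simp: algebra_simps)
      qed
    qed
    have "l2_inner M f' g - l2_inner M f g' = ?G1 f * cnj (?G0 g) - ?G0 f * cnj (?G1 g)"
      if ff': "(f, f') \<in> op_adjoint M A" "(g, g') \<in> op_adjoint M A" for f f' g g'
    proof -
      obtain a a' where f: "f \<in> L2 M" "f' \<in> L2 M" "ae_equal M f (sol a f')"
        and g: "g \<in> L2 M" "g' \<in> L2 M" "ae_equal M g (sol a' g')"
        using ff' unfolding adjoint_iff by blast
      have "l2_inner M f' g = l2_inner M f' (sol a' g')" "l2_inner M f g' = l2_inner M (sol a f') g'"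
        using f g by (auto intro!: l2_inner_cong_ae sol_L2)
      then show ?thesis
        using sol_green[OF f(2) g(2), of a' a]
        unfolding G(2)[OF f(2,3)] G(2)[OF g(2,3)]
        unfolding G(1)[OF f(2,3)] G(1)[OF g(2,3)] by (simp add: algebra_simps)
    qed
    then show "\<forall>(f, f')\<in>op_adjoint M A. \<forall>(g, g')\<in>op_adjoint M A.
        l2_inner M f' g - l2_inner M f g' = ?G1 f * cnj (?G0 g) - ?G0 f * cnj (?G1 g)" by fast
    show "(\<lambda>f. (?G0 f, ?G1 f)) ` Domain (op_adjoint M A) = UNIV"
    proof (intro equalityI subset_UNIV subsetI)
      fix z :: "complex \<times> complex"
      obtain a s where z: "z = (a, s)" by fastforce
      \<comment> \<open>a multiple of \<open>k\<close> as right-hand side realises any value of \<open>\<langle>g, k\<rangle>\<close>\<close>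
      define n where "n = l2_inner M ck ck"
      have n0: "n \<noteq> 0"
      proof
        assume "n = 0"
        then have "l2_norm M ck = 0" by (simp add: n_def l2_inner_self)
        then have "AE x in M. ck x = 0" using l2_norm_eq_0[OF k_L2] by (simp add: ae_equal_def)
        then have "\<exists>x\<in>{0<..<b}. ck x = 0"
          using b_pos by (intro AE_interval_witness[where a = 0 and b = b]) auto
        then show False using k_pos by fastforce
      qed
      define c where "c = (s - of_real (m0 - m) * a) / n"
      define g where "g = (\<lambda>x. c * ck x)"
      have g: "g \<in> L2 M" unfolding g_def by (intro L2_cmult k_L2)
      have "Z g 0 = c * n" unfolding Z_0[OF g] by (simp add: g_def l2_inner_cmult_left n_def)
      then have Zg: "Z g 0 = s - of_real (m0 - m) * a" using n0 by (simp add: c_def)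
      have "(sol a g, g) \<in> op_adjoint M A" unfolding adjoint_iff using g sol_L2[OF g] ae_equal_refl by blast
      then have "sol a g \<in> Domain (op_adjoint M A)" by auto
      moreover have "(?G0 (sol a g), ?G1 (sol a g)) = z"
        using G[OF g ae_equal_refl] unfolding z Zg by simp
      ultimately show "z \<in> (\<lambda>f. (?G0 f, ?G1 f)) ` Domain (op_adjoint M A)" by force
    qed
  qed
qed

text \<open>Expanding \<open>f = a k + sol 0 g\<close> in \<open>\<langle>g, f\<rangle>\<close> splits off the boundary term \<open>\<langle>g, k\<rangle> cnj a\<close>; the remaining term
  is the nonnegative energy.\<close>

lemma form_lower_bound:
  assumes "(f, g) \<in> op_adjoint M A"
  shows "Re ((Gamma1 \<nu> b f - of_real m0 * Gamma0 \<nu> b f) * cnj (Gamma0 \<nu> b f)) \<le> Re (l2_inner M g f)"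
proof -
  obtain a where f: "f \<in> L2 M" and g: "g \<in> L2 M" and fa: "ae_equal M f (sol a g)"
    using assms unfolding adjoint_iff by blast
  have "l2_inner M g f = l2_inner M g (sol a g)"
    using f g fa by (intro l2_inner_cong_ae sol_L2) auto
  also have "sol a g = (\<lambda>x. a * ck x + sol 0 g x)"
    by (rule ext) (rule sol_eq_k_plus)
  also have "l2_inner M g (\<lambda>x. a * ck x + sol 0 g x) = cnj a * Z g 0 + l2_inner M g (sol 0 g)"
    using g by (simp add: l2_inner_add_right L2_cmult k_L2 sol_L2 l2_inner_cmult_right Z_0)
  finally show ?thesis
    using energy_nonneg[OF g] by (simp add: Gamma0_sol[OF g fa] Gamma1_sol[OF g fa] mult.commute)
qed

lemma bessel_operator_linear: "linear_operator M A"
  unfolding linear_operator_def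
proof (intro conjI)
  show "A \<subseteq> L2 M \<times> L2 M" by (rule A_subset_L2)
  have "H2_function b (\<lambda>x. 0) (\<lambda>x. 0) (\<lambda>x. 0)" by (rule H2_functionI[OF b_pos]) auto
  then show "(\<lambda>x. 0, \<lambda>x. 0) \<in> A"
    unfolding bessel_operator_def mem_Collect_eq prod.case
    by (intro exI[of _ "\<lambda>x. 0"] conjI) simp_all
  have "(\<lambda>x. f x + f' x, \<lambda>x. g x + g' x) \<in> A" if fg: "(f, g) \<in> A" "(f', g') \<in> A" for f g f' g'
  proof -
    obtain h h1 h2 where H: "H2_function b h h1 h2" "h 0 = 0" "h1 0 = 0" "h b = 0"
      and f: "ae_equal M f h" "ae_equal M g (\<lambda>x. - h2 x + of_real (q x) * h x)"
      using fg(1) unfolding bessel_operator_def q_def by auto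
    obtain h' h1' h2' where H': "H2_function b h' h1' h2'" "h' 0 = 0" "h1' 0 = 0" "h' b = 0"
      and f': "ae_equal M f' h'" "ae_equal M g' (\<lambda>x. - h2' x + of_real (q x) * h' x)"
      using fg(2) unfolding bessel_operator_def q_def by auto
    have e: "(- h2 x + of_real (q x) * h x) + (- h2' x + of_real (q x) * h' x)
        = - (h2 x + h2' x) + of_real (q x) * (h x + h' x)" for x
      by (simp add: algebra_simps)
    have "ae_equal M (\<lambda>x. g x + g' x) (\<lambda>x. - (h2 x + h2' x) + of_real (q x) * (h x + h' x))"
      using ae_equal_add[OF f(2) f'(2)] unfolding e .
    moreover have "h 0 + h' 0 = 0" "h1 0 + h1' 0 = 0" "h b + h' b = 0" using H H' by auto
    ultimately show ?thesis
      using H2_function_add[OF b_pos H(1) H'(1)] ae_equal_add[OF f(1) f'(1)]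
      unfolding bessel_operator_def q_def by blast
  qed
  then show "\<forall>(f, g)\<in>A. \<forall>(f', g')\<in>A. (\<lambda>x. f x + f' x, \<lambda>x. g x + g' x) \<in> A" by fast
  have "(\<lambda>x. c * f x, \<lambda>x. c * g x) \<in> A" if fg: "(f, g) \<in> A" for f g c
  proof -
    obtain h h1 h2 where H: "H2_function b h h1 h2" "h 0 = 0" "h1 0 = 0" "h b = 0"
      and f: "ae_equal M f h" "ae_equal M g (\<lambda>x. - h2 x + of_real (q x) * h x)"
      using fg(1) unfolding bessel_operator_def q_def by auto
    have e: "c * (- h2 x + of_real (q x) * h x) = - (c * h2 x) + of_real (q x) * (c * h x)" for x
      by (simp add: algebra_simps)
    have "ae_equal M (\<lambda>x. c * g x) (\<lambda>x. - (c * h2 x) + of_real (q x) * (c * h x))"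
      using ae_equal_cmult[OF f(2), of c] unfolding e .
    moreover have "c * h 0 = 0" "c * h1 0 = 0" "c * h b = 0" using H by auto
    ultimately show ?thesis
      using H2_function_cmult[OF b_pos H(1), of c] ae_equal_cmult[OF f(1), of c]
      unfolding bessel_operator_def q_def by blast
  qed
  then show "\<forall>(f, g)\<in>A. \<forall>c. (\<lambda>x. c * f x, \<lambda>x. c * g x) \<in> A" by fast
  have "(f', g') \<in> A" if "(f, g) \<in> A" "ae_equal M f f'" "ae_equal M g g'" for f g f' g'
    using that ae_equal_trans[OF ae_equal_sym[OF that(2)]] ae_equal_trans[OF ae_equal_sym[OF that(3)]]
    unfolding bessel_operator_def by blast
  then show "\<forall>(f, g)\<in>A. \<forall>f' g'. ae_equal M f f' \<longrightarrow> ae_equal M g g' \<longrightarrow> (f', g') \<in> A" by fast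
  have "ae_equal M g g'" if "(f, g) \<in> A" "(f', g') \<in> A" "ae_equal M f f'" for f g f' g'
    using op_adjoint_single_valued[OF bessel_operator_densely_defined[OF b_pos] A_subset_L2 _ _ that(3)]
      that A_subset_adjoint by blast
  then show "\<forall>(f, g)\<in>A. \<forall>(f', g')\<in>A. ae_equal M f f' \<longrightarrow> ae_equal M g g'" by fast
qed

lemma bessel_operator_nonneg_symmetric: "nonneg_symmetric M A"
  unfolding nonneg_symmetric_def
proof (intro conjI bessel_operator_linear bessel_operator_densely_defined b_pos A_subset_adjoint)
  have "l2_inner M g f \<in> \<real>\<^sub>\<ge>\<^sub>0" if "(f, g) \<in> A" for f g
  proof -
    note D = bessel_operatorD[OF that]
    have D': "(f, g) \<in> op_adjoint M A" using that A_subset_adjoint by blast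
    have "l2_inner M g f = l2_inner M f g" using D' that by (auto simp: op_adjoint_def)
    then have "l2_inner M g f \<in> \<real>"
      using l2_inner_commute[of M f g] by (simp add: Reals_cnj_iff)
    moreover have "0 \<le> Re (l2_inner M g f)"
      using form_lower_bound[OF D'] Gamma0_sol[OF D(2,4)] by simp
    ultimately show ?thesis by (simp add: complex_nonneg_Reals_iff complex_is_Real_iff)
  qed
  then show "nonneg_operator M A" by (auto simp: nonneg_operator_def)
qed

lemma bessel_extremal_boundary_triplet:
  "extremal_boundary_triplet M A (Gamma0 \<nu> b) (\<lambda>f. Gamma1 \<nu> b f - of_real m0 * Gamma0 \<nu> b f)"
proof
  show "nonneg_symmetric M A" by (rule bessel_operator_nonneg_symmetric)
  show "complex_boundary_triplet M A (Gamma0 \<nu> b) (\<lambda>f. Gamma1 \<nu> b f - of_real m0 * Gamma0 \<nu> b f)"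
    by (rule boundary_triplet)
  show "f' \<in> L2 M" if "f \<in> L2 M" "ae_equal M f f'" for f f'
    using L2_interval_ae[OF that] by simp
  show "Re ((Gamma1 \<nu> b f - of_real m0 * Gamma0 \<nu> b f) * cnj (Gamma0 \<nu> b f)) \<le> Re (l2_inner M g f)"
    if "(f, g) \<in> op_adjoint M A" for f g
    using form_lower_bound[OF that] .
  show "\<exists>f g. (f, g) \<in> op_adjoint M A \<and> Gamma0 \<nu> b f = 1 \<and>
      Gamma1 \<nu> b f - of_real m0 * Gamma0 \<nu> b f = of_real s \<and> Re (l2_inner M g f) < 0" if s: "s < 0" for s
  proof -
    obtain g where g: "g \<in> L2 M" "l2_inner M g ck = of_real s" "Re (l2_inner M g (sol 1 g)) < 0"
      using energy_negative_direction[OF s] by blast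
    have "(sol 1 g, g) \<in> op_adjoint M A"
      unfolding adjoint_iff using g(1) sol_L2[OF g(1)] ae_equal_refl by blast
    then show ?thesis
      using g Gamma0_sol[OF g(1) ae_equal_refl] Gamma1_sol[OF g(1) ae_equal_refl]
      by (intro exI[of _ "sol 1 g"] exI[of _ g]) (simp add: Z_0)
  qed
  show "\<exists>c>0. \<exists>\<phi>. (\<phi>, \<lambda>x. - of_real c * \<phi> x) \<in> op_adjoint M A \<and> \<not> ae_equal M \<phi> (\<lambda>x. 0)"
  proof -
    obtain c \<phi> where c: "0 < c" and \<phi>: "\<phi> \<in> L2 M" "\<not> ae_equal M \<phi> (\<lambda>x. 0)"
      and eq: "\<And>x. 0 < x \<Longrightarrow> x < b \<Longrightarrow> \<phi> x = sol 1 (\<lambda>x. - of_real c * \<phi> x) x"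
      using defect_vector by blast
    have "ae_equal M \<phi> (sol 1 (\<lambda>x. - of_real c * \<phi> x))" by (rule ae_equalI) (rule eq)
    moreover have "(\<lambda>x. - of_real c * \<phi> x) \<in> L2 M" by (rule L2_cmult[OF \<phi>(1)])
    ultimately have "(\<phi>, \<lambda>x. - of_real c * \<phi> x) \<in> op_adjoint M A"
      unfolding adjoint_iff using \<phi>(1) by blast
    then show ?thesis using c \<phi>(2) by blast
  qed
qed

text \<open>The functions in these brackets are \<open>- k\<close> for \<open>\<nu> = 0\<close> and \<open>- 2 \<nu> k\<close> for \<open>\<nu> > 0\<close>.\<close>

lemma Krein_boundary_condition:
  assumes "f \<in> Domain (op_adjoint M A)"
  shows "\<nu> = 0 \<Longrightarrow> bracket0 b f (\<lambda>x. of_real (x powr (1/2) * ln (x / b)))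
      = Gamma1 \<nu> b f - of_real m0 * Gamma0 \<nu> b f"
    and "\<nu> \<noteq> 0 \<Longrightarrow> inverse (of_real (2 * \<nu>)) *
      bracket0 b f (\<lambda>x. of_real (b powr (-2 * \<nu>) * x powr (1/2 + \<nu>) - x powr (1/2 - \<nu>)))
      = Gamma1 \<nu> b f - of_real m0 * Gamma0 \<nu> b f"
proof -
  obtain g a where g: "g \<in> L2 M" "ae_equal M f (sol a g)" using assms by (auto simp: adjoint_iff)
  have G: "Gamma1 \<nu> b f - of_real m0 * Gamma0 \<nu> b f = Z g 0"
    using Gamma0_sol[OF g] Gamma1_sol[OF g] by simp
  show "bracket0 b f (\<lambda>x. of_real (x powr (1/2) * ln (x / b))) = Gamma1 \<nu> b f - of_real m0 * Gamma0 \<nu> b f"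
    if "\<nu> = 0"
  proof -
    have "bracket0 b f (\<lambda>x. of_real (x powr (1/2) * ln (x / b))) = of_real 0 * a - of_real (- 1) * Z g 0"
    proof (rule bracket0_sol[OF g])
      fix x assume "0 < x" "x < b"
      then show "x powr (1/2) * ln (x / b) = 0 * u x + - 1 * k x"
        unfolding k_def u_def \<rho>_def using that b_pos by (simp add: ln_div algebra_simps)
    qed
    then show ?thesis unfolding G by simp
  qed
  show "inverse (of_real (2 * \<nu>)) *
      bracket0 b f (\<lambda>x. of_real (b powr (-2 * \<nu>) * x powr (1/2 + \<nu>) - x powr (1/2 - \<nu>)))
      = Gamma1 \<nu> b f - of_real m0 * Gamma0 \<nu> b f" if "\<nu> \<noteq> 0"
  proof -
    have "bracket0 b f (\<lambda>x. of_real (b powr (-2 * \<nu>) * x powr (1/2 + \<nu>) - x powr (1/2 - \<nu>)))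
        = of_real 0 * a - of_real (- (2 * \<nu>)) * Z g 0"
    proof (rule bracket0_sol[OF g])
      fix x assume x: "0 < x" "x < b"
      have "x powr (1/2 - \<nu>) = u x * x powr (- 2 * \<nu>)"
        unfolding u_def by (simp flip: powr_add)
      then have "b powr (-2 * \<nu>) * x powr (1/2 + \<nu>) - x powr (1/2 - \<nu>)
          = u x * b powr (- 2 * \<nu>) - u x * x powr (- 2 * \<nu>)"
        by (simp add: u_def mult.commute)
      then show "b powr (-2 * \<nu>) * x powr (1/2 + \<nu>) - x powr (1/2 - \<nu>) = 0 * u x + - (2 * \<nu>) * k x"
        using k_power[OF that, of x] by simp
    qed
    then show ?thesis unfolding G using that by simp
  qed
qed

lemma extensions_of_bessel_operator:
  "complex_boundary_triplet M A (Gamma0 \<nu> b) (Gamma1 \<nu> b) \<and>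
     (\<exists>!S. is_Friedrichs_extension M A S) \<and>
     (\<exists>!S. is_Krein_extension M A S) \<and>
     (Domain (Friedrichs_extension M A) = {f \<in> Domain (op_adjoint M A). Gamma0 \<nu> b f = 0}) \<and>
     ({f \<in> Domain (op_adjoint M A). Gamma0 \<nu> b f = 0} =
           {f \<in> Domain (op_adjoint M A). bracket0 b f (\<lambda>x. of_real (x powr (1/2 + \<nu>))) = 0}) \<and>
     (Domain (Krein_extension M A) =
           (if \<nu> = 0
            then {f \<in> Domain (op_adjoint M A).
                    bracket0 b f (\<lambda>x. of_real (x powr (1/2) * ln (x / b))) = 0}
            else {f \<in> Domain (op_adjoint M A).
                    inverse (of_real (2 * \<nu>)) *
                      bracket0 b f (\<lambda>x. of_real (b powr (-2 * \<nu>) * x powr (1/2 + \<nu>)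
                                                   - x powr (1/2 - \<nu>))) = 0}))"
proof -
  interpret extremal_boundary_triplet M A "Gamma0 \<nu> b" "\<lambda>f. Gamma1 \<nu> b f - of_real m0 * Gamma0 \<nu> b f"
    by (rule bessel_extremal_boundary_triplet)
  have "complex_boundary_triplet M A (Gamma0 \<nu> b) (Gamma1 \<nu> b)"
    using boundary_triplet[of 0] by simp
  moreover have "Domain (Krein_extension M A) =
           (if \<nu> = 0
            then {f \<in> Domain (op_adjoint M A).
                    bracket0 b f (\<lambda>x. of_real (x powr (1/2) * ln (x / b))) = 0}
            else {f \<in> Domain (op_adjoint M A).
                    inverse (of_real (2 * \<nu>)) *
                      bracket0 b f (\<lambda>x. of_real (b powr (-2 * \<nu>) * x powr (1/2 + \<nu>)
                                                   - x powr (1/2 - \<nu>))) = 0})"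
  proof (cases "\<nu> = 0")
    case True
    show ?thesis
      unfolding if_P[OF True] extremal_extensions(4)
      by (intro Collect_cong conj_cong refl) (simp only: Krein_boundary_condition(1)[OF _ True])
  next
    case False
    show ?thesis
      unfolding if_not_P[OF False] extremal_extensions(4)
      by (intro Collect_cong conj_cong refl) (simp only: Krein_boundary_condition(2)[OF _ False])
  qed
  moreover have "{f \<in> Domain (op_adjoint M A). Gamma0 \<nu> b f = 0} =
      {f \<in> Domain (op_adjoint M A). bracket0 b f (\<lambda>x. of_real (x powr (1/2 + \<nu>))) = 0}"
    unfolding Gamma0_def ..
  ultimately show ?thesis using extremal_extensions(1-3) by blast
qed

end

theorem proposition4p4:
  fixes \<nu> b :: real
  assumes "0 \<le> \<nu>" and "\<nu> < 1" and "0 < b"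
  defines "M \<equiv> lebesgue_Ioo0 b"
    and "A \<equiv> bessel_operator \<nu> b"
  shows "complex_boundary_triplet M A (Gamma0 \<nu> b) (Gamma1 \<nu> b) \<and>
     (\<exists>!S. is_Friedrichs_extension M A S) \<and>
     (\<exists>!S. is_Krein_extension M A S) \<and>
     (Domain (Friedrichs_extension M A) = {f \<in> Domain (op_adjoint M A). Gamma0 \<nu> b f = 0}) \<and>
     ({f \<in> Domain (op_adjoint M A). Gamma0 \<nu> b f = 0} =
           {f \<in> Domain (op_adjoint M A). bracket0 b f (\<lambda>x. of_real (x powr (1/2 + \<nu>))) = 0}) \<and>
     (Domain (Krein_extension M A) =
           (if \<nu> = 0
            then {f \<in> Domain (op_adjoint M A).
                    bracket0 b f (\<lambda>x. of_real (x powr (1/2) * ln (x / b))) = 0}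
            else {f \<in> Domain (op_adjoint M A).
                    inverse (of_real (2 * \<nu>)) *
                      bracket0 b f (\<lambda>x. of_real (b powr (-2 * \<nu>) * x powr (1/2 + \<nu>)
                                                   - x powr (1/2 - \<nu>))) = 0}))"
  unfolding M_def A_def
  by (rule bessel.extensions_of_bessel_operator) (use assms in \<open>simp add: bessel_def\<close>)

end
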